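(* Let $C,G>0$, $M>1$, $Y\in(1,2)$ and $\sigma>0$. Let $S_t=S_0e^{X_t}$, $t\ge 0$, with $S_0>0$ and $X_t=L_t+\sigma W_t$, be the exponential CGMY model with an independent Brownian component described in the context (so that $\mathbb{E}(e^{X_t})=1$ for all $t\geq 0$). Let $t\mapsto\kappa_t\in\mathbb{R}$, $t\ge 0$, be a deterministic function such that $\kappa_t=o(1)$ as $t\to0$. Set $$d_1:=\frac{\sigma}{\sqrt{2\pi}},\qquad d_2:=\frac{C\,2^{\frac{1-Y}{2}}\sigma^{1-Y}}{\sqrt{\pi}\,Y(Y-1)}\,\Gamma\!\left(1-\frac Y2\right),$$ $$d_{31}:=\frac{C\,\Gamma(-Y)}{2}\left[(M-1)^Y-M^Y-(G+1)^Y+G^Y\right],$$ $$d_{32}:=-\frac1\pi\,\sigma^{1-2Y}C^2\cos^2\!\left(\frac{\pi Y}{2}\right)\Gamma^2(-Y)\,2^{Y-\frac12}\,\Gamma\!\left(Y-\frac12\right),$$ $$c_{\kappa,\sigma}(t):=\kappa_t\int_0^1\mathbb{P}\left(\sigma W_t\ge\kappa_t w\right)dw .$$ Then, as $t\to0$, $$\frac{e^{-\kappa_t}}{S_0}\,\mathbb{E}\left(\left(S_t-S_0e^{\kappa_t}\right)^+\right)+c_{\kappa,\sigma}(t)=d_1t^{\frac12}+d_2t^{\frac{3-Y}{2}}+d_{31}t+d_{32}t^{\frac52-Y}+o(\kappa_t)+o(t)+o\!\left(t^{\frac52-Y}\right),$$ where the terms $o(t)$ and $o(t^{5/2-Y})$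 do not depend on the function $\kappa_t$.
   Context: Model: on a probability space $(\Omega,\mathcal{F},\mathbb{P})$, $W=(W_t)_{t\ge0}$ is a standard Brownian motion and $L=(L_t)_{t\ge0}$ is an independent pure-jump (no Gaussian part) CGMY Lévy process with parameters $C,G,M,Y$, i.e. with Lévy measure $$\nu(dx)=C|x|^{-Y-1}\left(e^{-Mx}\mathbf 1_{\{x>0\}}+e^{Gx}\mathbf 1_{\{x<0\}}\right)dx .$$ The interest rate is zero and $\mathbb{P}$ is a martingale measure for $S_t=S_0e^{X_t}$, $X_t=L_t+\sigma W_t$; that is, the drift of $L$ is the one for which $\mathbb{E}(e^{X_t})=1$ for all $t\ge0$. Notation: $x^+:=x\mathbf 1_{\{x>0\}}$, and $\Gamma$ is the Gamma function (extended to negative non-integers). A term $o(\kappa_t)$ is a quantity $r(t)$ such that for each $\varepsilon>0$, $|r(t)|\le\varepsilon|\kappa_t|$ for all sufficiently small $t>0$. *)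

theory Defs
  imports "HOL-Probability.Probability" "HOL-Library.Landau_Symbols"
begin

text \<open>
  Processes are indexed by real numbers; only the times \<open>t \<ge> 0\<close> are ever constrained or used.
  The probability space is called \<open>P\<close>, since \<open>M\<close> is one of the CGMY parameters.
\<close>

definition indep_increments :: "'a measure \<Rightarrow> (real \<Rightarrow> 'a \<Rightarrow> real) \<Rightarrow> bool" where
  "indep_increments P X \<longleftrightarrow>
     (\<forall>(n::nat) (t::nat \<Rightarrow> real). 0 \<le> t 0 \<longrightarrow> (\<forall>i<n. t i \<le> t (Suc i)) \<longrightarrow>
        prob_space.indep_vars P (\<lambda>_. borel) (\<lambda>i \<omega>. X (t (Suc i)) \<omega> - X (t i) \<omega>) {..<n})"

definition stationary_increments :: "'a measure \<Rightarrow> (real \<Rightarrow> 'a \<Rightarrow> real) \<Rightarrow> bool" where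
  "stationary_increments P X \<longleftrightarrow>
     (\<forall>s t. 0 \<le> s \<longrightarrow> s \<le> t \<longrightarrow>
        distr P borel (\<lambda>\<omega>. X t \<omega> - X s \<omega>) = distr P borel (X (t - s)))"

definition stochastically_continuous :: "'a measure \<Rightarrow> (real \<Rightarrow> 'a \<Rightarrow> real) \<Rightarrow> bool" where
  "stochastically_continuous P X \<longleftrightarrow>
     (\<forall>t\<ge>0. \<forall>\<epsilon>>0.
        ((\<lambda>s. measure P {\<omega> \<in> space P. \<bar>X s \<omega> - X t \<omega>\<bar> > \<epsilon>}) \<longlongrightarrow> 0) (at t within {0..}))"

definition cadlag :: "(real \<Rightarrow> real) \<Rightarrow> bool" where
  "cadlag f \<longleftrightarrow>
     (\<forall>t\<ge>0. continuous (at_right t) f) \<and> (\<forall>t>0. \<exists>l. (f \<longlongrightarrow> l) (at_left t))"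

definition levy_process :: "'a measure \<Rightarrow> (real \<Rightarrow> 'a \<Rightarrow> real) \<Rightarrow> bool" where
  "levy_process P X \<longleftrightarrow>
     (\<forall>t\<ge>0. X t \<in> borel_measurable P) \<and>
     (AE \<omega> in P. X 0 \<omega> = 0) \<and>
     indep_increments P X \<and>
     stationary_increments P X \<and>
     stochastically_continuous P X \<and>
     (AE \<omega> in P. cadlag (\<lambda>t. X t \<omega>))"

definition standard_brownian_motion :: "'a measure \<Rightarrow> (real \<Rightarrow> 'a \<Rightarrow> real) \<Rightarrow> bool" where
  "standard_brownian_motion P W \<longleftrightarrow>
     (\<forall>t\<ge>0. W t \<in> borel_measurable P) \<and>
     (AE \<omega> in P. W 0 \<omega> = 0) \<and>
     indep_increments P W \<and>
     (\<forall>s t. 0 \<le> s \<longrightarrow> s < t \<longrightarrow>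
        distributed P lborel (\<lambda>\<omega>. W t \<omega> - W s \<omega>) (normal_density 0 (sqrt (t - s)))) \<and>
     (AE \<omega> in P. continuous_on {0..} (\<lambda>t. W t \<omega>))"

text \<open>Independence of the whole processes, viewed as random elements of the path space.\<close>

definition indep_processes ::
    "'a measure \<Rightarrow> (real \<Rightarrow> 'a \<Rightarrow> real) \<Rightarrow> (real \<Rightarrow> 'a \<Rightarrow> real) \<Rightarrow> bool" where
  "indep_processes P X Z \<longleftrightarrow>
     prob_space.indep_var P
       (Pi\<^sub>M {0..} (\<lambda>_. borel)) (\<lambda>\<omega>. \<lambda>t\<in>{0..}. X t \<omega>)
       (Pi\<^sub>M {0..} (\<lambda>_. borel)) (\<lambda>\<omega>. \<lambda>t\<in>{0..}. Z t \<omega>)"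

definition levy_measure :: "real measure \<Rightarrow> bool" where
  "levy_measure \<nu> \<longleftrightarrow>
     sets \<nu> = sets borel \<and> emeasure \<nu> {0} = 0 \<and>
     (\<integral>\<^sup>+x. ennreal (min 1 (x\<^sup>2)) \<partial>\<nu>) < \<infinity>"

text \<open>
  The exponent in the Levy-Khintchine formula for the triplet \<open>(b, a, \<nu>)\<close>: \<open>b\<close> is the drift
  relative to the truncation function \<open>x 1(\<bar>x\<bar> \<le> 1)\<close> and \<open>a\<close> is the Gaussian variance.
\<close>

definition levy_exponent :: "real \<Rightarrow> real \<Rightarrow> real measure \<Rightarrow> real \<Rightarrow> complex" where
  "levy_exponent b a \<nu> u =
     \<i> * of_real (b * u) - of_real (a * u\<^sup>2 / 2) +
     (\<integral>x. (iexp (u * x) - 1 - \<i> * of_real (u * x * indicator {-1..1} x)) \<partial>\<nu>)"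

definition has_levy_triplet ::
    "'a measure \<Rightarrow> (real \<Rightarrow> 'a \<Rightarrow> real) \<Rightarrow> real \<Rightarrow> real \<Rightarrow> real measure \<Rightarrow> bool" where
  "has_levy_triplet P X b a \<nu> \<longleftrightarrow>
     0 \<le> a \<and> levy_measure \<nu> \<and>
     (\<forall>t\<ge>0. \<forall>u. char (distr P borel (X t)) u = exp (of_real t * levy_exponent b a \<nu> u))"

definition cgmy_measure :: "real \<Rightarrow> real \<Rightarrow> real \<Rightarrow> real \<Rightarrow> real measure" where
  "cgmy_measure C G M Y =
     density lborel (\<lambda>x. ennreal
       (C * \<bar>x\<bar> powr (- Y - 1) *
        (exp (- M * x) * indicator {0<..} x + exp (G * x) * indicator {..<0} x)))"

text \<open>
  Pure-jump means that the Gaussian variance is zero. The parameters \<open>C, G, M, Y\<close> leave the drift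
  of a CGMY process open.
\<close>

definition cgmy_process ::
    "'a measure \<Rightarrow> real \<Rightarrow> real \<Rightarrow> real \<Rightarrow> real \<Rightarrow> (real \<Rightarrow> 'a \<Rightarrow> real) \<Rightarrow> bool" where
  "cgmy_process P C G M Y L \<longleftrightarrow>
     levy_process P L \<and> (\<exists>b. has_levy_triplet P L b 0 (cgmy_measure C G M Y))"

definition c_kappa ::
    "'a measure \<Rightarrow> (real \<Rightarrow> 'a \<Rightarrow> real) \<Rightarrow> real \<Rightarrow> (real \<Rightarrow> real) \<Rightarrow> real \<Rightarrow> real" where
  "c_kappa P W \<sigma> \<kappa> t =
     \<kappa> t * (LBINT w=0..1. measure P {\<omega> \<in> space P. \<sigma> * W t \<omega> \<ge> \<kappa> t * w})"

end

theory Submission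
  imports Defs "HOL-Complex_Analysis.Complex_Analysis" "HOL-Real_Asymp.Real_Asymp"
begin

text \<open>
  Since \<open>min (e\<^sup>x) 1 = e\<^bsup>x/2\<^esup> e\<^bsup>-|x|/2\<^esup>\<close> and \<open>e\<^bsup>-|x|/2\<^esup>\<close> is the Fourier transform of \<open>1 / (u\<^sup>2 + 1/4)\<close>,
  the at-the-money price is \<open>(2 \<pi>)\<^sup>-\<^sup>1 \<integral> (1 - E e\<^bsup>(1/2 + iu) X\<^sub>t\<^esup>) / (u\<^sup>2 + 1/4) du\<close>. The Levy-Khintchine formula extends
  to the strip \<open>0 \<le> Re z \<le> 1\<close> by pasting across the imaginary axis and analytic continuation, so the expectation is
  \<open>exp (- t \<sigma>\<^sup>2 (u\<^sup>2 + 1/4) / 2 - t \<rho> u + i t \<phi> u)\<close> with \<open>\<phi> u = O(u)\<close> and \<open>\<rho> u\<close> asymptotic to a multiple of \<open>|u|\<^sup>Y\<close>.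
  The Gaussian part alone gives the term \<open>\<surd>t\<close>, the part linear in \<open>\<rho>\<close> gives \<open>t\<^bsup>(3-Y)/2\<^esup>\<close> and, through the
  integrable difference between \<open>\<rho>\<close> and its leading power, \<open>t\<close>; the quadratic part gives \<open>t\<^bsup>5/2-Y\<^esup>\<close> after
  rescaling \<open>u = v / \<surd>t\<close>, and the phase only contributes \<open>O(t\<^bsup>3/2\<^esup>)\<close>.

  A log-strike \<open>\<kappa>\<close> changes the price by \<open>-\<kappa> \<integral>\<^sub>0\<^sup>1 P(X\<^sub>t \<ge> \<kappa> w) dw + o(\<kappa>)\<close>, and \<open>P(X\<^sub>t \<ge> c) - P(\<sigma> W\<^sub>t \<ge> c)\<close> tends
  to zero uniformly in \<open>c\<close> because \<open>L\<^sub>t / \<surd>t\<close> tends to zero in probability.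
\<close>

section \<open>Integration on the real line\<close>

text \<open>Integrations are exchanged only for nonnegative integrands, so that one iterated
  integral yields integrability and value of the other; hence \<open>1 - cos\<close> and
  \<open>1 + cos\<close> appear where a Fourier integral would have \<open>cos\<close> alone. On the
  line Re z = 1/2 the factor \<open>z\<^sup>2 - z\<close> is the real number
  \<open>- (u\<^sup>2 + 1/4)\<close>, so the Gaussian part carries no phase. Near 0 the Levy density
  has the same singularity on both half-lines; it cancels in the imaginary part of the jump
  exponent, which therefore grows only linearly. Compensating jumps by \<open>exp x - 1\<close>
  makes the jump exponent vanish at 1, and the martingale condition then fixes the remaining drift
  as \<open>- \<sigma>\<^sup>2 / 2\<close>. The coefficient of t is \<open>rho0\<close>, built from
  second differences of powers, minus C / (2 pi) times the integral of \<open>deficit\<close>; the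
  powers of M - 1/2 and G + 1/2, which only reflect the choice of the line, cancel. The remainders
  \<open>r2\<close> and \<open>r3\<close> come from the expansion at the money, where \<kappa> does
  not occur; everything depending on \<kappa> goes into the remainder of order o(\<kappa>).\<close>

lemma tonelli_has_bochner_integral:
  fixes f :: "'a \<Rightarrow> 'b \<Rightarrow> real"
  assumes "pair_sigma_finite M1 M2"
    and f [measurable]: "case_prod f \<in> borel_measurable (M1 \<Otimes>\<^sub>M M2)"
    and nonneg: "\<And>x y. 0 \<le> f x y"
    and inner: "AE x in M1. has_bochner_integral M2 (f x) (g x)"
    and outer: "has_bochner_integral M1 g I"
    and inner': "AE y in M2. has_bochner_integral M1 (\<lambda>x. f x y) (h y)"
    and h [measurable]: "h \<in> borel_measurable M2"
  shows "has_bochner_integral M2 h I"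
proof -
  interpret pair_sigma_finite M1 M2 by fact
  have g [measurable]: "g \<in> borel_measurable M1"
    using outer by (auto simp: has_bochner_integral_iff)
  have eq: "AE x in M1. g x = (\<integral>y. f x y \<partial>M2)"
    using inner by eventually_elim (simp add: has_bochner_integral_integral_eq)
  have "integrable M1 (\<lambda>x. \<integral>y. norm (case_prod f (x, y)) \<partial>M2)"
    using outer eq nonneg unfolding has_bochner_integral_iff
    by (subst integrable_cong_AE[of _ _ g]) auto
  moreover have "AE x in M1. integrable M2 (\<lambda>y. case_prod f (x, y))"
    using inner by eventually_elim (auto simp: has_bochner_integral_iff)
  ultimately have int: "integrable (M1 \<Otimes>\<^sub>M M2) (case_prod f)"
    by (intro Fubini_integrable f)
  have eq': "AE y in M2. h y = (\<integral>x. f x y \<partial>M1)"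
    using inner' by eventually_elim (simp add: has_bochner_integral_integral_eq)
  have "integrable M2 (\<lambda>y. \<integral>x. f x y \<partial>M1)"
    using integrable_snd[of "f"] int by simp
  then have "integrable M2 h"
    using eq' by (subst integrable_cong_AE[of _ _ "\<lambda>y. \<integral>x. f x y \<partial>M1"]) auto
  moreover have "(\<integral>y. h y \<partial>M2) = (\<integral>y. (\<integral>x. f x y \<partial>M1) \<partial>M2)"
    using eq' by (intro integral_cong_AE) auto
  moreover have "\<dots> = (\<integral>x. (\<integral>y. f x y \<partial>M2) \<partial>M1)"
    using Fubini_integral[of "f"] int by simp
  moreover have "\<dots> = (\<integral>x. g x \<partial>M1)"
    using eq by (intro integral_cong_AE) auto
  ultimately show ?thesis
    using outer by (simp add: has_bochner_integral_iff)
qed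

lemmas tonelli_lborel = tonelli_has_bochner_integral[OF lborel_pair.pair_sigma_finite_axioms]

text \<open>Passing to \<open>inverse t\<close> turns the limit at 0 into a limit at infinity. The
  dominating function is requested only for \<open>0 < t \<le> 1\<close>, which later allows bounds
  such as \<open>t powr Y \<le> t\<close>.\<close>

lemma dominated_convergence_at_right_0:
  fixes s :: "real \<Rightarrow> 'a \<Rightarrow> 'b::{banach, second_countable_topology}"
  assumes "f \<in> borel_measurable M" "\<And>t. s t \<in> borel_measurable M" "integrable M w"
    and "AE x in M. ((\<lambda>t. s t x) \<longlongrightarrow> f x) (at_right 0)"
    and "\<And>t. 0 < t \<Longrightarrow> t \<le> 1 \<Longrightarrow> AE x in M. norm (s t x) \<le> w x"
  shows "((\<lambda>t. \<integral>x. s t x \<partial>M) \<longlongrightarrow> (\<integral>x. f x \<partial>M)) (at_right 0)"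
  unfolding filterlim_at_right_to_top
proof (rule integral_dominated_convergence_at_top[where w = w])
  show "AE x in M. ((\<lambda>i. s (inverse i) x) \<longlongrightarrow> f x) at_top"
    using assms(4) by (simp add: filterlim_at_right_to_top)
  show "\<forall>\<^sub>F i in at_top. AE x in M. norm (s (inverse i) x) \<le> w x"
    using eventually_ge_at_top[of 1] by eventually_elim (auto intro!: assms(5) inverse_le_1_iff[THEN iffD2])
qed (use assms in auto)

text \<open>For a nonnegative integrand the gauge integral and the Lebesgue integral agree, so
  values known for \<open>has_integral\<close> (powers, antiderivatives, the Gamma integral) yield
  integrability together with the value.\<close>

lemma has_bochner_integral_from_hk:
  fixes f :: "real \<Rightarrow> real"
  assumes [measurable]: "f \<in> borel_measurable borel" "A \<in> sets borel"
    and nonneg: "\<And>x. x \<in> A \<Longrightarrow> 0 \<le> f x" and I: "(f has_integral I) A"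
  shows "has_bochner_integral lborel (\<lambda>x. indicator A x * f x) I"
proof (rule has_bochner_integral_nn_integral)
  show "AE x in lborel. 0 \<le> indicator A x * f x"
    using nonneg by (auto simp: indicator_def)
  show "0 \<le> I"
    using has_integral_nonneg[OF I nonneg] .
  show "(\<integral>\<^sup>+x. ennreal (indicator A x * f x) \<partial>lborel) = ennreal I"
    using nn_integral_has_integral_lebesgue[OF nonneg I] .
qed auto

lemma has_bochner_integral_Ioi_iff_Ici:
  fixes f :: "real \<Rightarrow> real"
  assumes [measurable]: "f \<in> borel_measurable borel"
  shows "has_bochner_integral lborel (\<lambda>x. indicator {0<..} x * f x) I
    \<longleftrightarrow> has_bochner_integral lborel (\<lambda>x. indicator {0..} x * f x) I"
proof (rule has_bochner_integral_cong_AE)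
  show "AE x in lborel. indicator {0<..} x * f x = indicator {0..} x * f x"
    using AE_lborel_singleton[of "0::real"] by eventually_elim (auto simp: indicator_def)
qed auto

lemma has_bochner_integral_Ioi_FTC:
  fixes f :: "real \<Rightarrow> real"
  assumes [measurable]: "f \<in> borel_measurable borel"
    and "\<And>x. 0 \<le> x \<Longrightarrow> DERIV F x :> f x" "\<And>x. 0 \<le> x \<Longrightarrow> 0 \<le> f x" "(F \<longlongrightarrow> T) at_top"
  shows "has_bochner_integral lborel (\<lambda>x. indicator {0<..} x * f x) (T - F 0)"
  unfolding has_bochner_integral_Ioi_iff_Ici[OF assms(1)]
proof (rule has_bochner_integral_nn_integral)
  have nn: "(\<integral>\<^sup>+x. ennreal (f x) * indicator {0..} x \<partial>lborel) = ennreal (T - F 0)"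
    using assms by (intro nn_integral_FTC_atLeast) auto
  show "(\<integral>\<^sup>+x. ennreal (indicator {0..} x * f x) \<partial>lborel) = ennreal (T - F 0)"
    unfolding nn[symmetric] by (intro nn_integral_cong) (auto simp: indicator_def)
  have "F 0 \<le> F x" if "0 \<le> x" for x
    using that by (intro DERIV_nonneg_imp_nondecreasing[of 0 x F]) (auto intro: assms)
  then show "0 \<le> T - F 0"
    using tendsto_lowerbound[OF assms(4), of "F 0"] eventually_mono[OF eventually_ge_at_top[of 0]]
    by (metis diff_ge_0_iff_ge trivial_limit_at_top_linorder)
qed (auto simp: indicator_def assms)

lemma has_bochner_integral_even:
  fixes f :: "real \<Rightarrow> real"
  assumes "has_bochner_integral lborel (\<lambda>x. indicator {0<..} x * f x) I"
    and "f \<in> borel_measurable borel" "\<And>x. f (- x) = f x"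
  shows "has_bochner_integral lborel f (2 * I)"
  using has_bochner_integral_even_function[of f I] assms
  by (simp add: has_bochner_integral_Ioi_iff_Ici)

section \<open>Integrals of 1 - cos against the weight 1/u^2\<close>

lemma one_minus_cos_le: "1 - cos (x::real) \<le> x\<^sup>2 / 2"
proof -
  have "1 - cos x = 2 * (sin (x/2))\<^sup>2"
    using cos_double_sin[of "x/2"] by simp
  also have "\<dots> \<le> 2 * (x/2)\<^sup>2"
    using abs_sin_x_le_abs_x[of "x/2"] unfolding abs_le_square_iff by simp
  finally show ?thesis by (simp add: power_divide)
qed

text \<open>The difference of the Laplace transforms of 1 and of \<open>cos\<close>, read off from
  the explicit antiderivative \<open>F\<close>, which vanishes at infinity. Multiplied by
  \<open>s\<close> it becomes \<open>1 / (1 + s\<^sup>2)\<close>.\<close>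

lemma integral_exp_one_minus_cos:
  assumes "s > 0"
  shows "has_bochner_integral lborel (\<lambda>u::real. indicator {0<..} u * (exp (- (u * s)) * (1 - cos u)))
           (1 / s - s / (1 + s\<^sup>2))"
proof -
  define F where "F u = - exp (- (u * s)) / s - exp (- (u * s)) * (sin u - s * cos u) / (1 + s\<^sup>2)" for u
  have pos: "1 + s\<^sup>2 \<noteq> 0" by (smt (verit) zero_le_power2)
  have D: "DERIV F u :> exp (- (u * s)) * (1 - cos u)" for u
    unfolding F_def
    apply (rule derivative_eq_intros refl | use assms pos in force)+
    using assms pos apply (simp add: divide_simps)
    apply (simp add: algebra_simps power2_eq_square)
    done
  have "((\<lambda>u. exp (- (u * s)) * (sin u - s * cos u)) \<longlongrightarrow> 0) at_top"
  proof (rule Lim_null_comparison)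
    have "norm (sin u - s * cos u) \<le> 1 + s" for u
    proof -
      have "\<bar>sin u - s * cos u\<bar> \<le> \<bar>sin u\<bar> + \<bar>s * cos u\<bar>" by linarith
      also have "\<dots> \<le> 1 + s * 1"
        using assms by (intro add_mono) (auto simp: abs_mult intro!: mult_left_mono)
      finally show ?thesis by simp
    qed
    then show "\<forall>\<^sub>F u in at_top. norm (exp (- (u * s)) * (sin u - s * cos u)) \<le> exp (- (u * s)) * (1 + s)"
      by (auto simp: abs_mult)
    show "((\<lambda>u. exp (- (u * s)) * (1 + s)) \<longlongrightarrow> 0) at_top"
      using assms by real_asymp
  qed
  moreover have "((\<lambda>u. exp (- (u * s)) / s) \<longlongrightarrow> 0) at_top"
    using assms by real_asymp
  ultimately have lim: "(F \<longlongrightarrow> 0) at_top"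
    using tendsto_diff[OF tendsto_minus tendsto_divide_zero, of "\<lambda>u. exp (- (u * s)) / s" 0 at_top
        "\<lambda>u. exp (- (u * s)) * (sin u - s * cos u)" "1 + s\<^sup>2"]
    by (simp add: F_def[abs_def])
  have "0 \<le> exp (- (u * s)) * (1 - cos u)" for u by simp
  then have "has_bochner_integral lborel (\<lambda>u::real. indicator {0<..} u * (exp (- (u * s)) * (1 - cos u))) (0 - F 0)"
    by (intro has_bochner_integral_Ioi_FTC lim D) auto
  then show ?thesis by (simp add: F_def)
qed

text \<open>For \<open>u > 0\<close> the weight \<open>1 / u\<^sup>2\<close> is the integral of
  \<open>s * exp (- (u * s))\<close> over \<open>s > 0\<close>. Exchanging the order leaves the
  integral of \<open>1 / (1 + s\<^sup>2)\<close>, that is the limit of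
  \<open>arctan\<close>.\<close>

lemma integral_one_minus_cos_half:
  "has_bochner_integral lborel (\<lambda>u::real. indicator {0<..} u * ((1 - cos u) / u\<^sup>2)) (pi / 2)"
proof (rule tonelli_lborel[where f = "\<lambda>s u. indicator {0<..} s * indicator {0<..} u * (s * exp (- (u * s)) * (1 - cos u))"
     and g = "\<lambda>s. indicator {0<..} s * (1 / (1 + s\<^sup>2))"])
  show "AE s::real in lborel. has_bochner_integral lborel
         (\<lambda>u. indicator {0<..} s * indicator {0<..} u * (s * exp (- (u * s)) * (1 - cos u)))
         (indicator {0<..} s * (1 / (1 + s\<^sup>2)))"
  proof (rule AE_I2)
    fix s :: real
    show "has_bochner_integral lborel
         (\<lambda>u. indicator {0<..} s * indicator {0<..} u * (s * exp (- (u * s)) * (1 - cos u)))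
         (indicator {0<..} s * (1 / (1 + s\<^sup>2)))"
    proof (cases "s > 0")
      case True
      have pos: "1 + s\<^sup>2 \<noteq> 0" by (smt (verit) zero_le_power2)
      have eq: "s * (1 / s - s / (1 + s\<^sup>2)) = 1 / (1 + s\<^sup>2)"
        using True pos by (simp add: divide_simps) (simp add: algebra_simps power2_eq_square)
      show ?thesis
        using has_bochner_integral_mult_right[OF integral_exp_one_minus_cos[OF True], of s] True eq
        by (simp add: mult_ac)
    qed auto
  qed
  have "((\<lambda>x. arctan x) \<longlongrightarrow> pi/2) at_top"
    by (rule tendsto_arctan_at_top)
  then have "has_bochner_integral lborel (\<lambda>s. indicator {0<..} s * (1 / (1 + s\<^sup>2))) (pi/2 - arctan 0)"
    by (intro has_bochner_integral_Ioi_FTC) (auto intro!: derivative_eq_intros simp: inverse_eq_divide)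
  then show "has_bochner_integral lborel (\<lambda>s. indicator {0<..} s * (1 / (1 + s\<^sup>2))) (pi / 2)" by simp
  show "AE u::real in lborel. has_bochner_integral lborel
         (\<lambda>s. indicator {0<..} s * indicator {0<..} u * (s * exp (- (u * s)) * (1 - cos u)))
         (indicator {0<..} u * ((1 - cos u) / u\<^sup>2))"
  proof (rule AE_I2)
    fix u :: real
    show "has_bochner_integral lborel
         (\<lambda>s. indicator {0<..} s * indicator {0<..} u * (s * exp (- (u * s)) * (1 - cos u)))
         (indicator {0<..} u * ((1 - cos u) / u\<^sup>2))"
    proof (cases "u > 0")
      case True
      define F where "F s = - exp (- (u * s)) * (s / u + 1 / u\<^sup>2)" for s
      have "has_bochner_integral lborel (\<lambda>s. indicator {0<..} s * (s * exp (- (u * s)))) (0 - F 0)"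
      proof (rule has_bochner_integral_Ioi_FTC)
        show "DERIV F s :> s * exp (- (u * s))" for s
          unfolding F_def
          apply (rule derivative_eq_intros refl | use True in force)+
          using True by (simp add: field_simps power2_eq_square)
        show "(F \<longlongrightarrow> 0) at_top"
          unfolding F_def using True by real_asymp
      qed auto
      from has_bochner_integral_mult_right[OF this, of "1 - cos u"] show ?thesis
        using True by (simp add: F_def mult_ac)
    qed auto
  qed
  show "(\<lambda>(s::real, u::real). indicator {0<..} s * indicator {0<..} u * (s * exp (- (u * s)) * (1 - cos u)) :: real)
      \<in> borel_measurable (lborel \<Otimes>\<^sub>M lborel)"
    by measurable
  show "0 \<le> indicator {0<..} s * indicator {0<..} u * (s * exp (- (u * s)) * (1 - cos u))" for s u :: real
    by (simp add: indicator_def)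
qed measurable

lemma integral_one_minus_cos:
  "has_bochner_integral lborel (\<lambda>u::real. (1 - cos (u * x)) / u\<^sup>2) (pi * \<bar>x\<bar>)"
proof (cases "x = 0")
  case False
  have "has_bochner_integral lborel (\<lambda>u::real. (1 - cos u) / u\<^sup>2) pi"
    using has_bochner_integral_even[OF integral_one_minus_cos_half] by simp
  then have "has_bochner_integral lborel (\<lambda>u::real. (1 - cos (0 + x * u)) / (0 + x * u)\<^sup>2) (pi /\<^sub>R \<bar>x\<bar>)"
    using False by (subst (asm) lborel_has_bochner_integral_real_affine_iff[where t = 0 and c = x])
  from has_bochner_integral_mult_right[OF this, of "x\<^sup>2"]
  have *: "has_bochner_integral lborel (\<lambda>u. x\<^sup>2 * ((1 - cos (0 + x * u)) / (0 + x * u)\<^sup>2)) (x\<^sup>2 * (pi /\<^sub>R \<bar>x\<bar>))"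
    by simp
  have "x\<^sup>2 * (pi /\<^sub>R \<bar>x\<bar>) = pi * \<bar>x\<bar>"
    using False by (simp add: field_simps power2_eq_square)
  moreover have "x\<^sup>2 * ((1 - cos (0 + x * u)) / (0 + x * u)\<^sup>2) = (1 - cos (u * x)) / u\<^sup>2" for u
    using False by (simp add: power_mult_distrib mult.commute)
  ultimately show ?thesis
    using * by (simp only:)
qed auto

section \<open>The Fourier transform of the Laplace density\<close>

lemma integral_mult_exp_half:
  "has_bochner_integral lborel (\<lambda>s::real. indicator {0<..} s * (s * exp (- s / 2))) 4"
proof -
  define F where "F s = - exp (- s / 2) * (2 * s + 4)" for s :: real
  have "has_bochner_integral lborel (\<lambda>s. indicator {0<..} s * (s * exp (- s / 2))) (0 - F 0)"
  proof (rule has_bochner_integral_Ioi_FTC)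
    show "DERIV F s :> s * exp (- s / 2)" for s
      unfolding F_def
      apply (rule derivative_eq_intros refl | simp)+
      by (simp add: field_simps)
    show "(F \<longlongrightarrow> 0) at_top"
      unfolding F_def by real_asymp
  qed auto
  then show ?thesis by (simp add: F_def)
qed

text \<open>\<open>1/2 * exp (- s / 2)\<close> is the exponential density with mean 2, and the real
  part of its characteristic function is \<open>(1/4) / (x\<^sup>2 + 1/4)\<close>; the integral is 1
  minus this. The rate 1/2 is what produces the 1/4 in the kernel.\<close>

lemma integral_exp_mult_cos:
  fixes x :: real
  shows "has_bochner_integral lborel (\<lambda>s::real. indicator {0<..} s * (1/2 * exp (- s / 2) * (1 - cos (x * s))))
           (x\<^sup>2 / (x\<^sup>2 + 1/4))"
proof -
  define F where "F s = - exp (- s / 2) - exp (- s / 2) * (x * sin (x * s) - cos (x * s) / 2) / (2 * (x\<^sup>2 + 1/4))" for s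
  have pos: "x\<^sup>2 + 1/4 > 0" by (smt (verit) zero_le_power2 divide_pos_pos)
  have "has_bochner_integral lborel (\<lambda>s. indicator {0<..} s * (1/2 * exp (- s / 2) * (1 - cos (x * s)))) (0 - F 0)"
  proof (rule has_bochner_integral_Ioi_FTC)
    have *: "DERIV (\<lambda>s. exp (- s / 2) * (x * sin (x * s) - cos (x * s) / 2)) s
        :> exp (- s / 2) * cos (x * s) * (x\<^sup>2 + 1/4)" for s
      apply (rule derivative_eq_intros refl | simp)+
      by (simp add: field_simps power2_eq_square)
    have D: "DERIV F s :> exp (- s / 2) / 2 - exp (- s / 2) * cos (x * s) * (x\<^sup>2 + 1/4) / (2 * (x\<^sup>2 + 1/4))" for s
      unfolding F_def
      by (rule derivative_eq_intros DERIV_cdivide * refl | simp)+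
    have cancel: "a * k / (2 * k) = a / 2" if "k > 0" for a k :: real
      using that by simp
    show "DERIV F s :> 1/2 * exp (- s / 2) * (1 - cos (x * s))" for s
      using D[of s] unfolding cancel[OF pos] by (simp add: right_diff_distrib)
    have "((\<lambda>s. exp (- s / 2) * (x * sin (x * s) - cos (x * s) / 2)) \<longlongrightarrow> 0) at_top"
    proof (rule Lim_null_comparison)
      have "\<bar>x * sin (x * s) - cos (x * s) / 2\<bar> \<le> \<bar>x\<bar> + 1" for s
      proof -
        have "\<bar>x * sin (x * s)\<bar> \<le> \<bar>x\<bar> * 1"
          unfolding abs_mult by (intro mult_left_mono) auto
        moreover have "\<bar>cos (x * s) / 2\<bar> \<le> 1" using abs_cos_le_one[of "x * s"] by (simp del: abs_cos_le_one)
        ultimately show ?thesis by linarith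
      qed
      then show "\<forall>\<^sub>F s in at_top. norm (exp (- s / 2) * (x * sin (x * s) - cos (x * s) / 2)) \<le> exp (- s / 2) * (\<bar>x\<bar> + 1)"
        by (auto simp: abs_mult)
      show "((\<lambda>s. exp (- s / 2) * (\<bar>x\<bar> + 1)) \<longlongrightarrow> 0) at_top" by real_asymp
    qed
    moreover have "((\<lambda>s::real. exp (- s / 2)) \<longlongrightarrow> 0) at_top" by real_asymp
    ultimately show "(F \<longlongrightarrow> 0) at_top"
      using tendsto_diff[OF tendsto_minus tendsto_divide_zero, of "\<lambda>s. exp (- s / 2)" 0 at_top
        "\<lambda>s. exp (- s / 2) * (x * sin (x * s) - cos (x * s) / 2)" "2 * (x\<^sup>2 + 1/4)"]
      by (simp add: F_def[abs_def])
  qed auto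
  moreover have "0 - F 0 = x\<^sup>2 / (x\<^sup>2 + 1/4)"
    using pos by (simp add: F_def field_simps)
  ultimately show ?thesis by simp
qed

text \<open>By the addition formulas the product is a combination of \<open>1 - cos (u * c)\<close>
  for c = s, x, s + x, s - x with weights 1, -1, 1/2, 1/2. The corresponding combination of absolute
  values is s plus a tent function in x.\<close>

lemma integral_one_minus_cos_mult_one_plus_cos:
  fixes s x :: real
  assumes "s > 0"
  shows "has_bochner_integral lborel (\<lambda>u::real. (1 - cos (u * s)) * (1 + cos (u * x)) / u\<^sup>2)
     (pi * (s + max (s - \<bar>x\<bar>) 0))"
proof -
  have "has_bochner_integral lborel (\<lambda>u::real. (1 - cos (u * s)) / u\<^sup>2 - (1 - cos (u * x)) / u\<^sup>2
        + 1/2 * ((1 - cos (u * (s + x))) / u\<^sup>2) + 1/2 * ((1 - cos (u * (s - x))) / u\<^sup>2))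
     (pi * \<bar>s\<bar> - pi * \<bar>x\<bar> + 1/2 * (pi * \<bar>s + x\<bar>) + 1/2 * (pi * \<bar>s - x\<bar>))"
    by (intro has_bochner_integral_add has_bochner_integral_diff has_bochner_integral_mult_right
        integral_one_minus_cos)
  moreover have "(1 - cos (u * s)) / u\<^sup>2 - (1 - cos (u * x)) / u\<^sup>2
        + 1/2 * ((1 - cos (u * (s + x))) / u\<^sup>2) + 1/2 * ((1 - cos (u * (s - x))) / u\<^sup>2)
       = (1 - cos (u * s)) * (1 + cos (u * x)) / u\<^sup>2" for u
    by (cases "u = 0") (simp_all add: divide_simps distrib_left right_diff_distrib cos_add cos_diff, simp add: algebra_simps)
  moreover have "pi * \<bar>s\<bar> - pi * \<bar>x\<bar> + 1/2 * (pi * \<bar>s + x\<bar>) + 1/2 * (pi * \<bar>s - x\<bar>)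
      = pi * (\<bar>s\<bar> - \<bar>x\<bar> + \<bar>s + x\<bar> / 2 + \<bar>s - x\<bar> / 2)"
    by (simp add: algebra_simps)
  moreover have "\<bar>s\<bar> - \<bar>x\<bar> + \<bar>s + x\<bar> / 2 + \<bar>s - x\<bar> / 2 = s + max (s - \<bar>x\<bar>) 0"
    using assms by (auto simp: max_def abs_if field_simps)
  ultimately show ?thesis by simp
qed

text \<open>
  \<open>u\<^sup>2 / (u\<^sup>2 + 1/4)\<close> is a mixture over \<open>s\<close> of the functions \<open>1 - cos (u * s)\<close>; the factor
  \<open>1 + cos (u * x)\<close> in place of \<open>cos (u * x)\<close> keeps all integrands nonnegative, so that Tonelli applies.
\<close>

lemma integral_one_plus_cos_laplace:
  fixes x :: real
  shows "has_bochner_integral lborel (\<lambda>u::real. (1 + cos (u * x)) / (u\<^sup>2 + 1/4)) (2 * pi + 2 * pi * exp (- \<bar>x\<bar> / 2))"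
proof (rule tonelli_lborel[where f = "\<lambda>s u::real. indicator {0<..} s * (1/2 * exp (- s / 2) * ((1 - cos (u * s)) * (1 + cos (u * x)) / u\<^sup>2))"
     and g = "\<lambda>s. indicator {0<..} s * (1/2 * exp (- s / 2) * (pi * (s + max (s - \<bar>x\<bar>) 0)))"])
  show "(\<lambda>(s::real, u::real). indicator {0<..} s * (1/2 * exp (- s / 2) * ((1 - cos (u * s)) * (1 + cos (u * x)) / u\<^sup>2)) :: real)
      \<in> borel_measurable (lborel \<Otimes>\<^sub>M lborel)"
    by measurable
  have "0 \<le> 1 + cos a" for a :: real
    using cos_ge_minus_one[of a] by linarith
  then show "0 \<le> indicator {0<..} s * (1/2 * exp (- s / 2) * ((1 - cos (u * s)) * (1 + cos (u * x)) / u\<^sup>2))" for s u :: real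
    by (simp add: indicator_def)
  show "AE s::real in lborel. has_bochner_integral lborel
      (\<lambda>u::real. indicator {0<..} s * (1/2 * exp (- s / 2) * ((1 - cos (u * s)) * (1 + cos (u * x)) / u\<^sup>2)))
      (indicator {0<..} s * (1/2 * exp (- s / 2) * (pi * (s + max (s - \<bar>x\<bar>) 0))))"
  proof (rule AE_I2)
    fix s :: real
    show "has_bochner_integral lborel
      (\<lambda>u::real. indicator {0<..} s * (1/2 * exp (- s / 2) * ((1 - cos (u * s)) * (1 + cos (u * x)) / u\<^sup>2)))
      (indicator {0<..} s * (1/2 * exp (- s / 2) * (pi * (s + max (s - \<bar>x\<bar>) 0))))"
    proof (cases "s > 0")
      case True
      then have ind: "indicator {0<..} s = (1::real)" by simp
      show ?thesis
        unfolding ind mult_1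
        by (intro has_bochner_integral_mult_right integral_one_minus_cos_mult_one_plus_cos True)
    qed auto
  qed
  \<comment> \<open>The tent term is the integrand \<open>s * exp (- s / 2)\<close> translated by
    \<open>\<bar>x\<bar>\<close>, up to the factor \<open>exp (- \<bar>x\<bar> / 2)\<close>: this is
    where the Laplace density emerges.\<close>
  have "has_bochner_integral lborel (\<lambda>s. indicator {0<..} (- \<bar>x\<bar> + 1 * s) * ((- \<bar>x\<bar> + 1 * s) * exp (- (- \<bar>x\<bar> + 1 * s) / 2))) (4 /\<^sub>R \<bar>1\<bar>)"
    by (subst lborel_has_bochner_integral_real_affine_iff[symmetric]) (use integral_mult_exp_half in auto)
  from has_bochner_integral_add[OF
      has_bochner_integral_mult_right[OF this, of "exp (- \<bar>x\<bar> / 2)"] integral_mult_exp_half]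
  have "has_bochner_integral lborel (\<lambda>s. pi / 2 * (
     exp (- \<bar>x\<bar> / 2) * (indicator {0<..} (- \<bar>x\<bar> + 1 * s) * ((- \<bar>x\<bar> + 1 * s) * exp (- (- \<bar>x\<bar> + 1 * s) / 2)))
     + indicator {0<..} s * (s * exp (- s / 2)))) (pi / 2 * (exp (- \<bar>x\<bar> / 2) * (4 /\<^sub>R \<bar>1\<bar>) + 4))"
    by (intro has_bochner_integral_mult_right) auto
  moreover have "pi / 2 * (
     exp (- \<bar>x\<bar> / 2) * (indicator {0<..} (- \<bar>x\<bar> + 1 * s) * ((- \<bar>x\<bar> + 1 * s) * exp (- (- \<bar>x\<bar> + 1 * s) / 2)))
     + indicator {0<..} s * (s * exp (- s / 2)))
     = indicator {0<..} s * (1/2 * exp (- s / 2) * (pi * (s + max (s - \<bar>x\<bar>) 0)))" for s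
  proof -
    have "exp (- \<bar>x\<bar> / 2) * exp (- (- \<bar>x\<bar> + 1 * s) / 2) = exp (- s / 2)"
      by (simp add: field_simps flip: exp_add)
    then have "exp (- \<bar>x\<bar> / 2) * ((- \<bar>x\<bar> + 1 * s) * exp (- (- \<bar>x\<bar> + 1 * s) / 2)) = (s - \<bar>x\<bar>) * exp (- s / 2)"
      by simp
    moreover have "exp (- \<bar>x\<bar> / 2) * (i * b) = i * (exp (- \<bar>x\<bar> / 2) * b)" for i b :: real
      by simp
    ultimately show ?thesis
      by (simp only:) (auto simp: indicator_def max_def algebra_simps)
  qed
  moreover have "pi / 2 * (exp (- \<bar>x\<bar> / 2) * (4 /\<^sub>R \<bar>1\<bar>) + 4) = 2 * pi + 2 * pi * exp (- \<bar>x\<bar> / 2)"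
    by (simp add: algebra_simps)
  ultimately show "has_bochner_integral lborel (\<lambda>s. indicator {0<..} s * (1/2 * exp (- s / 2) * (pi * (s + max (s - \<bar>x\<bar>) 0))))
      (2 * pi + 2 * pi * exp (- \<bar>x\<bar> / 2))"
    by (simp only:)
  show "AE u::real in lborel. has_bochner_integral lborel
      (\<lambda>s::real. indicator {0<..} s * (1/2 * exp (- s / 2) * ((1 - cos (u * s)) * (1 + cos (u * x)) / u\<^sup>2)))
      ((1 + cos (u * x)) / (u\<^sup>2 + 1/4))"
    using AE_lborel_singleton[of "0::real"]
  proof eventually_elim
    fix u :: real assume u: "u \<noteq> 0"
    show "has_bochner_integral lborel
      (\<lambda>s::real. indicator {0<..} s * (1/2 * exp (- s / 2) * ((1 - cos (u * s)) * (1 + cos (u * x)) / u\<^sup>2)))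
      ((1 + cos (u * x)) / (u\<^sup>2 + 1/4))"
      using has_bochner_integral_mult_right[OF integral_exp_mult_cos[of u], of "(1 + cos (u * x)) / u\<^sup>2"] u
      by (simp add: mult_ac)
  qed
qed measurable

lemma integral_laplace:
  "has_bochner_integral lborel (\<lambda>u::real. 1 / (u\<^sup>2 + 1/4)) (2 * pi)"
  using has_bochner_integral_mult_right[OF integral_one_plus_cos_laplace[of 0], of "1/2"] by simp

lemma integral_cos_laplace:
  fixes x :: real
  shows "has_bochner_integral lborel (\<lambda>u::real. cos (u * x) / (u\<^sup>2 + 1/4)) (2 * pi * exp (- \<bar>x\<bar> / 2))"
proof -
  have "(1 + cos (u * x)) / (u\<^sup>2 + 1/4) - 1 / (u\<^sup>2 + 1/4) = cos (u * x) / (u\<^sup>2 + 1/4)" for u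
    by (simp add: diff_divide_distrib[symmetric])
  with has_bochner_integral_diff[OF integral_one_plus_cos_laplace[of x] integral_laplace] show ?thesis
    by simp
qed

section \<open>Gamma integrals and Gaussian moments of real order\<close>

lemma integral_Gamma_scaled:
  fixes z c :: real
  assumes "z > 0" "c > 0"
  shows "has_bochner_integral lborel (\<lambda>x. indicator {0<..} x * (x powr (z - 1) * exp (- (c * x)))) (Gamma z * c powr - z)"
proof -
  have "has_bochner_integral lborel (\<lambda>x. indicator {0..} x * (x powr (z - 1) / exp x)) (Gamma z)"
    using Gamma_integral_real[OF assms(1)] by (intro has_bochner_integral_from_hk) auto
  then have "has_bochner_integral lborel (\<lambda>x. indicator {0<..} x * (x powr (z - 1) / exp x)) (Gamma z)"
    by (subst has_bochner_integral_Ioi_iff_Ici) auto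
  then have "has_bochner_integral lborel (\<lambda>x. indicator {0<..} (0 + c * x) * ((0 + c * x) powr (z - 1) / exp (0 + c * x))) (Gamma z /\<^sub>R \<bar>c\<bar>)"
    using assms by (subst (asm) lborel_has_bochner_integral_real_affine_iff[where t = 0 and c = c]) auto
  from has_bochner_integral_mult_right[OF this, of "c powr (1 - z)"]
  have "has_bochner_integral lborel (\<lambda>x. c powr (1 - z) * (indicator {0<..} (0 + c * x) * ((0 + c * x) powr (z - 1) / exp (0 + c * x)))) (c powr (1 - z) * (Gamma z /\<^sub>R \<bar>c\<bar>))"
    by simp
  moreover have "c powr (1 - z) * (indicator {0<..} (0 + c * x) * ((0 + c * x) powr (z - 1) / exp (0 + c * x)))
     = indicator {0<..} x * (x powr (z - 1) * exp (- (c * x)))" for x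
    using assms by (auto simp: indicator_def zero_less_mult_iff powr_mult powr_diff exp_minus field_simps)
  moreover have "c powr (1 - z) * (Gamma z /\<^sub>R \<bar>c\<bar>) = Gamma z * c powr - z"
    using assms by (simp add: powr_diff powr_minus field_simps)
  ultimately show ?thesis by (simp only:)
qed

text \<open>The substitution t = v^2 in the Gamma integral with exponent \<open>s / 2\<close>: the
  Jacobian \<open>2 * v\<close> turns \<open>t powr (s / 2 - 1)\<close> into twice
  \<open>v powr (s - 1)\<close>. The substitution is made for absolutely integrable functions, and
  the result is carried back to \<open>lborel\<close> by nonnegativity.\<close>

lemma integral_gaussian_powr:
  fixes s c :: real
  assumes "s > 0" "c > 0"
  shows "has_bochner_integral lborel (\<lambda>v. indicator {0<..} v * (v powr (s - 1) * exp (- (c * v\<^sup>2))))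
           (Gamma (s / 2) * c powr - (s / 2) / 2)"
proof -
  define f where "f = (\<lambda>t::real. t powr (s / 2 - 1) * exp (- (c * t)))"
  have bi: "has_bochner_integral lborel (\<lambda>x. indicator {0<..} x * f x) (Gamma (s / 2) * c powr - (s / 2))"
    unfolding f_def using assms by (intro integral_Gamma_scaled) auto
  have si: "set_integrable lborel {0<..} f"
    using bi by (simp add: set_integrable_def has_bochner_integral_iff)
  have ai: "f absolutely_integrable_on {0<..}"
    using si by (simp add: set_integrable_def integrable_completion f_def)
  have eq: "integral {0<..} f = Gamma (s / 2) * c powr - (s / 2)"
    using set_borel_integral_eq_integral(2)[OF si] bi
    by (simp add: set_lebesgue_integral_def has_bochner_integral_iff)
  have img: "(\<lambda>v::real. v\<^sup>2) ` {0<..} = {0<..}"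
  proof (intro equalityI subsetI)
    fix y :: real assume "y \<in> {0<..}"
    then have "y = (sqrt y)\<^sup>2" "sqrt y \<in> {0<..}" by auto
    then show "y \<in> (\<lambda>v. v\<^sup>2) ` {0<..}" by (rule image_eqI)
  qed auto
  have "(\<lambda>v. \<bar>2 * v\<bar> * f (v\<^sup>2)) absolutely_integrable_on {0<..} \<and>
        integral {0<..} (\<lambda>v. \<bar>2 * v\<bar> * f (v\<^sup>2)) = Gamma (s / 2) * c powr - (s / 2)"
  proof (subst has_absolute_integral_change_of_variables_1'[where g = "\<lambda>v. v\<^sup>2" and g' = "\<lambda>v. 2 * v" and S = "{0<..}"])
    show "((\<lambda>v. v\<^sup>2) has_real_derivative 2 * v) (at v within {0<..})" for v :: real
      by (auto intro!: derivative_eq_intros)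
    show "inj_on (\<lambda>v::real. v\<^sup>2) {0<..}"
      by (auto simp: inj_on_def power2_eq_iff)
  qed (use ai eq img in auto)
  then have hi: "((\<lambda>v. \<bar>2 * v\<bar> * f (v\<^sup>2)) has_integral Gamma (s / 2) * c powr - (s / 2)) {0<..}"
    using set_lebesgue_integral_eq_integral(1) integrable_integral by metis
  have "has_bochner_integral lborel (\<lambda>v. indicator {0<..} v * (\<bar>2 * v\<bar> * f (v\<^sup>2))) (Gamma (s / 2) * c powr - (s / 2))"
    by (rule has_bochner_integral_from_hk[OF _ _ _ hi]) (auto simp: f_def)
  from has_bochner_integral_mult_right[OF this, of "1/2"]
  have "has_bochner_integral lborel (\<lambda>v. 1/2 * (indicator {0<..} v * (\<bar>2 * v\<bar> * f (v\<^sup>2)))) (Gamma (s / 2) * c powr - (s / 2) / 2)"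
    by simp
  moreover have "1/2 * (indicator {0<..} v * (\<bar>2 * v\<bar> * f (v\<^sup>2))) = indicator {0<..} v * (v powr (s - 1) * exp (- (c * v\<^sup>2)))" for v
  proof (cases "v > 0")
    case True
    have "v\<^sup>2 powr (s / 2 - 1) = v powr (s - 2)"
      using True by (simp add: powr_powr flip: powr_numeral) 
    moreover have "v * v powr (s - 2) = v powr (s - 1)"
      using True powr_add[of v 1 "s - 2"] by simp
    ultimately show ?thesis
      using True by (simp add: f_def)
  qed auto
  ultimately show ?thesis by (simp only:)
qed

section \<open>Integrals against stable densities\<close>

text \<open>The two arguments of the minimum serve the two ends: near 0 the integrand is at most a
  multiple of \<open>x powr (1 - Y)\<close>, integrable because Y < 2, and at infinity of
  \<open>x powr (- Y)\<close>, integrable because Y > 1.\<close>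

lemma integrable_powr_stable:
  fixes h :: "real \<Rightarrow> real"
  assumes Y: "1 < Y" "Y < 2" and [measurable]: "h \<in> borel_measurable borel"
    and bound: "\<And>x. 0 < x \<Longrightarrow> \<bar>h x\<bar> \<le> K * min (x\<^sup>2) x"
  shows "integrable lborel (\<lambda>x. indicator {0<..} x * (x powr (- Y - 1) * h x))"
proof (rule Bochner_Integration.integrable_bound)
  have "has_bochner_integral lborel (\<lambda>x. indicator {0..1} x * x powr (1 - Y)) (1 powr (1 - Y + 1) / (1 - Y + 1))"
    using Y by (intro has_bochner_integral_from_hk has_integral_powr_from_0) auto
  moreover have "has_bochner_integral lborel (\<lambda>x. indicator {1..} x * x powr (- Y)) (- (1 powr (- Y + 1)) / (- Y + 1))"
    using Y by (intro has_bochner_integral_from_hk has_integral_powr_to_inf) auto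
  ultimately show "integrable lborel (\<lambda>x. K * (indicator {0..1} x * x powr (1 - Y) + indicator {1..} x * x powr (- Y)))"
    by (intro integrable_mult_right Bochner_Integration.integrable_add) (auto simp: has_bochner_integral_iff)
  have "\<bar>h 1\<bar> \<le> K" using bound[of 1] by simp
  then have K: "K \<ge> 0" by linarith
  show "AE x in lborel. norm (indicator {0<..} x * (x powr (- Y - 1) * h x))
      \<le> norm (K * (indicator {0..1} x * x powr (1 - Y) + indicator {1..} x * x powr (- Y)))"
  proof (rule AE_I2)
    fix x :: real
    show "norm (indicator {0<..} x * (x powr (- Y - 1) * h x))
      \<le> norm (K * (indicator {0..1} x * x powr (1 - Y) + indicator {1..} x * x powr (- Y)))"
    proof (cases "x > 0")
      case True
      have e: "x powr (- Y - 1) * x\<^sup>2 = x powr (1 - Y)" "x powr (- Y - 1) * x = x powr (- Y)"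
        using True powr_add[of x "- Y - 1" 2] powr_add[of x "- Y - 1" 1] by simp_all
      have "x powr (- Y - 1) * \<bar>h x\<bar> \<le> x powr (- Y - 1) * (K * min (x\<^sup>2) x)"
        using bound[OF True] by (intro mult_left_mono) auto
      also have "\<dots> = K * (if x \<le> 1 then x powr (1 - Y) else x powr (- Y))"
      proof (cases "x \<le> 1")
        case True
        then have "x\<^sup>2 \<le> x" using \<open>x > 0\<close> by (simp add: power2_eq_square)
        then show ?thesis using True by (simp add: min_def mult_ac flip: e)
      next
        case False
        then have "x < x\<^sup>2" by (simp add: power2_eq_square)
        then show ?thesis using False by (simp add: min_def mult_ac flip: e)
      qed
      also have "\<dots> \<le> K * (indicator {0..1} x * x powr (1 - Y) + indicator {1..} x * x powr (- Y))"
        using True K by (intro mult_left_mono) (auto simp: indicator_def)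
      finally show ?thesis
        using True K by (simp add: abs_mult)
    qed (use K in \<open>auto\<close>)
  qed
qed measurable

lemma not_int_between_1_2:
  assumes "1 < (Y::real)" "Y < 2"
  shows "Y \<notin> \<int>"
proof
  assume "Y \<in> \<int>"
  then obtain n :: int where "Y = of_int n" by (auto elim: Ints_cases)
  with assms have "1 < n" "n < 2" by auto
  then show False by auto
qed

lemma Gamma_two_minus:
  assumes "1 < (Y::real)" "Y < 2"
  shows "Gamma (2 - Y) = Y * (Y - 1) * Gamma (- Y)"
proof -
  have ni: "- Y \<notin> \<int>\<^sub>\<le>\<^sub>0" "1 - Y \<notin> \<int>\<^sub>\<le>\<^sub>0"
    using not_int_between_1_2[OF assms] nonpos_Ints_Int[of "- Y"] nonpos_Ints_Int[of "1 - Y"] Ints_diff[of 1 "1 - Y"]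
    by auto
  have "Gamma (1 - Y) = - Y * Gamma (- Y)" "Gamma (2 - Y) = (1 - Y) * Gamma (1 - Y)"
    using Gamma_plus1[OF ni(1)] Gamma_plus1[OF ni(2)] by simp_all
  then show ?thesis by (simp add: algebra_simps)
qed

text \<open>Taylor's formula with integral remainder writes
  \<open>exp (- (a * x)) - 1 + a * x\<close> as x^2 times the integral of
  \<open>(a - c) * exp (- (c * x))\<close> over 0 < c < a. The x-integral is then a convergent Gamma
  integral with value \<open>Gamma (2 - Y) * c powr (Y - 2)\<close>, and the remaining c-integral
  \<open>a powr Y / (Y * (Y - 1))\<close> turns \<open>Gamma (2 - Y)\<close> into
  \<open>Gamma (- Y)\<close>.\<close>

lemma integral_stable_exp:
  fixes Y a :: real
  assumes Y: "1 < Y" "Y < 2" and "a > 0"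
  shows "has_bochner_integral lborel (\<lambda>x. indicator {0<..} x * (x powr (- Y - 1) * (exp (- (a * x)) - 1 + a * x)))
           (Gamma (- Y) * a powr Y)"
proof (rule tonelli_lborel[where f = "\<lambda>c x::real. indicator {0<..<a} c * (a - c) * (indicator {0<..} x * (x powr ((2 - Y) - 1) * exp (- (c * x))))"
     and g = "\<lambda>c. indicator {0<..<a} c * (a - c) * (Gamma (2 - Y) * c powr (- (2 - Y)))"])
  show "(\<lambda>(c::real, x::real). indicator {0<..<a} c * (a - c) * (indicator {0<..} x * (x powr ((2 - Y) - 1) * exp (- (c * x)))) :: real)
      \<in> borel_measurable (lborel \<Otimes>\<^sub>M lborel)"
    by measurable
  show "0 \<le> indicator {0<..<a} c * (a - c) * (indicator {0<..} x * (x powr ((2 - Y) - 1) * exp (- (c * x))))" for c x :: real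
    by (auto simp: indicator_def)
  show "AE c::real in lborel. has_bochner_integral lborel
      (\<lambda>x::real. indicator {0<..<a} c * (a - c) * (indicator {0<..} x * (x powr ((2 - Y) - 1) * exp (- (c * x)))))
      (indicator {0<..<a} c * (a - c) * (Gamma (2 - Y) * c powr (- (2 - Y))))"
  proof (rule AE_I2)
    fix c :: real
    show "has_bochner_integral lborel
      (\<lambda>x::real. indicator {0<..<a} c * (a - c) * (indicator {0<..} x * (x powr ((2 - Y) - 1) * exp (- (c * x)))))
      (indicator {0<..<a} c * (a - c) * (Gamma (2 - Y) * c powr (- (2 - Y))))"
    proof (cases "c \<in> {0<..<a}")
      case True
      then show ?thesis
        using Y by (intro has_bochner_integral_mult_right integral_Gamma_scaled) auto
    qed auto
  qed
  show "has_bochner_integral lborel (\<lambda>c. indicator {0<..<a} c * (a - c) * (Gamma (2 - Y) * c powr (- (2 - Y)))) (Gamma (- Y) * a powr Y)"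
  proof -
    have 1: "((\<lambda>c. a * c powr (Y - 2)) has_integral (a * (a powr (Y - 2 + 1) / (Y - 2 + 1)))) {0..a}"
      using Y assms by (intro has_integral_mult_right has_integral_powr_from_0) auto
    have 2: "((\<lambda>c. c powr (Y - 1)) has_integral (a powr (Y - 1 + 1) / (Y - 1 + 1))) {0..a}"
      using Y assms by (intro has_integral_powr_from_0) auto
    have "((\<lambda>c. Gamma (2 - Y) * (a * c powr (Y - 2) - c powr (Y - 1))) has_integral
         (Gamma (2 - Y) * (a * (a powr (Y - 2 + 1) / (Y - 2 + 1)) - a powr (Y - 1 + 1) / (Y - 1 + 1)))) {0..a}"
      by (intro has_integral_mult_right has_integral_diff 1 2)
    moreover have powr_Suc: "c powr (Y - 1) = c * c powr (Y - 2)" if "c \<ge> 0" for c :: real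
      using that powr_add[of c 1 "Y - 2"] by (cases "c = 0") auto
    ultimately have "has_bochner_integral lborel (\<lambda>c. indicator {0..a} c * (Gamma (2 - Y) * (a * c powr (Y - 2) - c powr (Y - 1))))
         (Gamma (2 - Y) * (a * (a powr (Y - 2 + 1) / (Y - 2 + 1)) - a powr (Y - 1 + 1) / (Y - 1 + 1)))"
      using Y by (intro has_bochner_integral_from_hk) (auto intro!: mult_nonneg_nonneg Gamma_real_nonneg mult_right_mono)
    moreover have "AE c in lborel. indicator {0..a} c * (Gamma (2 - Y) * (a * c powr (Y - 2) - c powr (Y - 1)))
        = indicator {0<..<a} c * (a - c) * (Gamma (2 - Y) * c powr (- (2 - Y)))"
      using AE_lborel_singleton[of 0] AE_lborel_singleton[of a]
      by eventually_elim (auto simp: indicator_def powr_Suc algebra_simps)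
    ultimately have fin: "has_bochner_integral lborel (\<lambda>c. indicator {0<..<a} c * (a - c) * (Gamma (2 - Y) * c powr (- (2 - Y))))
         (Gamma (2 - Y) * (a * (a powr (Y - 2 + 1) / (Y - 2 + 1)) - a powr (Y - 1 + 1) / (Y - 1 + 1)))"
      by (subst (asm) has_bochner_integral_cong_AE) auto
    have a: "a * a powr (Y - 1) = a powr Y"
      using powr_add[of a 1 "Y - 1"] \<open>a > 0\<close> by simp
    have "Gamma (2 - Y) * (a * (a powr (Y - 2 + 1) / (Y - 2 + 1)) - a powr (Y - 1 + 1) / (Y - 1 + 1))
      = Gamma (2 - Y) * (a powr Y / (Y - 1) - a powr Y / Y)"
      by (simp add: a)
    also have "b / (Y - 1) - b / Y = b / (Y * (Y - 1))" for b
      using Y by (simp add: field_simps)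
    also have "Gamma (2 - Y) * (a powr Y / (Y * (Y - 1))) = Gamma (- Y) * a powr Y"
      using Y by (simp add: Gamma_two_minus[OF Y])
    finally have "Gamma (2 - Y) * (a * (a powr (Y - 2 + 1) / (Y - 2 + 1)) - a powr (Y - 1 + 1) / (Y - 1 + 1))
      = Gamma (- Y) * a powr Y" .
    from fin[unfolded this] show ?thesis .
  qed
  show "AE x::real in lborel. has_bochner_integral lborel
      (\<lambda>c::real. indicator {0<..<a} c * (a - c) * (indicator {0<..} x * (x powr ((2 - Y) - 1) * exp (- (c * x)))))
      (indicator {0<..} x * (x powr (- Y - 1) * (exp (- (a * x)) - 1 + a * x)))"
  proof (rule AE_I2)
    fix x :: real
    show "has_bochner_integral lborel
      (\<lambda>c::real. indicator {0<..<a} c * (a - c) * (indicator {0<..} x * (x powr ((2 - Y) - 1) * exp (- (c * x)))))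
      (indicator {0<..} x * (x powr (- Y - 1) * (exp (- (a * x)) - 1 + a * x)))"
    proof (cases "x > 0")
      case True
      define F where "F c = exp (- (c * x)) * (1 / x\<^sup>2 - (a - c) / x)" for c
      have D: "(F has_real_derivative (a - c) * exp (- (c * x))) (at c)" for c
      proof -
        have "(F has_real_derivative exp (- (c * x)) * - x * (1 / x\<^sup>2 - (a - c) / x) + (1 / x) * exp (- (c * x))) (at c)"
          unfolding F_def using True by (auto intro!: derivative_eq_intros)
        moreover have "exp (- (c * x)) * - x * (1 / x\<^sup>2 - (a - c) / x) + (1 / x) * exp (- (c * x)) = (a - c) * exp (- (c * x))"
          using True by (simp add: field_simps power2_eq_square)
        ultimately show ?thesis by (simp only:)
      qed
      have "((\<lambda>c. (a - c) * exp (- (c * x))) has_integral (F a - F 0)) {0..a}"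
      proof (rule fundamental_theorem_of_calculus)
        show "(F has_vector_derivative (a - c) * exp (- (c * x))) (at c within {0..a})" for c
          using D unfolding has_real_derivative_iff_has_vector_derivative[symmetric]
          by (rule has_field_derivative_at_within)
      qed (use assms in auto)
      then have "has_bochner_integral lborel (\<lambda>c. indicator {0..a} c * ((a - c) * exp (- (c * x)))) (F a - F 0)"
        by (intro has_bochner_integral_from_hk) auto
      moreover have "AE c in lborel. indicator {0..a} c * ((a - c) * exp (- (c * x))) = indicator {0<..<a} c * ((a - c) * exp (- (c * x)))"
        using AE_lborel_singleton[of 0] AE_lborel_singleton[of a]
        by eventually_elim (auto simp: indicator_def)
      ultimately have "has_bochner_integral lborel (\<lambda>c. indicator {0<..<a} c * ((a - c) * exp (- (c * x)))) (F a - F 0)"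
        by (subst (asm) has_bochner_integral_cong_AE) auto
      from has_bochner_integral_mult_right[OF this, of "x powr (1 - Y)"]
      have "has_bochner_integral lborel (\<lambda>c. indicator {0<..<a} c * (a - c) * (indicator {0<..} x * (x powr ((2 - Y) - 1) * exp (- (c * x)))))
         (x powr (1 - Y) * (F a - F 0))"
        using True by (simp add: mult_ac)
      moreover have "x powr (1 - Y) = x powr (- Y - 1) * x\<^sup>2"
        using True powr_add[of x "- Y - 1" 2] by simp
      moreover have "x\<^sup>2 * (F a - F 0) = exp (- (a * x)) - 1 + a * x"
        using True by (simp add: F_def field_simps power2_eq_square)
      ultimately show ?thesis using True by (simp add: mult.assoc)
    qed auto
  qed
qed measurable

text \<open>The integral of \<open>x powr (- Y - 1) * (1 - cos x)\<close> over the positive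
  half-line, in the form delivered by Gaussian averaging. All factors are visibly positive and match
  those of the coefficient d2; the equivalent form with \<open>cos (pi * Y / 2)\<close> serves for
  d32.\<close>

definition stable_const :: "real \<Rightarrow> real" where
  "stable_const Y = sqrt pi * 2 powr (- Y) * Gamma (1 - Y / 2) / (Y * Gamma ((Y + 1) / 2))"

text \<open>\<open>1 - exp (- x\<^sup>2 / 2)\<close> is the integral of
  \<open>y * exp (- y\<^sup>2 / 2)\<close> over 0 < y < x. After the exchange the x-integral is the
  tail \<open>y powr (- Y) / Y\<close>, and a Gaussian moment of order 1 - Y > -1 remains.\<close>

lemma integral_stable_gaussian:
  assumes Y: "1 < Y" "Y < 2"
  shows "has_bochner_integral lborel (\<lambda>x::real. indicator {0<..} x * (x powr (- Y - 1) * (1 - exp (- x\<^sup>2 / 2))))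
     (Gamma (1 - Y / 2) * 2 powr (- Y / 2) / Y)"
proof (rule tonelli_lborel[where f = "\<lambda>y x::real. indicator {0<..} y * (y * exp (- y\<^sup>2 / 2)) * (indicator {y..} x * x powr (- Y - 1))"
     and g = "\<lambda>y::real. indicator {0<..} y * (y * exp (- y\<^sup>2 / 2)) * (y powr (- Y) / Y)"])
  have m: "(\<lambda>z::real \<times> real. indicator {fst z..} (snd z) :: real) \<in> borel_measurable (lborel \<Otimes>\<^sub>M lborel)"
  proof -
    have "(\<lambda>z::real \<times> real. indicator {fst z..} (snd z) :: real) = (\<lambda>z. if fst z \<le> snd z then 1 else 0)"
      by (auto simp: indicator_def)
    also have "\<dots> \<in> borel_measurable (lborel \<Otimes>\<^sub>M lborel)" by measurable
    finally show ?thesis .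
  qed
  show "(\<lambda>(y::real, x::real). indicator {0<..} y * (y * exp (- y\<^sup>2 / 2)) * (indicator {y..} x * x powr (- Y - 1)) :: real)
      \<in> borel_measurable (lborel \<Otimes>\<^sub>M lborel)"
    using m unfolding case_prod_beta by measurable
  show "0 \<le> indicator {0<..} y * (y * exp (- y\<^sup>2 / 2)) * (indicator {y..} x * x powr (- Y - 1))" for y x :: real
    by (auto simp: indicator_def)
  show "AE y::real in lborel. has_bochner_integral lborel
      (\<lambda>x::real. indicator {0<..} y * (y * exp (- y\<^sup>2 / 2)) * (indicator {y..} x * x powr (- Y - 1)))
      (indicator {0<..} y * (y * exp (- y\<^sup>2 / 2)) * (y powr (- Y) / Y))"
  proof (rule AE_I2)
    fix y :: real
    show "has_bochner_integral lborel
      (\<lambda>x::real. indicator {0<..} y * (y * exp (- y\<^sup>2 / 2)) * (indicator {y..} x * x powr (- Y - 1)))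
      (indicator {0<..} y * (y * exp (- y\<^sup>2 / 2)) * (y powr (- Y) / Y))"
    proof (cases "y > 0")
      case True
      have "((\<lambda>x. x powr (- Y - 1)) has_integral - (y powr (- Y - 1 + 1)) / (- Y - 1 + 1)) {y..}"
        using Y True by (intro has_integral_powr_to_inf) auto
      then have "has_bochner_integral lborel (\<lambda>x. indicator {y..} x * x powr (- Y - 1)) (y powr (- Y) / Y)"
        by (intro has_bochner_integral_from_hk) auto
      then show ?thesis by (intro has_bochner_integral_mult_right)
    qed auto
  qed
  have "has_bochner_integral lborel (\<lambda>v. indicator {0<..} v * (v powr ((2 - Y) - 1) * exp (- (1/2 * v\<^sup>2))))
           (Gamma ((2 - Y) / 2) * (1/2) powr - ((2 - Y) / 2) / 2)"
    using Y by (intro integral_gaussian_powr) auto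
  from has_bochner_integral_divide_zero[OF this, of Y]
  have "has_bochner_integral lborel (\<lambda>v. indicator {0<..} v * (v powr ((2 - Y) - 1) * exp (- (1/2 * v\<^sup>2))) / Y)
           (Gamma ((2 - Y) / 2) * (1/2) powr - ((2 - Y) / 2) / 2 / Y)" .
  moreover have "indicator {0<..} y * (y powr ((2 - Y) - 1) * exp (- (1/2 * y\<^sup>2))) / Y
     = indicator {0<..} y * (y * exp (- y\<^sup>2 / 2)) * (y powr (- Y) / Y)" for y :: real
    using powr_add[of y 1 "- Y"] by (auto simp: indicator_def)
  moreover have "Gamma ((2 - Y) / 2) * (1/2) powr - ((2 - Y) / 2) / 2 / Y = Gamma (1 - Y / 2) * 2 powr (- Y / 2) / Y"
  proof -
    have "(1/2) powr - ((2 - Y) / 2) = 2 powr ((2 - Y) / 2)"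
      by (simp add: powr_minus powr_divide)
    also have "\<dots> = 2 * 2 powr (- Y / 2)"
      using powr_add[of 2 1 "- Y / 2"] by (simp add: diff_divide_distrib)
    finally show ?thesis by (simp add: diff_divide_distrib)
  qed
  ultimately show "has_bochner_integral lborel (\<lambda>y::real. indicator {0<..} y * (y * exp (- y\<^sup>2 / 2)) * (y powr (- Y) / Y))
      (Gamma (1 - Y / 2) * 2 powr (- Y / 2) / Y)"
    by (simp only:)
  show "AE x::real in lborel. has_bochner_integral lborel
      (\<lambda>y::real. indicator {0<..} y * (y * exp (- y\<^sup>2 / 2)) * (indicator {y..} x * x powr (- Y - 1)))
      (indicator {0<..} x * (x powr (- Y - 1) * (1 - exp (- x\<^sup>2 / 2))))"
  proof (rule AE_I2)
    fix x :: real
    show "has_bochner_integral lborel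
      (\<lambda>y::real. indicator {0<..} y * (y * exp (- y\<^sup>2 / 2)) * (indicator {y..} x * x powr (- Y - 1)))
      (indicator {0<..} x * (x powr (- Y - 1) * (1 - exp (- x\<^sup>2 / 2))))"
    proof (cases "x > 0")
      case True
      have "((\<lambda>y. y * exp (- y\<^sup>2 / 2)) has_integral (- exp (- x\<^sup>2 / 2) - - exp (- 0\<^sup>2 / 2))) {0..x}"
      proof (rule fundamental_theorem_of_calculus)
        show "((\<lambda>y. - exp (- y\<^sup>2 / 2)) has_vector_derivative y * exp (- y\<^sup>2 / 2)) (at y within {0..x})" for y
          unfolding has_real_derivative_iff_has_vector_derivative[symmetric]
          by (rule derivative_eq_intros refl | simp)+
      qed (use True in auto)
      then have "has_bochner_integral lborel (\<lambda>y. indicator {0..x} y * (y * exp (- y\<^sup>2 / 2))) (- exp (- x\<^sup>2 / 2) - - exp (- 0\<^sup>2 / 2))"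
        by (intro has_bochner_integral_from_hk) auto
      from has_bochner_integral_mult_right[OF this, of "x powr (- Y - 1)"]
      have "has_bochner_integral lborel (\<lambda>y. x powr (- Y - 1) * (indicator {0..x} y * (y * exp (- y\<^sup>2 / 2)))) (indicator {0<..} x * (x powr (- Y - 1) * (1 - exp (- x\<^sup>2 / 2))))"
        using True by simp
      moreover have "x powr (- Y - 1) * (indicator {0..x} y * (y * exp (- y\<^sup>2 / 2)))
         = indicator {0<..} y * (y * exp (- y\<^sup>2 / 2)) * (indicator {y..} x * x powr (- Y - 1))" for y
        using True by (auto simp: indicator_def)
      ultimately show ?thesis by (simp only:)
    next
      case False
      then have z: "indicator {0<..} y * (y * exp (- y\<^sup>2 / 2)) * (indicator {y..} x * x powr (- Y - 1)) = 0" for y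
        by (auto simp: indicator_def)
      show ?thesis unfolding z using False by (simp add: has_bochner_integral_zero)
    qed
  qed
qed measurable

lemma integral_cos_gaussian:
  "has_bochner_integral lborel (\<lambda>v::real. (1 - cos (v * x)) * exp (- v\<^sup>2 / 2)) (sqrt (2 * pi) * (1 - exp (- x\<^sup>2 / 2)))"
proof -
  have eq: "complex_of_real (exp (- x\<^sup>2 / 2)) = (CLINT v|std_normal_distribution. iexp (x * v))"
    using char_std_normal_distribution by (simp add: char_def fun_eq_iff of_real_exp)
  interpret real_distribution std_normal_distribution by (rule real_dist_normal_dist)
  have int: "integrable std_normal_distribution (\<lambda>v. iexp (x * v))"
    by (rule integrable_iexp) auto
  have "has_bochner_integral std_normal_distribution (\<lambda>v. Re (iexp (x * v))) (exp (- x\<^sup>2 / 2))"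
    using integral_Re[OF int] integrable_Re[OF int] unfolding eq[symmetric]
    by (simp only: has_bochner_integral_iff Re_complex_of_real simp_thms)
  then have "has_bochner_integral std_normal_distribution (\<lambda>v. cos (v * x)) (exp (- x\<^sup>2 / 2))"
    by (simp only: Re_exp) (simp add: mult.commute)
  moreover have "has_bochner_integral std_normal_distribution (\<lambda>v. 1) (1::real)"
    using prob_space by (simp add: has_bochner_integral_iff)
  ultimately have "has_bochner_integral std_normal_distribution (\<lambda>v. 1 - cos (v * x)) (1 - exp (- x\<^sup>2 / 2))"
    by (intro has_bochner_integral_diff)
  then have "has_bochner_integral lborel (\<lambda>v. std_normal_density v * (1 - cos (v * x))) (1 - exp (- x\<^sup>2 / 2))"
    by (auto simp: has_bochner_integral_iff integrable_density integral_density)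
  from has_bochner_integral_mult_right[OF this, of "sqrt (2 * pi)"]
  have "has_bochner_integral lborel (\<lambda>v. sqrt (2 * pi) * (std_normal_density v * (1 - cos (v * x)))) (sqrt (2 * pi) * (1 - exp (- x\<^sup>2 / 2)))"
    by simp
  moreover have "sqrt (2 * pi) * (std_normal_density v * (1 - cos (v * x))) = (1 - cos (v * x)) * exp (- v\<^sup>2 / 2)" for v
    by (simp add: std_normal_density_def)
  ultimately show ?thesis by (simp only:)
qed

lemma integral_gaussian_powr_line:
  fixes s c :: real
  assumes "s > 0" "c > 0"
  shows "has_bochner_integral lborel (\<lambda>v. \<bar>v\<bar> powr (s - 1) * exp (- (c * v\<^sup>2))) (Gamma (s / 2) * c powr - (s / 2))"
proof -
  have "has_bochner_integral lborel (\<lambda>v. indicator {0<..} v * (\<bar>v\<bar> powr (s - 1) * exp (- (c * v\<^sup>2))))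
      (Gamma (s / 2) * c powr - (s / 2) / 2)"
  proof -
    have "indicator {0<..} v * (v powr (s - 1) * exp (- (c * v\<^sup>2)))
      = indicator {0<..} v * (\<bar>v\<bar> powr (s - 1) * exp (- (c * v\<^sup>2)))" for v :: real
      by (auto simp: indicator_def)
    with integral_gaussian_powr[OF assms] show ?thesis by (simp only:)
  qed
  from has_bochner_integral_even[OF this] show ?thesis by simp
qed

text \<open>Only the homogeneity of degree Y in u is established here, the constant \<open>k\<close>
  being left as an integral: its evaluation will itself use this scaling law.\<close>

lemma integral_stable_cos_scaled:
  assumes Y: "1 < Y" "Y < 2"
  defines "k \<equiv> (\<integral>x. indicator {0<..} x * (x powr (- Y - 1) * (1 - cos x)) \<partial>lborel)"
  shows "has_bochner_integral lborel (\<lambda>x::real. indicator {0<..} x * (x powr (- Y - 1) * (1 - cos (u * x)))) (\<bar>u\<bar> powr Y * k)"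
proof (cases "u = 0")
  case False
  define f where "f x = indicator {0<..} x * (x powr (- Y - 1) * (1 - cos x))" for x :: real
  have "integrable lborel f"
    unfolding f_def
  proof (rule integrable_powr_stable[OF Y, where K = 2])
    fix x :: real assume "0 < x"
    moreover have "\<bar>1 - cos x\<bar> \<le> 2 * x"
    proof (cases "x \<le> 1")
      case True
      then have "x\<^sup>2 \<le> x" using \<open>0 < x\<close> by (simp add: power2_eq_square)
      then show ?thesis using one_minus_cos_le[of x] \<open>0 < x\<close> by simp
    next
      case False
      moreover have "\<bar>1 - cos x\<bar> = 1 - cos x" by simp
      ultimately show ?thesis using cos_ge_minus_one[of x] by linarith
    qed
    moreover have "\<bar>1 - cos x\<bar> \<le> 2 * x\<^sup>2"
    proof -
      have "0 \<le> x\<^sup>2" "\<bar>1 - cos x\<bar> = 1 - cos x" by simp_all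
      then show ?thesis using one_minus_cos_le[of x] by linarith
    qed
    ultimately show "\<bar>1 - cos x\<bar> \<le> 2 * min (x\<^sup>2) x" by (auto simp: min_def)
  qed auto
  then have "has_bochner_integral lborel f k"
    unfolding has_bochner_integral_iff k_def f_def by simp
  then have "has_bochner_integral lborel (\<lambda>x. f (0 + \<bar>u\<bar> * x)) (k /\<^sub>R \<bar>\<bar>u\<bar>\<bar>)"
    using False by (subst (asm) lborel_has_bochner_integral_real_affine_iff[where t = 0 and c = "\<bar>u\<bar>"]) auto
  from has_bochner_integral_mult_right[OF this, of "\<bar>u\<bar> powr (Y + 1)"]
  have "has_bochner_integral lborel (\<lambda>x. \<bar>u\<bar> powr (Y + 1) * f (0 + \<bar>u\<bar> * x)) (\<bar>u\<bar> powr (Y + 1) * (k /\<^sub>R \<bar>\<bar>u\<bar>\<bar>))"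
    by simp
  moreover have "\<bar>u\<bar> powr (Y + 1) * (k /\<^sub>R \<bar>\<bar>u\<bar>\<bar>) = \<bar>u\<bar> powr Y * k"
    using False by (simp add: powr_add)
  moreover have "\<bar>u\<bar> powr (Y + 1) * f (0 + \<bar>u\<bar> * x) = indicator {0<..} x * (x powr (- Y - 1) * (1 - cos (u * x)))" for x
  proof (cases "x > 0")
    case True
    have "\<bar>u\<bar> powr (Y + 1) * (\<bar>u\<bar> * x) powr (- Y - 1) = x powr (- Y - 1)"
      using False True powr_add[of "\<bar>u\<bar>" "Y + 1" "- Y - 1"] by (simp add: powr_mult)
    moreover have "cos (\<bar>u\<bar> * x) = cos (u * x)"
      by (simp add: abs_if)
    ultimately show ?thesis
      using False True by (simp add: f_def zero_less_mult_iff)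
  qed (auto simp: f_def zero_less_mult_iff)
  ultimately show ?thesis by (simp only:)
qed auto

text \<open>The double integral of
  \<open>x powr (- Y - 1) * (1 - cos (v * x)) * exp (- v\<^sup>2 / 2)\<close> is computed in both
  orders. Integrating over x first gives the unknown constant times a Gaussian moment of order Y;
  integrating over v first gives the integral of \<open>integral_stable_gaussian\<close>. The
  constant is the quotient.\<close>

lemma stable_const_eq_integral:
  assumes Y: "1 < Y" "Y < 2"
  shows "(\<integral>x. indicator {0<..} x * (x powr (- Y - 1) * (1 - cos x)) \<partial>lborel) = stable_const Y" (is "?k = _")
proof -
  have "has_bochner_integral lborel (\<lambda>x::real. indicator {0<..} x * (x powr (- Y - 1) * (sqrt (2 * pi) * (1 - exp (- x\<^sup>2 / 2)))))
      (?k * (Gamma ((Y + 1) / 2) * (1/2) powr - ((Y + 1) / 2)))"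
  proof (rule tonelli_lborel[where f = "\<lambda>v x::real. indicator {0<..} x * (x powr (- Y - 1) * (1 - cos (v * x))) * exp (- v\<^sup>2 / 2)"
        and g = "\<lambda>v. \<bar>v\<bar> powr Y * ?k * exp (- v\<^sup>2 / 2)"])
    show "(\<lambda>(v::real, x::real). indicator {0<..} x * (x powr (- Y - 1) * (1 - cos (v * x))) * exp (- v\<^sup>2 / 2) :: real)
      \<in> borel_measurable (lborel \<Otimes>\<^sub>M lborel)"
      by measurable
    show "0 \<le> indicator {0<..} x * (x powr (- Y - 1) * (1 - cos (v * x))) * exp (- v\<^sup>2 / 2)" for v x :: real
      by (auto simp: indicator_def)
    show "AE v::real in lborel. has_bochner_integral lborel
        (\<lambda>x::real. indicator {0<..} x * (x powr (- Y - 1) * (1 - cos (v * x))) * exp (- v\<^sup>2 / 2))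
        (\<bar>v\<bar> powr Y * ?k * exp (- v\<^sup>2 / 2))"
      by (intro AE_I2 has_bochner_integral_mult_left integral_stable_cos_scaled Y)
    have "has_bochner_integral lborel (\<lambda>v. ?k * (\<bar>v\<bar> powr (Y + 1 - 1) * exp (- (1/2 * v\<^sup>2)))) (?k * (Gamma ((Y + 1) / 2) * (1/2) powr - ((Y + 1) / 2)))"
      using Y by (intro has_bochner_integral_mult_right integral_gaussian_powr_line) auto
    moreover have "?k * (\<bar>v\<bar> powr (Y + 1 - 1) * exp (- (1/2 * v\<^sup>2))) = \<bar>v\<bar> powr Y * ?k * exp (- v\<^sup>2 / 2)" for v
      by simp
    ultimately show "has_bochner_integral lborel (\<lambda>v. \<bar>v\<bar> powr Y * ?k * exp (- v\<^sup>2 / 2)) (?k * (Gamma ((Y + 1) / 2) * (1/2) powr - ((Y + 1) / 2)))"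
      by (simp only:)
    show "AE x::real in lborel. has_bochner_integral lborel
        (\<lambda>v::real. indicator {0<..} x * (x powr (- Y - 1) * (1 - cos (v * x))) * exp (- v\<^sup>2 / 2))
        (indicator {0<..} x * (x powr (- Y - 1) * (sqrt (2 * pi) * (1 - exp (- x\<^sup>2 / 2)))))"
      unfolding mult.assoc by (intro AE_I2 has_bochner_integral_mult_right integral_cos_gaussian[unfolded mult.assoc])
  qed measurable
  moreover have "has_bochner_integral lborel (\<lambda>x::real. sqrt (2 * pi) * (indicator {0<..} x * (x powr (- Y - 1) * (1 - exp (- x\<^sup>2 / 2)))))
     (sqrt (2 * pi) * (Gamma (1 - Y / 2) * 2 powr (- Y / 2) / Y))"
    by (intro has_bochner_integral_mult_right integral_stable_gaussian Y)
  ultimately have "?k * (Gamma ((Y + 1) / 2) * (1/2) powr - ((Y + 1) / 2)) = sqrt (2 * pi) * (Gamma (1 - Y / 2) * 2 powr (- Y / 2) / Y)"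
    by (simp add: has_bochner_integral_iff mult_ac)
  moreover have "(1/2) powr - ((Y + 1) / 2) = 2 powr (Y / 2) * sqrt 2"
  proof -
    have "(1/2) powr - ((Y + 1) / 2) = 2 powr ((Y + 1) / 2)"
      by (simp add: powr_minus powr_divide)
    then show ?thesis by (simp add: add_divide_distrib powr_add powr_half_sqrt)
  qed
  moreover have "Gamma ((Y + 1) / 2) > 0" using Y by (intro Gamma_real_pos) auto
  moreover have "2 powr (- Y) = 2 powr (- Y / 2) * 2 powr (- Y / 2)" by (simp flip: powr_add)
  moreover have "2 powr (- Y / 2) * 2 powr (Y / 2) = (1::real)" by (simp flip: powr_add)
  ultimately have "?k * Gamma ((Y + 1) / 2) = sqrt pi * Gamma (1 - Y / 2) * 2 powr (- Y) / Y"
  proof -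
    assume a: "?k * (Gamma ((Y + 1) / 2) * (1/2) powr - ((Y + 1) / 2)) = sqrt (2 * pi) * (Gamma (1 - Y / 2) * 2 powr (- Y / 2) / Y)"
      and b: "(1/2) powr - ((Y + 1) / 2) = 2 powr (Y / 2) * sqrt 2"
      and c: "2 powr (- Y) = 2 powr (- Y / 2) * 2 powr (- Y / 2)" and d: "2 powr (- Y / 2) * 2 powr (Y / 2) = (1::real)"
    have "?k * Gamma ((Y + 1) / 2) = ?k * (Gamma ((Y + 1) / 2) * (2 powr (Y / 2) * sqrt 2)) * (2 powr (- Y / 2) / sqrt 2)"
      using d by (simp add: mult_ac)
    also have "\<dots> = sqrt (2 * pi) * (Gamma (1 - Y / 2) * 2 powr (- Y / 2) / Y) * (2 powr (- Y / 2) / sqrt 2)"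
      using a b by simp
    also have "\<dots> = sqrt pi * Gamma (1 - Y / 2) * 2 powr (- Y) / Y"
      unfolding c by (simp add: real_sqrt_mult)
    finally show ?thesis .
  qed
  moreover have "k = a / (Y * g)" if "k * g = a / Y" "g > 0" for k g a
    using that Y by (simp add: field_simps)
  ultimately have "?k = sqrt pi * Gamma (1 - Y / 2) * 2 powr (- Y) / (Y * Gamma ((Y + 1) / 2))"
    using \<open>Gamma ((Y + 1) / 2) > 0\<close> by blast
  then show ?thesis by (simp only: stable_const_def mult_ac)
qed

lemma integral_stable_cos:
  assumes Y: "1 < Y" "Y < 2"
  shows "has_bochner_integral lborel (\<lambda>x::real. indicator {0<..} x * (x powr (- Y - 1) * (1 - cos (u * x)))) (\<bar>u\<bar> powr Y * stable_const Y)"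
  using integral_stable_cos_scaled[OF Y] stable_const_eq_integral[OF Y] by simp

lemma stable_const_pos:
  assumes Y: "1 < Y" "Y < 2"
  shows "0 < stable_const Y"
  using assms by (auto simp: stable_const_def intro!: divide_pos_pos mult_pos_pos Gamma_real_pos)

text \<open>The duplication formula at \<open>- (Y / 2)\<close> expresses \<open>Gamma (- Y)\<close>
  through \<open>Gamma (- (Y / 2))\<close>, and the reflection formula at \<open>(1 + Y) / 2\<close>
  introduces the cosine. Both formulas are taken over the complex numbers and transferred to real
  arguments.\<close>

lemma stable_const_eq_Gamma:
  assumes Y: "1 < Y" "Y < 2"
  shows "stable_const Y = - Gamma (- Y) * cos (pi * Y / 2)"
proof -
  have noint: "- (Y / 2) \<notin> \<int>\<^sub>\<le>\<^sub>0" "- (Y / 2) + 1 / 2 \<notin> \<int>\<^sub>\<le>\<^sub>0"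
  proof -
    have *: "z \<notin> \<int>\<^sub>\<le>\<^sub>0" if "-1 < z" "z < 0" for z :: real
    proof
      assume "z \<in> \<int>\<^sub>\<le>\<^sub>0"
      then obtain n :: int where "z = of_int n" by (auto elim!: nonpos_Ints_cases)
      with that have "-1 < n" "n < 0" by linarith+
      then show False by auto
    qed
    show "- (Y / 2) \<notin> \<int>\<^sub>\<le>\<^sub>0" "- (Y / 2) + 1 / 2 \<notin> \<int>\<^sub>\<le>\<^sub>0"
      by (rule *; use Y in simp)+
  qed
  have dup: "Gamma (- (Y / 2)) * Gamma (- (Y / 2) + 1 / 2) = 2 * 2 powr Y * sqrt pi * Gamma (- Y)"
  proof -
    have "complex_of_real (- (Y / 2)) \<notin> \<int>\<^sub>\<le>\<^sub>0" "complex_of_real (- (Y / 2)) + 1 / 2 \<notin> \<int>\<^sub>\<le>\<^sub>0"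
      using noint of_real_in_nonpos_Ints_iff[where 'a = complex, of "- (Y / 2)"]
        of_real_in_nonpos_Ints_iff[where 'a = complex, of "- (Y / 2) + 1 / 2"] by simp_all
    from Gamma_legendre_duplication[OF this]
    have "complex_of_real (Gamma (- (Y / 2)) * Gamma (- (Y / 2) + 1 / 2)) =
       complex_of_real (exp ((1 + Y) * ln 2) * sqrt pi * Gamma (- Y))"
      by (simp add: Gamma_complex_of_real[symmetric] exp_of_real[symmetric])
    then have "Gamma (- (Y / 2)) * Gamma (- (Y / 2) + 1 / 2) = exp ((1 + Y) * ln 2) * sqrt pi * Gamma (- Y)"
      by (simp only: of_real_eq_iff)
    also have "exp ((1 + Y) * ln 2) = (2::real) powr (1 + Y)"
      by (simp add: powr_def)
    finally show ?thesis by (simp add: powr_add)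
  qed
  have refl: "Gamma ((1 + Y) / 2) * Gamma (- (Y / 2) + 1 / 2) * cos (pi * Y / 2) = pi"
  proof -
    have "complex_of_real (Gamma ((1 + Y) / 2) * Gamma (1 - (1 + Y) / 2)) = of_real (pi / sin (pi * ((1 + Y) / 2)))"
      using Gamma_reflection_complex[of "of_real ((1 + Y) / 2)"]
      by (simp add: Gamma_complex_of_real[symmetric] sin_of_real[symmetric])
    then have "Gamma ((1 + Y) / 2) * Gamma (1 - (1 + Y) / 2) = pi / sin (pi * ((1 + Y) / 2))"
      by (simp only: of_real_eq_iff)
    moreover have "sin (pi * ((1 + Y) / 2)) = cos (pi * Y / 2)"
      using sin_add[of "pi / 2" "pi * Y / 2"] by (simp add: field_simps)
    moreover have "1 - (1 + Y) / 2 = - (Y / 2) + 1 / 2" by (simp add: field_simps)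
    \<comment> \<open>The angle lies strictly between pi/2 and pi because 1 < Y < 2; hence the
      cosine is nonzero and the reflection formula can be multiplied out.\<close>
    moreover have "cos (pi * Y / 2) < 0"
    proof -
      have "cos (pi * Y / 2) = - cos (pi - pi * Y / 2)" by (simp add: cos_diff)
      moreover have "cos (pi - pi * Y / 2) > 0" using Y by (intro cos_gt_zero_pi) (auto simp: field_simps)
      ultimately show ?thesis by simp
    qed
    ultimately show ?thesis by simp
  qed
  have half: "Gamma (1 - Y / 2) = - (Y / 2) * Gamma (- (Y / 2))"
    using Gamma_plus1[OF noint(1)] by (simp add: add.commute)
  have pos: "Gamma ((1 + Y) / 2) > 0" using Y by (intro Gamma_real_pos) auto
  have "2 powr (- Y) * 2 powr Y = (1::real)" by (simp flip: powr_add)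
  then have p: "2 powr (- Y) = 1 / (2::real) powr Y" by (simp add: field_simps)
  have "- Gamma (- Y) * cos (pi * Y / 2) * (2 * 2 powr Y * sqrt pi) * Gamma ((1 + Y) / 2)
     = - Gamma (- (Y / 2)) * (Gamma ((1 + Y) / 2) * Gamma (- (Y / 2) + 1 / 2) * cos (pi * Y / 2))"
    using dup by (simp add: mult_ac)
  also have "\<dots> = - Gamma (- (Y / 2)) * pi" unfolding refl ..
  also have "\<dots> = stable_const Y * (2 * 2 powr Y * sqrt pi) * Gamma ((1 + Y) / 2)"
  proof -
    have "- g * pi = sqrt pi * (1 / c) * (- (Y / 2) * g) / (Y * h) * (2 * c * sqrt pi) * h" if "c > 0" "h > 0" for c h g :: real
      using that Y by (simp add: field_simps)
    then show ?thesis
      using pos unfolding stable_const_def half p add.commute[of Y 1] by simp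
  qed
  finally have eq: "- Gamma (- Y) * cos (pi * Y / 2) * (2 * 2 powr Y * sqrt pi) * Gamma ((1 + Y) / 2)
     = stable_const Y * (2 * 2 powr Y * sqrt pi) * Gamma ((1 + Y) / 2)" .
  have cancel: "a = b" if "a * k * g = b * k * g" "0 < k" "0 < g" for a b k g :: real
    using that by simp
  show ?thesis
    by (rule cancel[OF eq _ pos, symmetric]) simp
qed

text \<open>The integral \<open>pi * \<bar>x\<bar>\<close> of
  \<open>(1 - cos (u * x)) / u\<^sup>2\<close> is averaged over a Gaussian x. This settles the
  exponent u^2/2; the scale \<open>c = sqrt (2 * s)\<close> gives a general s.\<close>

lemma integral_one_minus_gaussian:
  assumes "s > 0"
  shows "has_bochner_integral lborel (\<lambda>u::real. (1 - exp (- (s * u\<^sup>2))) / u\<^sup>2) (2 * sqrt (pi * s))"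
proof -
  have "has_bochner_integral lborel (\<lambda>u::real. 1 / u\<^sup>2 * (sqrt (2 * pi) * (1 - exp (- u\<^sup>2 / 2)))) (pi * 2)"
  proof (rule tonelli_lborel[where f = "\<lambda>x u::real. 1 / u\<^sup>2 * ((1 - cos (x * u)) * exp (- x\<^sup>2 / 2))"
        and g = "\<lambda>x. pi * \<bar>x\<bar> * exp (- x\<^sup>2 / 2)"])
    show "(\<lambda>(x::real, u::real). 1 / u\<^sup>2 * ((1 - cos (x * u)) * exp (- x\<^sup>2 / 2)) :: real)
      \<in> borel_measurable (lborel \<Otimes>\<^sub>M lborel)"
      by measurable
    show "0 \<le> 1 / u\<^sup>2 * ((1 - cos (x * u)) * exp (- x\<^sup>2 / 2))" for x u :: real
      by simp
    show "AE x::real in lborel. has_bochner_integral lborel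
        (\<lambda>u::real. 1 / u\<^sup>2 * ((1 - cos (x * u)) * exp (- x\<^sup>2 / 2))) (pi * \<bar>x\<bar> * exp (- x\<^sup>2 / 2))"
    proof (rule AE_I2)
      fix x :: real
      have "(1 - cos (u * x)) / u\<^sup>2 * exp (- x\<^sup>2 / 2) = 1 / u\<^sup>2 * ((1 - cos (x * u)) * exp (- x\<^sup>2 / 2))" for u
        by (simp add: mult.commute)
      moreover have "has_bochner_integral lborel (\<lambda>u. (1 - cos (u * x)) / u\<^sup>2 * exp (- x\<^sup>2 / 2)) (pi * \<bar>x\<bar> * exp (- x\<^sup>2 / 2))"
        by (intro has_bochner_integral_mult_left integral_one_minus_cos)
      ultimately
      show "has_bochner_integral lborel
        (\<lambda>u::real. 1 / u\<^sup>2 * ((1 - cos (x * u)) * exp (- x\<^sup>2 / 2))) (pi * \<bar>x\<bar> * exp (- x\<^sup>2 / 2))"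
        by (simp only:)
    qed
    have "has_bochner_integral lborel (\<lambda>v::real. \<bar>v\<bar> powr (2 - 1) * exp (- (1/2 * v\<^sup>2))) (Gamma (2 / 2) * (1/2) powr - (2 / 2))"
      by (intro integral_gaussian_powr_line) auto
    then have "has_bochner_integral lborel (\<lambda>v::real. \<bar>v\<bar> * exp (- v\<^sup>2 / 2)) 2"
      by (simp add: powr_minus)
    from has_bochner_integral_mult_right[OF this, of pi]
    show "has_bochner_integral lborel (\<lambda>x. pi * \<bar>x\<bar> * exp (- x\<^sup>2 / 2)) (pi * 2)"
      by (simp add: mult.assoc)
    show "AE u::real in lborel. has_bochner_integral lborel
        (\<lambda>x::real. 1 / u\<^sup>2 * ((1 - cos (x * u)) * exp (- x\<^sup>2 / 2))) (1 / u\<^sup>2 * (sqrt (2 * pi) * (1 - exp (- u\<^sup>2 / 2))))"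
      by (intro AE_I2 has_bochner_integral_mult_right integral_cos_gaussian)
  qed measurable
  from has_bochner_integral_mult_right[OF this, of "1 / sqrt (2 * pi)"]
  have "has_bochner_integral lborel (\<lambda>u::real. 1 / sqrt (2 * pi) * (1 / u\<^sup>2 * (sqrt (2 * pi) * (1 - exp (- u\<^sup>2 / 2))))) (1 / sqrt (2 * pi) * (pi * 2))"
    by simp
  moreover have "1 / sqrt (2 * pi) * (1 / u\<^sup>2 * (sqrt (2 * pi) * (1 - exp (- u\<^sup>2 / 2)))) = (1 - exp (- u\<^sup>2 / 2)) / u\<^sup>2" for u
    by simp
  moreover have "1 / sqrt (2 * pi) * (pi * 2) = sqrt (2 * pi)"
    by (simp add: field_simps)
  ultimately have 1: "has_bochner_integral lborel (\<lambda>u::real. (1 - exp (- u\<^sup>2 / 2)) / u\<^sup>2) (sqrt (2 * pi))"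
    by (simp only:)
  define c where "c = sqrt (2 * s)"
  have c: "c > 0" "c\<^sup>2 = 2 * s" using assms by (auto simp: c_def)
  from 1 have "has_bochner_integral lborel (\<lambda>u::real. (1 - exp (- (0 + c * u)\<^sup>2 / 2)) / (0 + c * u)\<^sup>2) (sqrt (2 * pi) /\<^sub>R \<bar>c\<bar>)"
    using c by (subst (asm) lborel_has_bochner_integral_real_affine_iff[where t = 0 and c = c]) auto
  from has_bochner_integral_mult_right[OF this, of "c\<^sup>2"]
  have "has_bochner_integral lborel (\<lambda>u::real. c\<^sup>2 * ((1 - exp (- (0 + c * u)\<^sup>2 / 2)) / (0 + c * u)\<^sup>2)) (c\<^sup>2 * (sqrt (2 * pi) /\<^sub>R \<bar>c\<bar>))"
    by simp
  moreover have "c\<^sup>2 * ((1 - exp (- (0 + c * u)\<^sup>2 / 2)) / (0 + c * u)\<^sup>2) = (1 - exp (- (s * u\<^sup>2))) / u\<^sup>2" for u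
    using c assms by (simp add: power_mult_distrib)
  moreover have "c\<^sup>2 * (sqrt (2 * pi) /\<^sub>R \<bar>c\<bar>) = 2 * sqrt (pi * s)"
  proof -
    have "c\<^sup>2 * (sqrt (2 * pi) /\<^sub>R \<bar>c\<bar>) = c * sqrt (2 * pi)"
      using c(1) by (simp add: power2_eq_square)
    also have "\<dots> = sqrt (2\<^sup>2 * (pi * s))"
      unfolding c_def real_sqrt_mult[symmetric] by (simp add: mult_ac)
    finally show ?thesis by (simp add: real_sqrt_mult)
  qed
  ultimately show ?thesis by (simp only:)
qed

lemma integrable_one_minus_exp_laplace:
  fixes s :: real
  assumes "s \<ge> 0"
  shows "integrable lborel (\<lambda>u::real. (1 - exp (- (s * (u\<^sup>2 + 1/4)))) / (u\<^sup>2 + 1/4))"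
proof (rule Bochner_Integration.integrable_bound)
  show "integrable lborel (\<lambda>u::real. 1 / (u\<^sup>2 + 1/4))"
    using integral_laplace by (simp add: has_bochner_integral_iff)
  have "\<bar>1 - exp (- (s * (u\<^sup>2 + 1/4)))\<bar> \<le> 1" for u :: real
    using assms by simp
  then show "AE u in lborel. norm ((1 - exp (- (s * (u\<^sup>2 + 1/4)))) / (u\<^sup>2 + 1/4)) \<le> norm (1 / (u\<^sup>2 + 1/4))"
    by (intro AE_I2) (auto simp: abs_divide intro!: divide_right_mono)
qed measurable

text \<open>The quotient (1 - exp(-s b)) / b is compared at b = a + 1/4 and b = a. The difference is
  a difference of two terms, each between 0 and the stated bound. The bound is linear in s and
  integrable when a = u^2, so it still dominates after division by s.\<close>

lemma one_minus_exp_laplace_diff_bound: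
  fixes s a :: real
  assumes "s \<ge> 0" "a > 0"
  shows "\<bar>(1 - exp (- (s * (a + 1/4)))) / (a + 1/4) - (1 - exp (- (s * a))) / a\<bar> \<le> s / 4 / (a + 1/4)"
proof -
  have eq: "(1 - exp (- (s * (a + 1/4)))) / (a + 1/4) - (1 - exp (- (s * a))) / a
     = exp (- (s * a)) * (1 - exp (- (s / 4))) / (a + 1/4) - (1 - exp (- (s * a))) / a / 4 / (a + 1/4)"
  proof -
    have "exp (- (s * (a + 1/4))) = exp (- (s * a)) * exp (- (s / 4))"
      by (simp add: distrib_left flip: exp_add)
    then show ?thesis using assms by (simp add: divide_simps) (simp add: algebra_simps)
  qed
  have e: "1 - exp (- y) \<le> y" "0 \<le> 1 - exp (- y)" if "y \<ge> 0" for y :: real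
    using exp_ge_add_one_self[of "- y"] that by auto
  have "exp (- (s * a)) * (1 - exp (- (s / 4))) \<le> 1 * (s / 4)"
    using assms e[of "s / 4"] by (intro mult_mono) auto
  then have 1: "exp (- (s * a)) * (1 - exp (- (s / 4))) / (a + 1/4) \<le> s / 4 / (a + 1/4)"
    using assms by (intro divide_right_mono) auto
  have "(1 - exp (- (s * a))) / a \<le> s"
    using assms e[of "s * a"] by (simp add: divide_le_eq)
  then have 2: "(1 - exp (- (s * a))) / a / 4 / (a + 1/4) \<le> s / 4 / (a + 1/4)"
    using assms by (intro divide_right_mono) auto
  have 3: "0 \<le> exp (- (s * a)) * (1 - exp (- (s / 4))) / (a + 1/4)" "0 \<le> (1 - exp (- (s * a))) / a / 4 / (a + 1/4)"
    using assms e by auto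
  show ?thesis unfolding eq using 1 2 3 by linarith
qed

text \<open>Adding 1/4 to \<open>u\<^sup>2\<close> changes the Gaussian integral only by o(s):
  divided by s, both quotients tend to 1 for fixed u, so the integrand of the difference tends to 0.
  The Gaussian part thus has no term of order t of its own.\<close>

lemma integral_one_minus_exp_laplace_asymp:
  "((\<lambda>s::real. ((\<integral>u. (1 - exp (- (s * (u\<^sup>2 + 1/4)))) / (u\<^sup>2 + 1/4) \<partial>lborel) - 2 * sqrt (pi * s)) / s) \<longlongrightarrow> 0) (at_right 0)"
proof -
  define F where "F s u = ((1 - exp (- (s * (u\<^sup>2 + 1/4)))) / (u\<^sup>2 + 1/4) - (1 - exp (- (s * u\<^sup>2))) / u\<^sup>2) / s" for s u :: real
  have "((\<lambda>s. \<integral>u. F s u \<partial>lborel) \<longlongrightarrow> (\<integral>u. (\<lambda>_::real. 0) u \<partial>lborel)) (at_right 0)"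
  proof (rule dominated_convergence_at_right_0)
    show "integrable lborel (\<lambda>u::real. 1/4 * (1 / (u\<^sup>2 + 1/4)))"
      using integral_laplace by (intro integrable_mult_right) (simp add: has_bochner_integral_iff)
    show "AE u in lborel. ((\<lambda>s. F s u) \<longlongrightarrow> 0) (at_right 0)"
      using AE_lborel_singleton[of "0::real"]
    proof eventually_elim
      fix u :: real assume "u \<noteq> 0"
      define a where "a = u\<^sup>2"
      have "a > 0" using \<open>u \<noteq> 0\<close> by (simp add: a_def)
      have lim: "((\<lambda>s. (1 - exp (- (s * b))) / b / s) \<longlongrightarrow> 1) (at_right 0)" if "b > 0" for b :: real
      proof -
        have "((\<lambda>s. (1 - exp (- (s * b))) / b / s) \<longlongrightarrow> b * inverse b) (at_right 0)"
          using that by real_asymp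
        then show ?thesis using that by simp
      qed
      have "((\<lambda>s. (1 - exp (- (s * (a + 1/4)))) / (a + 1/4) / s - (1 - exp (- (s * a))) / a / s) \<longlongrightarrow> 1 - 1) (at_right 0)"
        using \<open>a > 0\<close> by (intro tendsto_diff lim) auto
      then show "((\<lambda>s. F s u) \<longlongrightarrow> 0) (at_right 0)"
        unfolding F_def a_def[symmetric] diff_divide_distrib[of _ _ "s::real" for s] by simp
    qed
    show "AE u in lborel. norm (F s u) \<le> 1/4 * (1 / (u\<^sup>2 + 1/4))" if "0 < s" "s \<le> 1" for s
      using AE_lborel_singleton[of "0::real"]
    proof eventually_elim
      fix u :: real assume "u \<noteq> 0"
      then have "\<bar>(1 - exp (- (s * (u\<^sup>2 + 1/4)))) / (u\<^sup>2 + 1/4) - (1 - exp (- (s * u\<^sup>2))) / u\<^sup>2\<bar> \<le> s / 4 / (u\<^sup>2 + 1/4)"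
        using that by (intro one_minus_exp_laplace_diff_bound) auto
      then have "norm (F s u) \<le> s / 4 / (u\<^sup>2 + 1/4) / s"
        unfolding F_def real_norm_def abs_divide abs_of_pos[OF that(1)] using that by (intro divide_right_mono) auto
      then show "norm (F s u) \<le> 1/4 * (1 / (u\<^sup>2 + 1/4))" using that by simp
    qed
  qed (auto simp: F_def)
  then have lim: "((\<lambda>s. \<integral>u. F s u \<partial>lborel) \<longlongrightarrow> 0) (at_right 0)" by simp
  have eq: "(\<integral>u. F s u \<partial>lborel) = ((\<integral>u. (1 - exp (- (s * (u\<^sup>2 + 1/4)))) / (u\<^sup>2 + 1/4) \<partial>lborel) - 2 * sqrt (pi * s)) / s"
    if "s > 0" for s
    unfolding F_def using integral_one_minus_gaussian[OF that] integrable_one_minus_exp_laplace[of s] that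
    by (subst integral_divide_zero, subst Bochner_Integration.integral_diff) (auto simp: has_bochner_integral_iff)
  show ?thesis
    by (rule Lim_transform_eventually[OF lim]) (use eventually_at_right_less[of 0] eq in \<open>auto elim: eventually_mono\<close>)
qed

section \<open>The exponent of the tilted process\<close>

locale cgmy_params =
  fixes C G M Y \<sigma> :: real
  assumes C: "C > 0" and G: "G > 0" and M: "M > 1" and Y1: "1 < Y" and Y2: "Y < 2" and \<sigma>: "\<sigma> > 0"
begin

text \<open>
  Multiplying the CGMY density by \<open>exp (x / 2)\<close>, as on the line \<open>Re z = 1/2\<close>, turns the tempering parameters
  \<open>M, G\<close> into \<open>M - 1/2, G + 1/2\<close>; both half-lines are folded onto the positive one.
\<close>

definition tilt :: "real \<Rightarrow> real" where
  "tilt x = exp (- ((M - 1/2) * x)) + exp (- ((G + 1/2) * x))"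

definition osc :: "real \<Rightarrow> real" where
  "osc u = (\<integral>x. indicator {0<..} x * (x powr (- Y - 1) * (tilt x * (1 - cos (u * x)))) \<partial>lborel)"

text \<open>The value of \<open>rho\<close> at 0, namely the integral of (exp x + 1) / 2 - exp (x /
  2) against the Levy measure. It is a sum of second differences of \<open>a powr Y\<close> with
  step 1/2, centred at M - 1/2 and G + 1/2.\<close>

definition rho0 :: real where
  "rho0 = C / 2 * Gamma (- Y) * ((M - 1) powr Y - 2 * (M - 1/2) powr Y + M powr Y
     + (G + 1) powr Y - 2 * (G + 1/2) powr Y + G powr Y)"

text \<open>Minus the real part of the jump exponent at 1/2 + iu; the identification is
  \<open>Re_jump_exponent\<close>.\<close>

definition rho :: "real \<Rightarrow> real" where
  "rho u = rho0 + C * osc u"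

lemmas Y_bounds = Y1 Y2

lemma tilt_measurable [measurable]: "tilt \<in> borel_measurable borel"
  unfolding tilt_def[abs_def] by measurable

lemma tilt_nonneg: "0 \<le> tilt x"
  by (simp add: tilt_def)

lemma tilt_le_2: "0 \<le> x \<Longrightarrow> tilt x \<le> 2"
  using M G by (auto simp: tilt_def intro!: add_mono[of _ "1::real" _ 1, simplified])

lemma osc_kernel_bounds:
  "0 \<le> indicator {0<..} x * (x powr (- Y - 1) * (tilt x * (1 - cos (u * x))))"
  "indicator {0<..} x * (x powr (- Y - 1) * (tilt x * (1 - cos (u * x))))
    \<le> 2 * (indicator {0<..} x * (x powr (- Y - 1) * (1 - cos (u * x))))"
proof -
  show "0 \<le> indicator {0<..} x * (x powr (- Y - 1) * (tilt x * (1 - cos (u * x))))"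
    by (auto simp: tilt_nonneg indicator_def)
  have "tilt x * (x powr (- Y - 1) * (1 - cos (u * x))) \<le> 2 * (x powr (- Y - 1) * (1 - cos (u * x)))" if "x > 0"
    using that by (intro mult_right_mono tilt_le_2) auto
  then show "indicator {0<..} x * (x powr (- Y - 1) * (tilt x * (1 - cos (u * x))))
    \<le> 2 * (indicator {0<..} x * (x powr (- Y - 1) * (1 - cos (u * x))))"
    by (auto simp: indicator_def mult_ac)
qed

lemma integrable_stable_cos: "integrable lborel (\<lambda>x. indicator {0<..} x * (x powr (- Y - 1) * (1 - cos (u * x))))"
  using integral_stable_cos[OF Y_bounds] by (auto simp: has_bochner_integral_iff)

lemma integrable_osc_kernel:
  "integrable lborel (\<lambda>x. indicator {0<..} x * (x powr (- Y - 1) * (tilt x * (1 - cos (u * x)))))"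
proof (rule Bochner_Integration.integrable_bound)
  show "integrable lborel (\<lambda>x. 2 * (indicator {0<..} x * (x powr (- Y - 1) * (1 - cos (u * x)))))"
    by (intro integrable_mult_right integrable_stable_cos)
  show "AE x in lborel. norm (indicator {0<..} x * (x powr (- Y - 1) * (tilt x * (1 - cos (u * x)))))
    \<le> norm (2 * (indicator {0<..} x * (x powr (- Y - 1) * (1 - cos (u * x)))))"
    using osc_kernel_bounds[of _ u] by (intro AE_I2) (auto intro: order_trans simp del: mult_eq_0_iff)
qed measurable

lemma osc_measurable [measurable]: "osc \<in> borel_measurable borel"
  unfolding osc_def[abs_def] by measurable

lemma rho_measurable [measurable]: "rho \<in> borel_measurable borel"
  unfolding rho_def[abs_def] by measurable

lemma osc_nonneg: "0 \<le> osc u"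
  unfolding osc_def by (intro Bochner_Integration.integral_nonneg osc_kernel_bounds)

lemma osc_le: "osc u \<le> 2 * (\<bar>u\<bar> powr Y * stable_const Y)"
proof -
  have "osc u \<le> (\<integral>x. 2 * (indicator {0<..} x * (x powr (- Y - 1) * (1 - cos (u * x)))) \<partial>lborel)"
    unfolding osc_def by (intro integral_mono integrable_osc_kernel integrable_mult_right integrable_stable_cos osc_kernel_bounds)
  also have "\<dots> = 2 * (\<bar>u\<bar> powr Y * stable_const Y)"
    using integral_stable_cos[OF Y_bounds, of u] by (simp add: has_bochner_integral_iff)
  finally show ?thesis .
qed

text \<open>The factor \<open>(exp (x / 4) - exp (- x / 4))\<^sup>2\<close> makes a second
  difference of three exponentials. Second differences annihilate affine functions, so the
  compensators \<open>- 1 + a * x\<close> may be inserted and \<open>integral_stable_exp\<close>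
  applies to each term.\<close>

lemma integral_second_difference:
  assumes "a > 0"
  shows "has_bochner_integral lborel (\<lambda>x. indicator {0<..} x * (x powr (- Y - 1) * (exp (- ((a + 1/2) * x)) * (exp (x / 4) - exp (- x / 4))\<^sup>2)))
     (Gamma (- Y) * (a powr Y - 2 * (a + 1/2) powr Y + (a + 1) powr Y))"
proof -
  have "has_bochner_integral lborel (\<lambda>x. indicator {0<..} x * (x powr (- Y - 1) * (exp (- (a * x)) - 1 + a * x))
        - 2 * (indicator {0<..} x * (x powr (- Y - 1) * (exp (- ((a + 1/2) * x)) - 1 + (a + 1/2) * x)))
        + indicator {0<..} x * (x powr (- Y - 1) * (exp (- ((a + 1) * x)) - 1 + (a + 1) * x)))
     (Gamma (- Y) * a powr Y - 2 * (Gamma (- Y) * (a + 1/2) powr Y) + Gamma (- Y) * (a + 1) powr Y)"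
    using assms by (intro has_bochner_integral_add has_bochner_integral_diff has_bochner_integral_mult_right integral_stable_exp Y_bounds) auto
  moreover have "indicator {0<..} x * (x powr (- Y - 1) * (exp (- (a * x)) - 1 + a * x))
        - 2 * (indicator {0<..} x * (x powr (- Y - 1) * (exp (- ((a + 1/2) * x)) - 1 + (a + 1/2) * x)))
        + indicator {0<..} x * (x powr (- Y - 1) * (exp (- ((a + 1) * x)) - 1 + (a + 1) * x))
      = indicator {0<..} x * (x powr (- Y - 1) * (exp (- ((a + 1/2) * x)) * (exp (x / 4) - exp (- x / 4))\<^sup>2))" for x :: real
  proof -
    have "exp (- ((a + 1/2) * x)) * (exp (x / 4) - exp (- x / 4))\<^sup>2
        = exp (- ((a + 1/2) * x)) * (exp (x / 4) * exp (x / 4) - 2 * (exp (x / 4) * exp (- x / 4)) + exp (- x / 4) * exp (- x / 4))"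
      by (simp add: power2_eq_square algebra_simps)
    also have "\<dots> = exp (- (a * x)) - 2 * exp (- ((a + 1/2) * x)) + exp (- ((a + 1) * x))"
      by (simp add: distrib_left right_diff_distrib flip: exp_add) (simp add: algebra_simps)
    also have "\<dots> = (exp (- (a * x)) - 1 + a * x) - 2 * (exp (- ((a + 1/2) * x)) - 1 + (a + 1/2) * x)
        + (exp (- ((a + 1) * x)) - 1 + (a + 1) * x)"
      by (simp add: algebra_simps)
    finally have e: "exp (- ((a + 1/2) * x)) * (exp (x / 4) - exp (- x / 4))\<^sup>2
      = (exp (- (a * x)) - 1 + a * x) - 2 * (exp (- ((a + 1/2) * x)) - 1 + (a + 1/2) * x)
        + (exp (- ((a + 1) * x)) - 1 + (a + 1) * x)" .
    have "i * (p * w) - 2 * (i * (p * y)) + i * (p * z) = i * (p * (w - 2 * y + z))" for i p w y z :: real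
      by (simp add: algebra_simps)
    then show ?thesis unfolding e .
  qed
  moreover have "Gamma (- Y) * a powr Y - 2 * (Gamma (- Y) * (a + 1/2) powr Y) + Gamma (- Y) * (a + 1) powr Y
     = Gamma (- Y) * (a powr Y - 2 * (a + 1/2) powr Y + (a + 1) powr Y)"
    by (simp add: algebra_simps)
  ultimately show ?thesis by (simp only:)
qed

text \<open>The second-difference formula with a = M - 1 for the positive jumps and a = G for the
  negative ones; M > 1 makes the first base positive.\<close>

lemma integral_rho0:
  "has_bochner_integral lborel (\<lambda>x. indicator {0<..} x * (x powr (- Y - 1) * (C / 2 * (tilt x * (exp (x / 4) - exp (- x / 4))\<^sup>2)))) rho0"
proof -
  have "has_bochner_integral lborel (\<lambda>x. C / 2 * (
        indicator {0<..} x * (x powr (- Y - 1) * (exp (- (((M - 1) + 1/2) * x)) * (exp (x / 4) - exp (- x / 4))\<^sup>2))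
      + indicator {0<..} x * (x powr (- Y - 1) * (exp (- ((G + 1/2) * x)) * (exp (x / 4) - exp (- x / 4))\<^sup>2))))
     (C / 2 * (Gamma (- Y) * ((M - 1) powr Y - 2 * ((M - 1) + 1/2) powr Y + ((M - 1) + 1) powr Y)
       + Gamma (- Y) * (G powr Y - 2 * (G + 1/2) powr Y + (G + 1) powr Y)))"
    using M G by (intro has_bochner_integral_mult_right has_bochner_integral_add integral_second_difference) auto
  moreover have "C / 2 * (
        indicator {0<..} x * (x powr (- Y - 1) * (exp (- (((M - 1) + 1/2) * x)) * (exp (x / 4) - exp (- x / 4))\<^sup>2))
      + indicator {0<..} x * (x powr (- Y - 1) * (exp (- ((G + 1/2) * x)) * (exp (x / 4) - exp (- x / 4))\<^sup>2)))
     = indicator {0<..} x * (x powr (- Y - 1) * (C / 2 * (tilt x * (exp (x / 4) - exp (- x / 4))\<^sup>2)))" for x :: real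
  proof -
    have "(M - 1) + 1/2 = M - 1/2" by simp
    then show ?thesis by (simp only: tilt_def) (simp add: algebra_simps)
  qed
  moreover have "C / 2 * (Gamma (- Y) * ((M - 1) powr Y - 2 * ((M - 1) + 1/2) powr Y + ((M - 1) + 1) powr Y)
       + Gamma (- Y) * (G powr Y - 2 * (G + 1/2) powr Y + (G + 1) powr Y)) = rho0"
  proof -
    have "(M - 1) + 1/2 = M - 1/2" "(M - 1) + 1 = M" by simp_all
    then show ?thesis by (simp only: rho0_def) (simp add: algebra_simps)
  qed
  ultimately show ?thesis by (simp only:)
qed

lemma rho0_nonneg: "0 \<le> rho0"
proof -
  have "0 \<le> (\<integral>x. indicator {0<..} x * (x powr (- Y - 1) * (C / 2 * (tilt x * (exp (x / 4) - exp (- x / 4))\<^sup>2))) \<partial>lborel)"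
    using C tilt_nonneg by (intro Bochner_Integration.integral_nonneg) (auto simp: indicator_def)
  then show ?thesis using integral_rho0 by (simp add: has_bochner_integral_iff)
qed

lemma rho_nonneg: "0 \<le> rho u"
  using C osc_nonneg rho0_nonneg by (simp add: rho_def)

lemma rho_le: "rho u \<le> rho0 + 2 * C * stable_const Y * \<bar>u\<bar> powr Y"
  using osc_le[of u] C by (simp add: rho_def mult_left_mono algebra_simps)

text \<open>
  The integrand has a sign because \<open>tilt x / (u\<^sup>2 + 1/4) \<le> 2 / u\<^sup>2\<close>, so its integral, which produces part of the
  coefficient of \<open>t\<close>, can be computed by exchanging the order of integration.
\<close>

lemma integral_deficit:
  "has_bochner_integral lborel (\<lambda>u. 2 * stable_const Y * \<bar>u\<bar> powr (Y - 2) - osc u / (u\<^sup>2 + 1/4))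
     (2 * pi * (Gamma (- Y) * (M powr Y - (M - 1/2) powr Y + (G + 1) powr Y - (G + 1/2) powr Y)))"
proof -
  define N where "N u = 2 * stable_const Y * \<bar>u\<bar> powr (Y - 2) - osc u / (u\<^sup>2 + 1/4)" for u
  define f where "f x u = indicator {0<..} x * (x powr (- Y - 1) * ((1 - cos (u * x)) * (2 / u\<^sup>2 - tilt x / (u\<^sup>2 + 1/4))))" for x u :: real
  define g where "g x = indicator {0<..} x * (x powr (- Y - 1) * (2 * pi * (x - tilt x * (1 - exp (- x / 2)))))" for x :: real
  have "has_bochner_integral lborel N
     (2 * pi * (Gamma (- Y) * (M powr Y - (M - 1/2) powr Y + (G + 1) powr Y - (G + 1/2) powr Y)))"
  proof (rule tonelli_lborel[where f = f and g = g])
    show "case_prod f \<in> borel_measurable (lborel \<Otimes>\<^sub>M lborel)"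
      unfolding f_def[abs_def] by measurable
    show "N \<in> borel_measurable lborel"
      unfolding N_def[abs_def] by measurable
    show "0 \<le> f x u" for x u
    proof (cases "x > 0 \<and> u \<noteq> 0")
      case True
      then have "tilt x / (u\<^sup>2 + 1/4) \<le> 2 / u\<^sup>2"
        using tilt_le_2[of x] tilt_nonneg[of x] by (intro frac_le) auto
      then show ?thesis using True by (auto simp: f_def)
    qed (auto simp: f_def)
    show "AE x in lborel. has_bochner_integral lborel (f x) (g x)"
    proof (rule AE_I2)
      fix x :: real
      show "has_bochner_integral lborel (f x) (g x)"
      proof (cases "x > 0")
        case True
        have "has_bochner_integral lborel (\<lambda>u. 2 * ((1 - cos (u * x)) / u\<^sup>2) - tilt x * (1 / (u\<^sup>2 + 1/4) - cos (u * x) / (u\<^sup>2 + 1/4)))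
           (2 * (pi * \<bar>x\<bar>) - tilt x * (2 * pi - 2 * pi * exp (- \<bar>x\<bar> / 2)))"
          by (intro has_bochner_integral_mult_right has_bochner_integral_diff integral_one_minus_cos integral_laplace integral_cos_laplace)
        then have "has_bochner_integral lborel (\<lambda>u. x powr (- Y - 1) * (2 * ((1 - cos (u * x)) / u\<^sup>2) - tilt x * (1 / (u\<^sup>2 + 1/4) - cos (u * x) / (u\<^sup>2 + 1/4))))
           (x powr (- Y - 1) * (2 * (pi * \<bar>x\<bar>) - tilt x * (2 * pi - 2 * pi * exp (- \<bar>x\<bar> / 2))))"
          by (intro has_bochner_integral_mult_right)
        moreover have "2 * ((1 - cos (u * x)) / u\<^sup>2) - tilt x * (1 / (u\<^sup>2 + 1/4) - cos (u * x) / (u\<^sup>2 + 1/4))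
            = (1 - cos (u * x)) * (2 / u\<^sup>2 - tilt x / (u\<^sup>2 + 1/4))" for u
          by (simp add: algebra_simps diff_divide_distrib)
        moreover have "2 * (pi * \<bar>x\<bar>) - tilt x * (2 * pi - 2 * pi * exp (- \<bar>x\<bar> / 2)) = 2 * pi * (x - tilt x * (1 - exp (- x / 2)))"
          using True by (simp add: algebra_simps)
        ultimately show ?thesis
          using True by (simp add: f_def[abs_def] g_def)
      qed (simp add: f_def[abs_def] g_def has_bochner_integral_zero)
    qed
    show "AE u in lborel. has_bochner_integral lborel (\<lambda>x. f x u) (N u)"
      using AE_lborel_singleton[of "0::real"]
    proof eventually_elim
      fix u :: real assume u: "u \<noteq> 0"
      have "has_bochner_integral lborel (\<lambda>x. 2 / u\<^sup>2 * (indicator {0<..} x * (x powr (- Y - 1) * (1 - cos (u * x))))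
            - 1 / (u\<^sup>2 + 1/4) * (indicator {0<..} x * (x powr (- Y - 1) * (tilt x * (1 - cos (u * x))))))
           (2 / u\<^sup>2 * (\<bar>u\<bar> powr Y * stable_const Y) - 1 / (u\<^sup>2 + 1/4) * osc u)"
        using integrable_osc_kernel[of u]
        by (intro has_bochner_integral_diff has_bochner_integral_mult_right integral_stable_cos Y_bounds)
          (simp add: has_bochner_integral_iff osc_def)
      moreover have "2 / u\<^sup>2 * (indicator {0<..} x * (x powr (- Y - 1) * (1 - cos (u * x))))
            - 1 / (u\<^sup>2 + 1/4) * (indicator {0<..} x * (x powr (- Y - 1) * (tilt x * (1 - cos (u * x))))) = f x u" for x
      proof -
        have "a * (i * (p * c)) - 1 / w * (i * (p * (d * c))) = i * (p * (c * (a - d / w)))" for a i p c d w :: real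
          by (simp add: algebra_simps)
        then show ?thesis unfolding f_def .
      qed
      moreover have "2 / u\<^sup>2 * (\<bar>u\<bar> powr Y * stable_const Y) - 1 / (u\<^sup>2 + 1/4) * osc u = N u"
      proof -
        have "\<bar>u\<bar> powr (Y - 2) = \<bar>u\<bar> powr Y / u\<^sup>2"
          using u by (simp add: powr_diff)
        then show ?thesis by (simp add: N_def)
      qed
      ultimately show "has_bochner_integral lborel (\<lambda>x. f x u) (N u)" by (simp only:)
    qed
    \<comment> \<open>Multiplication by \<open>exp (- x / 2)\<close> raises M - 1/2 to M and G + 1/2
      to G + 1. In the signed sum of the four compensators the constants cancel and the slopes add
      up to 1/2 + 1/2, which accounts exactly for the term x in \<open>g\<close>.\<close>
    define E where "E a x = indicator {0<..} x * (x powr (- Y - 1) * (exp (- (a * x)) - 1 + a * x))" for a x :: real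
    have "has_bochner_integral lborel (\<lambda>x. 2 * pi * (E M x - E (M - 1/2) x + E (G + 1) x - E (G + 1/2) x))
       (2 * pi * (Gamma (- Y) * M powr Y - Gamma (- Y) * (M - 1/2) powr Y + Gamma (- Y) * (G + 1) powr Y - Gamma (- Y) * (G + 1/2) powr Y))"
      unfolding E_def using M G
      by (intro has_bochner_integral_mult_right has_bochner_integral_add has_bochner_integral_diff integral_stable_exp Y_bounds) auto
    moreover have "2 * pi * (E M x - E (M - 1/2) x + E (G + 1) x - E (G + 1/2) x) = g x" for x
    proof -
      have "exp (- ((M - 1/2) * x)) * exp (- x / 2) = exp (- (M * x))" "exp (- ((G + 1/2) * x)) * exp (- x / 2) = exp (- ((G + 1) * x))"
        unfolding exp_add[symmetric] by (simp_all add: algebra_simps)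
      then have "tilt x * (1 - exp (- x / 2)) = tilt x - exp (- (M * x)) - exp (- ((G + 1) * x))"
        by (simp add: tilt_def algebra_simps)
      then have "x - tilt x * (1 - exp (- x / 2)) = (exp (- (M * x)) - 1 + M * x) - (exp (- ((M - 1/2) * x)) - 1 + (M - 1/2) * x)
        + (exp (- ((G + 1) * x)) - 1 + (G + 1) * x) - (exp (- ((G + 1/2) * x)) - 1 + (G + 1/2) * x)"
        by (simp add: tilt_def algebra_simps)
      then show ?thesis
        unfolding g_def E_def by (simp only:) (simp add: algebra_simps)
    qed
    moreover have "2 * pi * (Gamma (- Y) * M powr Y - Gamma (- Y) * (M - 1/2) powr Y + Gamma (- Y) * (G + 1) powr Y - Gamma (- Y) * (G + 1/2) powr Y)
      = 2 * pi * (Gamma (- Y) * (M powr Y - (M - 1/2) powr Y + (G + 1) powr Y - (G + 1/2) powr Y))"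
      by (simp add: algebra_simps)
    ultimately show "has_bochner_integral lborel g
     (2 * pi * (Gamma (- Y) * (M powr Y - (M - 1/2) powr Y + (G + 1) powr Y - (G + 1/2) powr Y)))"
      by (simp only:)
  qed
  then show ?thesis unfolding N_def[abs_def] .
qed

end

section \<open>Asymptotics of the Fourier integral\<close>

context cgmy_params
begin

text \<open>The contribution of the Gaussian component together with its drift
  \<open>- \<sigma>\<^sup>2 / 2\<close> to the transform at z = 1/2 + iu, where
  \<open>z\<^sup>2 - z\<close> is \<open>- (u\<^sup>2 + 1/4)\<close>.\<close>

definition gauss :: "real \<Rightarrow> real \<Rightarrow> real" where
  "gauss t u = exp (- (t * (\<sigma>\<^sup>2 / 2) * (u\<^sup>2 + 1/4)))"

lemma gauss_measurable [measurable]: "gauss t \<in> borel_measurable borel"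
  unfolding gauss_def[abs_def] by measurable

lemma gauss_pos: "0 < gauss t u"
  by (simp add: gauss_def)

lemma gauss_le_1: "0 \<le> t \<Longrightarrow> gauss t u \<le> 1"
  by (simp add: gauss_def)

lemma gauss_tendsto: "((\<lambda>t. gauss t u) \<longlongrightarrow> 1) (at_right 0)"
proof -
  have "((\<lambda>t. gauss t u) \<longlongrightarrow> exp (- (0 * (\<sigma>\<^sup>2 / 2) * (u\<^sup>2 + 1/4)))) (at_right 0)"
    unfolding gauss_def by (intro tendsto_intros)
  then show ?thesis by simp
qed

lemma integral_gauss_mult:
  assumes "integrable lborel f"
  shows "0 < t \<Longrightarrow> integrable lborel (\<lambda>u. gauss t u * f u)"
    and "((\<lambda>t. \<integral>u. gauss t u * f u \<partial>lborel) \<longlongrightarrow> (\<integral>u. f u \<partial>lborel)) (at_right 0)"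
proof -
  have [measurable]: "f \<in> borel_measurable borel"
    using borel_measurable_integrable[OF assms] by simp
  have b: "norm (gauss t u * f u) \<le> norm (f u)" if "0 < t" for t u
    using that gauss_pos[of t u] gauss_le_1[of t u] by (simp add: abs_mult mult_left_le_one_le)
  show "integrable lborel (\<lambda>u. gauss t u * f u)" if "0 < t"
    using b[OF that] by (intro Bochner_Integration.integrable_bound[OF assms]) auto
  show "((\<lambda>t. \<integral>u. gauss t u * f u \<partial>lborel) \<longlongrightarrow> (\<integral>u. f u \<partial>lborel)) (at_right 0)"
  proof (rule dominated_convergence_at_right_0[where w = "\<lambda>u. norm (f u)"])
    show "AE u in lborel. ((\<lambda>t. gauss t u * f u) \<longlongrightarrow> f u) (at_right 0)"
      using tendsto_mult[OF gauss_tendsto tendsto_const] by (intro AE_I2) simp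
  qed (use b assms in auto)
qed

lemma integrable_laplace: "integrable lborel (\<lambda>u::real. 1 / (u\<^sup>2 + 1/4))"
  and integral_laplace_eq: "(\<integral>u. 1 / (u\<^sup>2 + 1/4) \<partial>lborel) = 2 * pi"
  using integral_laplace by (auto simp: has_bochner_integral_iff)

section \<open>The contribution linear in \<open>rho\<close>\<close>

definition deficit :: "real \<Rightarrow> real" where
  "deficit u = 2 * stable_const Y * \<bar>u\<bar> powr (Y - 2) - osc u / (u\<^sup>2 + 1/4)"

lemma integral_gauss_powr:
  assumes "0 < t"
  shows "has_bochner_integral lborel (\<lambda>u. gauss t u * \<bar>u\<bar> powr (Y - 2))
    (exp (- (t * \<sigma>\<^sup>2 / 8)) * (Gamma ((Y - 1) / 2) * (t * (\<sigma>\<^sup>2 / 2)) powr - ((Y - 1) / 2)))"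
proof -
  have "has_bochner_integral lborel (\<lambda>v. \<bar>v\<bar> powr ((Y - 1) - 1) * exp (- (t * (\<sigma>\<^sup>2 / 2) * v\<^sup>2)))
    (Gamma ((Y - 1) / 2) * (t * (\<sigma>\<^sup>2 / 2)) powr - ((Y - 1) / 2))"
    using Y1 \<sigma> assms by (intro integral_gaussian_powr_line) auto
  from has_bochner_integral_mult_right[OF this, of "exp (- (t * \<sigma>\<^sup>2 / 8))"]
  have "has_bochner_integral lborel (\<lambda>v. exp (- (t * \<sigma>\<^sup>2 / 8)) * (\<bar>v\<bar> powr ((Y - 1) - 1) * exp (- (t * (\<sigma>\<^sup>2 / 2) * v\<^sup>2))))
    (exp (- (t * \<sigma>\<^sup>2 / 8)) * (Gamma ((Y - 1) / 2) * (t * (\<sigma>\<^sup>2 / 2)) powr - ((Y - 1) / 2)))"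
    by simp
  moreover have "exp (- (t * \<sigma>\<^sup>2 / 8)) * (\<bar>v\<bar> powr ((Y - 1) - 1) * exp (- (t * (\<sigma>\<^sup>2 / 2) * v\<^sup>2))) = gauss t v * \<bar>v\<bar> powr (Y - 2)" for v
  proof -
    have "gauss t v = exp (- (t * \<sigma>\<^sup>2 / 8)) * exp (- (t * (\<sigma>\<^sup>2 / 2) * v\<^sup>2))"
      unfolding gauss_def exp_add[symmetric] by (simp add: algebra_simps)
    then show ?thesis by simp
  qed
  ultimately show ?thesis by (simp only:)
qed

text \<open>Isolates the one summand that is not integrable over the line:
  \<open>\<bar>u\<bar> powr (Y - 2)\<close> decays too slowly since Y - 2 > -1. Its integral against
  \<open>gauss\<close> is explicit and blows up as t tends to 0, while in the other two summands the
  Gaussian factor can simply be removed in the limit.\<close>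

lemma rho_laplace_eq:
  "rho u / (u\<^sup>2 + 1/4) = rho0 * (1 / (u\<^sup>2 + 1/4)) + C * (2 * stable_const Y * \<bar>u\<bar> powr (Y - 2) - deficit u)"
  by (simp add: rho_def deficit_def add_divide_distrib)

lemma integral_gauss_rho:
  assumes "0 < t"
  shows "has_bochner_integral lborel (\<lambda>u. gauss t u * (rho u / (u\<^sup>2 + 1/4)))
     (rho0 * (\<integral>u. gauss t u * (1 / (u\<^sup>2 + 1/4)) \<partial>lborel)
       + C * (2 * stable_const Y * (exp (- (t * \<sigma>\<^sup>2 / 8)) * (Gamma ((Y - 1) / 2) * (t * (\<sigma>\<^sup>2 / 2)) powr - ((Y - 1) / 2)))
          - (\<integral>u. gauss t u * deficit u \<partial>lborel)))"
proof -
  have "integrable lborel deficit"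
    using integral_deficit by (simp add: has_bochner_integral_iff deficit_def[abs_def])
  then have "has_bochner_integral lborel (\<lambda>u. rho0 * (gauss t u * (1 / (u\<^sup>2 + 1/4)))
       + C * (2 * stable_const Y * (gauss t u * \<bar>u\<bar> powr (Y - 2)) - gauss t u * deficit u))
     (rho0 * (\<integral>u. gauss t u * (1 / (u\<^sup>2 + 1/4)) \<partial>lborel)
       + C * (2 * stable_const Y * (exp (- (t * \<sigma>\<^sup>2 / 8)) * (Gamma ((Y - 1) / 2) * (t * (\<sigma>\<^sup>2 / 2)) powr - ((Y - 1) / 2)))
          - (\<integral>u. gauss t u * deficit u \<partial>lborel)))"
    using assms by (intro has_bochner_integral_add has_bochner_integral_diff has_bochner_integral_mult_right
        has_bochner_integral_integrable integral_gauss_mult integral_gauss_powr integrable_laplace)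
  moreover have "rho0 * (gauss t u * (1 / (u\<^sup>2 + 1/4)))
       + C * (2 * stable_const Y * (gauss t u * \<bar>u\<bar> powr (Y - 2)) - gauss t u * deficit u) = gauss t u * (rho u / (u\<^sup>2 + 1/4))" for u
    unfolding rho_laplace_eq by (simp add: algebra_simps)
  ultimately show ?thesis by (simp only:)
qed

definition linear_coeff :: real where
  "linear_coeff = C * Gamma (- Y) / 2 * ((M - 1) powr Y - M powr Y - (G + 1) powr Y + G powr Y)"

text \<open>After removal of the divergent power, the limit is \<open>rho0\<close> minus C / (2 pi)
  times the integral of \<open>deficit\<close>. The powers of M - 1/2 and G + 1/2 cancel between the
  two and \<open>linear_coeff\<close> remains. Replacing the factor
  \<open>exp (- (t * \<sigma>\<^sup>2 / 8))\<close>, which comes from the 1/4 in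
  \<open>gauss\<close>, by 1 costs order t times \<open>t powr (- (Y - 1) / 2)\<close>, which
  vanishes.\<close>

lemma integral_gauss_rho_asymp:
  "((\<lambda>t. 1 / (2 * pi) * ((\<integral>u. gauss t u * (rho u / (u\<^sup>2 + 1/4)) \<partial>lborel)
      - C * (2 * stable_const Y) * (Gamma ((Y - 1) / 2) * (t * (\<sigma>\<^sup>2 / 2)) powr - ((Y - 1) / 2)))) \<longlongrightarrow> linear_coeff) (at_right 0)"
proof -
  have id: "integrable lborel deficit" "(\<integral>u. deficit u \<partial>lborel) = 2 * pi * (Gamma (- Y) * (M powr Y - (M - 1/2) powr Y + (G + 1) powr Y - (G + 1/2) powr Y))"
    using integral_deficit by (simp_all add: has_bochner_integral_iff deficit_def[abs_def])
  have "((\<lambda>t. (exp (- (t * s2 / 8)) - 1) * (t * (s2 / 2)) powr - (y / 2)) \<longlongrightarrow> 0) (at_right 0)"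
    if "s2 > 0" "0 < y" "y < 1" for s2 y :: real
    using that by real_asymp
  from this[of "\<sigma>\<^sup>2" "Y - 1"] have lim: "((\<lambda>t. (exp (- (t * \<sigma>\<^sup>2 / 8)) - 1) * (t * (\<sigma>\<^sup>2 / 2)) powr - ((Y - 1) / 2)) \<longlongrightarrow> 0) (at_right 0)"
    using \<sigma> Y1 Y2 by auto
  have "((\<lambda>t. 1 / (2 * pi) * (rho0 * (\<integral>u. gauss t u * (1 / (u\<^sup>2 + 1/4)) \<partial>lborel)
       + C * (2 * stable_const Y) * Gamma ((Y - 1) / 2) * ((exp (- (t * \<sigma>\<^sup>2 / 8)) - 1) * (t * (\<sigma>\<^sup>2 / 2)) powr - ((Y - 1) / 2))
          - C * (\<integral>u. gauss t u * deficit u \<partial>lborel))) \<longlongrightarrow>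
     1 / (2 * pi) * (rho0 * (2 * pi) + C * (2 * stable_const Y) * Gamma ((Y - 1) / 2) * 0
       - C * (2 * pi * (Gamma (- Y) * (M powr Y - (M - 1/2) powr Y + (G + 1) powr Y - (G + 1/2) powr Y))))) (at_right 0)"
    using integral_gauss_mult(2)[OF integrable_laplace] integral_gauss_mult(2)[OF id(1)]
    unfolding id(2) integral_laplace_eq
    by (intro tendsto_mult[OF tendsto_const] tendsto_add tendsto_diff lim)
  also have "1 / (2 * pi) * (rho0 * (2 * pi) + C * (2 * stable_const Y) * Gamma ((Y - 1) / 2) * 0
       - C * (2 * pi * (Gamma (- Y) * (M powr Y - (M - 1/2) powr Y + (G + 1) powr Y - (G + 1/2) powr Y)))) = linear_coeff"
    by (simp add: rho0_def linear_coeff_def field_simps)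
  finally show ?thesis
  proof (rule Lim_transform_eventually)
    show "\<forall>\<^sub>F t in at_right 0. 1 / (2 * pi) * (rho0 * (\<integral>u. gauss t u * (1 / (u\<^sup>2 + 1/4)) \<partial>lborel)
       + C * (2 * stable_const Y) * Gamma ((Y - 1) / 2) * ((exp (- (t * \<sigma>\<^sup>2 / 8)) - 1) * (t * (\<sigma>\<^sup>2 / 2)) powr - ((Y - 1) / 2))
          - C * (\<integral>u. gauss t u * deficit u \<partial>lborel)) =
      1 / (2 * pi) * ((\<integral>u. gauss t u * (rho u / (u\<^sup>2 + 1/4)) \<partial>lborel)
      - C * (2 * stable_const Y) * (Gamma ((Y - 1) / 2) * (t * (\<sigma>\<^sup>2 / 2)) powr - ((Y - 1) / 2)))"
      using eventually_at_right_less[of 0]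
    proof eventually_elim
      fix t :: real assume "0 < t"
      from integral_gauss_rho[OF this] have i: "(\<integral>u. gauss t u * (rho u / (u\<^sup>2 + 1/4)) \<partial>lborel) = 
        rho0 * (\<integral>u. gauss t u * (1 / (u\<^sup>2 + 1/4)) \<partial>lborel)
       + C * (2 * stable_const Y * (exp (- (t * \<sigma>\<^sup>2 / 8)) * (Gamma ((Y - 1) / 2) * (t * (\<sigma>\<^sup>2 / 2)) powr - ((Y - 1) / 2)))
          - (\<integral>u. gauss t u * deficit u \<partial>lborel))"
        by (simp add: has_bochner_integral_iff)
      have "r + c * k * g * ((e - 1) * p) - c * d = r + c * (k * (e * (g * p)) - d) - c * k * (g * p)" for r c k g e p d :: real
        by (simp add: algebra_simps)
      then show "1 / (2 * pi) * (rho0 * (\<integral>u. gauss t u * (1 / (u\<^sup>2 + 1/4)) \<partial>lborel)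
       + C * (2 * stable_const Y) * Gamma ((Y - 1) / 2) * ((exp (- (t * \<sigma>\<^sup>2 / 8)) - 1) * (t * (\<sigma>\<^sup>2 / 2)) powr - ((Y - 1) / 2))
          - C * (\<integral>u. gauss t u * deficit u \<partial>lborel)) =
        1 / (2 * pi) * ((\<integral>u. gauss t u * (rho u / (u\<^sup>2 + 1/4)) \<partial>lborel)
      - C * (2 * stable_const Y) * (Gamma ((Y - 1) / 2) * (t * (\<sigma>\<^sup>2 / 2)) powr - ((Y - 1) / 2)))"
        unfolding i by (simp only:)
    qed
  qed
qed

section \<open>The contribution quadratic in \<open>rho\<close>\<close>

definition remainder2 :: "real \<Rightarrow> real" where
  "remainder2 y = y - (1 - exp (- y))"

lemma remainder2_measurable [measurable]: "remainder2 \<in> borel_measurable borel"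
  unfolding remainder2_def[abs_def] by measurable

text \<open>The linear bound gives integrability at fixed t, by comparison with \<open>rho\<close>;
  the quadratic bound gives a domination uniform in t after rescaling.\<close>

lemma remainder2_bounds:
  assumes "0 \<le> y"
  shows "0 \<le> remainder2 y" "remainder2 y \<le> y" "remainder2 y \<le> y\<^sup>2 / 2"
proof -
  show "0 \<le> remainder2 y" using exp_ge_add_one_self[of "- y"] by (simp add: remainder2_def)
  show "remainder2 y \<le> y" using assms by (simp add: remainder2_def)
  have "y\<^sup>2 / 2 - remainder2 y \<ge> 0\<^sup>2 / 2 - remainder2 0"
  proof (rule DERIV_nonneg_imp_nondecreasing[OF assms])
    fix x :: real assume "0 \<le> x"
    have "((\<lambda>x. x\<^sup>2 / 2 - remainder2 x) has_real_derivative x - (1 - exp (- x))) (at x)"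
      unfolding remainder2_def by (auto intro!: derivative_eq_intros)
    moreover have "x - (1 - exp (- x)) \<ge> 0" using exp_ge_add_one_self[of "- x"] by simp
    ultimately show "\<exists>y. ((\<lambda>x. x\<^sup>2 / 2 - remainder2 x) has_real_derivative y) (at x) \<and> 0 \<le> y" by blast
  qed
  then show "remainder2 y \<le> y\<^sup>2 / 2" by (simp add: remainder2_def)
qed

lemma remainder2_tendsto: "((\<lambda>y. remainder2 y / y\<^sup>2) \<longlongrightarrow> 1 / 2) (at_right 0)"
  unfolding remainder2_def by real_asymp

lemma osc_scaled:
  assumes "u \<noteq> 0"
  shows "osc u = \<bar>u\<bar> powr Y * (\<integral>y. indicator {0<..} y * (y powr (- Y - 1) * (tilt (y / \<bar>u\<bar>) * (1 - cos y))) \<partial>lborel)"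
proof -
  have "osc u = \<bar>1 / \<bar>u\<bar>\<bar> *\<^sub>R (\<integral>y. indicator {0<..} (0 + 1 / \<bar>u\<bar> * y) * ((0 + 1 / \<bar>u\<bar> * y) powr (- Y - 1) * (tilt (0 + 1 / \<bar>u\<bar> * y) * (1 - cos (u * (0 + 1 / \<bar>u\<bar> * y))))) \<partial>lborel)"
    unfolding osc_def using assms by (intro lborel_integral_real_affine) auto
  also have "(\<lambda>y. indicator {0<..} (0 + 1 / \<bar>u\<bar> * y) * ((0 + 1 / \<bar>u\<bar> * y) powr (- Y - 1) * (tilt (0 + 1 / \<bar>u\<bar> * y) * (1 - cos (u * (0 + 1 / \<bar>u\<bar> * y))))))
     = (\<lambda>y. \<bar>u\<bar> powr (Y + 1) * (indicator {0<..} y * (y powr (- Y - 1) * (tilt (y / \<bar>u\<bar>) * (1 - cos y)))))"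
  proof
    fix y
    show "indicator {0<..} (0 + 1 / \<bar>u\<bar> * y) * ((0 + 1 / \<bar>u\<bar> * y) powr (- Y - 1) * (tilt (0 + 1 / \<bar>u\<bar> * y) * (1 - cos (u * (0 + 1 / \<bar>u\<bar> * y)))))
     = \<bar>u\<bar> powr (Y + 1) * (indicator {0<..} y * (y powr (- Y - 1) * (tilt (y / \<bar>u\<bar>) * (1 - cos y))))"
    proof (cases "y > 0")
      case True
      have "(1 / \<bar>u\<bar>) powr (- Y - 1) = \<bar>u\<bar> powr (Y + 1)"
        using powr_minus_divide[of "1 / \<bar>u\<bar>" "Y + 1"] powr_divide[of 1 "\<bar>u\<bar>" "Y + 1"] by simp
      then have "(1 / \<bar>u\<bar> * y) powr (- Y - 1) = \<bar>u\<bar> powr (Y + 1) * y powr (- Y - 1)"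
        using True assms by (subst powr_mult) auto
      moreover have "cos (u * (1 / \<bar>u\<bar> * y)) = cos y"
        using assms by (auto simp: abs_if)
      ultimately show ?thesis using True assms by simp
    qed (use assms in \<open>simp add: zero_less_divide_iff\<close>)
  qed
  finally show ?thesis using assms by (simp add: powr_add)
qed

text \<open>At u = v / sqrt t the substitution y = |u| x evaluates \<open>tilt\<close> at
  \<open>sqrt t / \<bar>v\<bar> * y\<close>, which tends to 0. Since \<open>tilt 0 = 2\<close>, the
  tempering disappears in the limit and twice the stable integral is left; \<open>rho0\<close> is
  killed by \<open>t powr (Y / 2)\<close>.\<close>

lemma tendsto_rho_scaled:
  assumes "v \<noteq> 0"
  shows "((\<lambda>t. t powr (Y / 2) * rho (v / sqrt t)) \<longlongrightarrow> 2 * C * stable_const Y * \<bar>v\<bar> powr Y) (at_right 0)"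
proof -
  define W where "W = (\<lambda>e. \<integral>y. indicator {0<..} y * (y powr (- Y - 1) * (tilt (e * y) * (1 - cos y))) \<partial>lborel)"
  have "(W \<longlongrightarrow> (\<integral>y. 2 * (indicator {0<..} y * (y powr (- Y - 1) * (1 - cos (1 * y)))) \<partial>lborel)) (at_right 0)"
    unfolding W_def
  proof (rule dominated_convergence_at_right_0)
    show "integrable lborel (\<lambda>y. 2 * (indicator {0<..} y * (y powr (- Y - 1) * (1 - cos (1 * y)))))"
      by (intro integrable_mult_right integrable_stable_cos)
    show "AE y in lborel. ((\<lambda>e. indicator {0<..} y * (y powr (- Y - 1) * (tilt (e * y) * (1 - cos y)))) \<longlongrightarrow> 2 * (indicator {0<..} y * (y powr (- Y - 1) * (1 - cos (1 * y))))) (at_right 0)"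
    proof (rule AE_I2)
      fix y :: real
      have "((\<lambda>e. indicator {0<..} y * (y powr (- Y - 1) * (tilt (e * y) * (1 - cos y)))) \<longlongrightarrow> indicator {0<..} y * (y powr (- Y - 1) * (tilt (0 * y) * (1 - cos y)))) (at_right 0)"
        unfolding tilt_def by (intro tendsto_intros)
      moreover have "i * (p * (tilt (0 * y) * c)) = 2 * (i * (p * c))" for i p c
        by (simp add: tilt_def)
      ultimately show "((\<lambda>e. indicator {0<..} y * (y powr (- Y - 1) * (tilt (e * y) * (1 - cos y)))) \<longlongrightarrow> 2 * (indicator {0<..} y * (y powr (- Y - 1) * (1 - cos (1 * y))))) (at_right 0)"
        by (simp only: mult_1_left)
    qed
    show "AE y in lborel. norm (indicator {0<..} y * (y powr (- Y - 1) * (tilt (e * y) * (1 - cos y)))) \<le> 2 * (indicator {0<..} y * (y powr (- Y - 1) * (1 - cos (1 * y))))" if "0 < e" for e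
    proof (rule AE_I2)
      fix y :: real
      have "tilt (e * y) * (y powr (- Y - 1) * (1 - cos y)) \<le> 2 * (y powr (- Y - 1) * (1 - cos y))" if "y > 0"
        using that \<open>0 < e\<close> by (intro mult_right_mono tilt_le_2) auto
      then show "norm (indicator {0<..} y * (y powr (- Y - 1) * (tilt (e * y) * (1 - cos y)))) \<le> 2 * (indicator {0<..} y * (y powr (- Y - 1) * (1 - cos (1 * y))))"
        using tilt_nonneg by (auto simp: indicator_def abs_mult mult_ac)
    qed
  qed measurable
  also have "(\<integral>y. 2 * (indicator {0<..} y * (y powr (- Y - 1) * (1 - cos (1 * y)))) \<partial>lborel) = 2 * stable_const Y"
    using integral_stable_cos[OF Y_bounds, of 1] by (simp add: has_bochner_integral_iff)
  finally have W: "(W \<longlongrightarrow> 2 * stable_const Y) (at_right 0)" .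
  have "filterlim (\<lambda>t. sqrt t / \<bar>v\<bar>) (at_right 0) (at_right 0)"
  proof -
    have "a > 0 \<Longrightarrow> filterlim (\<lambda>t. sqrt t / a) (at_right 0) (at_right 0)" for a :: real
      by real_asymp
    then show ?thesis using assms by simp
  qed
  then have W': "((\<lambda>t. W (sqrt t / \<bar>v\<bar>)) \<longlongrightarrow> 2 * stable_const Y) (at_right 0)"
    by (rule filterlim_compose[OF W])
  have "((\<lambda>t::real. t powr (Y / 2)) \<longlongrightarrow> 0) (at_right 0)"
    using Y1 by real_asymp
  then have "((\<lambda>t. rho0 * t powr (Y / 2) + C * (\<bar>v\<bar> powr Y * W (sqrt t / \<bar>v\<bar>))) \<longlongrightarrow> rho0 * 0 + C * (\<bar>v\<bar> powr Y * (2 * stable_const Y))) (at_right 0)"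
    by (intro tendsto_intros W')
  then have "((\<lambda>t. rho0 * t powr (Y / 2) + C * (\<bar>v\<bar> powr Y * W (sqrt t / \<bar>v\<bar>))) \<longlongrightarrow> 2 * C * stable_const Y * \<bar>v\<bar> powr Y) (at_right 0)"
    by (simp add: mult_ac)
  then show ?thesis
  proof (rule Lim_transform_eventually)
    show "\<forall>\<^sub>F t in at_right 0. rho0 * t powr (Y / 2) + C * (\<bar>v\<bar> powr Y * W (sqrt t / \<bar>v\<bar>)) = t powr (Y / 2) * rho (v / sqrt t)"
      using eventually_at_right_less[of 0]
    proof eventually_elim
      fix t :: real assume t: "0 < t"
      have nz: "v / sqrt t \<noteq> 0" using t assms by simp
      have e1: "\<bar>v / sqrt t\<bar> powr Y = \<bar>v\<bar> powr Y / t powr (Y / 2)"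
        using t by (simp add: abs_divide powr_divide powr_half_sqrt[symmetric] powr_powr)
      have e2: "y / \<bar>v / sqrt t\<bar> = sqrt t / \<bar>v\<bar> * y" for y
        using t by (simp add: abs_divide)
      have "osc (v / sqrt t) = \<bar>v\<bar> powr Y / t powr (Y / 2) * W (sqrt t / \<bar>v\<bar>)"
        unfolding W_def osc_scaled[OF nz] e1 e2 ..
      then show "rho0 * t powr (Y / 2) + C * (\<bar>v\<bar> powr Y * W (sqrt t / \<bar>v\<bar>)) = t powr (Y / 2) * rho (v / sqrt t)"
        using t by (simp add: rho_def distrib_left)
    qed
  qed
qed

text \<open>The integrand of the quadratic contribution after u = v / sqrt t, with
  \<open>t powr (5/2 - Y)\<close> taken out. The exponent is the sum of -1/2 from du, of 1 from the
  kernel \<open>1 / (u\<^sup>2 + 1/4)\<close>, and of 2 - Y, the order of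
  \<open>remainder2 (t * rho u)\<close> at this scale.\<close>

definition scaled_remainder :: "real \<Rightarrow> real \<Rightarrow> real" where
  "scaled_remainder t v = exp (- (\<sigma>\<^sup>2 / 2 * (v\<^sup>2 + t / 4))) * (t powr (Y - 2) * remainder2 (t * rho (v / sqrt t)) / (v\<^sup>2 + t / 4))"

text \<open>The argument of \<open>remainder2\<close> is \<open>t powr (1 - Y / 2)\<close> times a
  quantity \<open>r\<close> with positive limit \<open>k\<close>. It tends to 0 from the right
  because Y < 2, so \<open>remainder2\<close> may be replaced by half the square of its
  argument.\<close>

lemma scaled_remainder_tendsto:
  assumes "v \<noteq> 0"
  shows "((\<lambda>t. scaled_remainder t v) \<longlongrightarrow> 2 * C\<^sup>2 * (stable_const Y)\<^sup>2 * (\<bar>v\<bar> powr (2 * Y - 2) * exp (- (\<sigma>\<^sup>2 / 2 * v\<^sup>2)))) (at_right 0)"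
proof -
  define k where "k = 2 * C * stable_const Y * \<bar>v\<bar> powr Y"
  define r where "r t = t powr (Y / 2) * rho (v / sqrt t)" for t
  have k: "k > 0" using C stable_const_pos[OF Y_bounds] assms by (simp add: k_def)
  have r: "(r \<longlongrightarrow> k) (at_right 0)"
    unfolding r_def[abs_def] k_def by (rule tendsto_rho_scaled[OF assms])
  have y: "t * rho (v / sqrt t) = t powr (1 - Y / 2) * r t" if "t > 0" for t
    using that powr_add[of t "1 - Y / 2" "Y / 2"] by (simp add: r_def)
  have "((\<lambda>t::real. t powr (1 - Y / 2)) \<longlongrightarrow> 0) (at_right 0)"
    using Y2 by real_asymp
  from tendsto_mult[OF this r] have "((\<lambda>t. t powr (1 - Y / 2) * r t) \<longlongrightarrow> 0) (at_right 0)" by simp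
  moreover have pos: "\<forall>\<^sub>F t in at_right 0. 0 < t powr (1 - Y / 2) * r t"
    using order_tendstoD(1)[OF r k] eventually_at_right_less[of 0] by eventually_elim simp
  ultimately have "filterlim (\<lambda>t. t powr (1 - Y / 2) * r t) (at_right 0) (at_right 0)"
    by (auto simp: filterlim_at elim: eventually_mono)
  then have "((\<lambda>t. remainder2 (t powr (1 - Y / 2) * r t) / (t powr (1 - Y / 2) * r t)\<^sup>2) \<longlongrightarrow> 1 / 2) (at_right 0)"
    by (rule filterlim_compose[OF remainder2_tendsto])
  from tendsto_mult[OF this tendsto_power[OF r, of 2]]
  have "((\<lambda>t. remainder2 (t powr (1 - Y / 2) * r t) / (t powr (1 - Y / 2) * r t)\<^sup>2 * (r t)\<^sup>2) \<longlongrightarrow> 1 / 2 * k\<^sup>2) (at_right 0)" .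
  then have lim: "((\<lambda>t. t powr (Y - 2) * remainder2 (t * rho (v / sqrt t))) \<longlongrightarrow> 1 / 2 * k\<^sup>2) (at_right 0)"
  proof (rule Lim_transform_eventually)
    show "\<forall>\<^sub>F t in at_right 0. remainder2 (t powr (1 - Y / 2) * r t) / (t powr (1 - Y / 2) * r t)\<^sup>2 * (r t)\<^sup>2 = t powr (Y - 2) * remainder2 (t * rho (v / sqrt t))"
      using pos eventually_at_right_less[of 0]
    proof eventually_elim
      fix t :: real assume p: "0 < t powr (1 - Y / 2) * r t" and t: "0 < t"
      have "(t powr (1 - Y / 2))\<^sup>2 = t powr (2 - Y)"
        using t by (simp add: power2_eq_square flip: powr_add)
      then have "1 / (t powr (1 - Y / 2))\<^sup>2 = t powr (Y - 2)"
        using powr_minus_divide[of t "2 - Y"] by simp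
      moreover have "r t \<noteq> 0" using p by auto
      moreover have "q / (a * b)\<^sup>2 * b\<^sup>2 = 1 / a\<^sup>2 * q" if "b \<noteq> 0" for q a b :: real
        using that by (simp add: power_mult_distrib)
      ultimately show "remainder2 (t powr (1 - Y / 2) * r t) / (t powr (1 - Y / 2) * r t)\<^sup>2 * (r t)\<^sup>2 = t powr (Y - 2) * remainder2 (t * rho (v / sqrt t))"
        unfolding y[OF t] by (simp only: not_False_eq_True)
    qed
  qed
  have "((\<lambda>t. scaled_remainder t v) \<longlongrightarrow> exp (- (\<sigma>\<^sup>2 / 2 * (v\<^sup>2 + 0 / 4))) * (1 / 2 * k\<^sup>2 / (v\<^sup>2 + 0 / 4))) (at_right 0)"
    unfolding scaled_remainder_def using assms by (intro tendsto_intros lim) auto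
  moreover have "1 / 2 * k\<^sup>2 / (v\<^sup>2 + 0 / 4) = 2 * C\<^sup>2 * (stable_const Y)\<^sup>2 * \<bar>v\<bar> powr (2 * Y - 2)"
  proof -
    have "\<bar>v\<bar> powr (2 * Y - 2) = (\<bar>v\<bar> powr Y)\<^sup>2 / v\<^sup>2"
      using assms by (simp add: powr_diff power2_eq_square flip: powr_add)
    then show ?thesis by (simp add: k_def power_mult_distrib)
  qed
  ultimately have "((\<lambda>t. scaled_remainder t v) \<longlongrightarrow> exp (- (\<sigma>\<^sup>2 / 2 * (v\<^sup>2 + 0 / 4))) * (2 * C\<^sup>2 * (stable_const Y)\<^sup>2 * \<bar>v\<bar> powr (2 * Y - 2))) (at_right 0)"
    by (simp only:)
  then show ?thesis by (simp add: mult_ac)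
qed

text \<open>A domination independent of t, by a Gaussian times powers of |v|. It follows from
  \<open>remainder2 y \<le> y\<^sup>2 / 2\<close>, from \<open>rho_le\<close>, and from (a + b)^2
  \<le> 2 a^2 + 2 b^2, which separates the constant \<open>rho0\<close> from the stable
  growth.\<close>

lemma scaled_remainder_bound:
  assumes "0 < t" "t \<le> 1" "v \<noteq> 0"
  shows "0 \<le> scaled_remainder t v"
    and "scaled_remainder t v \<le> exp (- (\<sigma>\<^sup>2 / 2 * v\<^sup>2)) * (4 * rho0\<^sup>2 * \<bar>v\<bar> powr 0 + (2 * C * stable_const Y)\<^sup>2 * \<bar>v\<bar> powr (2 * Y - 2))"
proof -
  define k where "k = 2 * C * stable_const Y"
  have k: "k \<ge> 0" using C stable_const_pos[OF Y_bounds] by (simp add: k_def)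
  define R where "R = rho (v / sqrt t)"
  have R: "0 \<le> R" unfolding R_def by (rule rho_nonneg)
  have q: "scaled_remainder t v = exp (- (\<sigma>\<^sup>2 / 2 * (v\<^sup>2 + t / 4))) * (t powr (Y - 2) * remainder2 (t * R) / (v\<^sup>2 + t / 4))"
    by (simp add: scaled_remainder_def R_def)
  show "0 \<le> scaled_remainder t v"
    unfolding q using assms R remainder2_bounds(1)[of "t * R"] by simp
  have "R \<le> rho0 + k * \<bar>v / sqrt t\<bar> powr Y"
    using rho_le[of "v / sqrt t"] by (simp add: R_def k_def)
  also have "\<bar>v / sqrt t\<bar> powr Y = \<bar>v\<bar> powr Y / t powr (Y / 2)"
    using assms by (simp add: abs_divide powr_divide powr_half_sqrt[symmetric] powr_powr)
  finally have "t powr (Y / 2) * R \<le> t powr (Y / 2) * (rho0 + k * (\<bar>v\<bar> powr Y / t powr (Y / 2)))"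
    using assms by (intro mult_left_mono) auto
  also have "\<dots> = t powr (Y / 2) * rho0 + k * \<bar>v\<bar> powr Y"
    using assms by (simp add: distrib_left)
  finally have "(t powr (Y / 2) * R)\<^sup>2 \<le> (t powr (Y / 2) * rho0 + k * \<bar>v\<bar> powr Y)\<^sup>2"
    using R by (intro power_mono) auto
  also have "\<dots> \<le> 2 * (t powr (Y / 2) * rho0)\<^sup>2 + 2 * (k * \<bar>v\<bar> powr Y)\<^sup>2"
    using zero_le_power2[of "t powr (Y / 2) * rho0 - k * \<bar>v\<bar> powr Y"]
    by (simp add: power2_sum power2_diff)
  finally have sq: "(t powr (Y / 2) * R)\<^sup>2 / 2 \<le> t powr Y * rho0\<^sup>2 + k\<^sup>2 * (\<bar>v\<bar> powr Y)\<^sup>2"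
    using assms by (simp add: power_mult_distrib power2_eq_square[of "t powr (Y / 2)"] flip: powr_add)
  have "t powr (Y - 2) * remainder2 (t * R) \<le> t powr (Y - 2) * ((t * R)\<^sup>2 / 2)"
    using assms R by (intro mult_left_mono remainder2_bounds) auto
  also have "\<dots> = (t powr (Y / 2) * R)\<^sup>2 / 2"
  proof -
    have "t powr (Y - 2) * t\<^sup>2 = (t powr (Y / 2))\<^sup>2"
      using assms by (simp add: powr_diff power2_eq_square flip: powr_add)
    then show ?thesis by (simp add: power_mult_distrib)
  qed
  finally have 1: "t powr (Y - 2) * remainder2 (t * R) \<le> t powr Y * rho0\<^sup>2 + k\<^sup>2 * (\<bar>v\<bar> powr Y)\<^sup>2"
    using sq by linarith
  have d: "v\<^sup>2 + t / 4 > 0" "v\<^sup>2 > 0" using assms by (auto intro: add_nonneg_pos)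
  have "t powr (Y - 2) * remainder2 (t * R) / (v\<^sup>2 + t / 4) \<le> (t powr Y * rho0\<^sup>2 + k\<^sup>2 * (\<bar>v\<bar> powr Y)\<^sup>2) / (v\<^sup>2 + t / 4)"
    using 1 d by (intro divide_right_mono) auto
  also have "\<dots> = t powr Y * rho0\<^sup>2 / (v\<^sup>2 + t / 4) + k\<^sup>2 * (\<bar>v\<bar> powr Y)\<^sup>2 / (v\<^sup>2 + t / 4)"
    by (simp add: add_divide_distrib)
  \<comment> \<open>The denominator \<open>v\<^sup>2 + t / 4\<close> is bounded below by
    \<open>t / 4\<close> in the first quotient and by \<open>v\<^sup>2\<close> in the second: the
    first numerator supplies a factor t, the second a power of |v|. This avoids a singularity at v =
    0 in the first term and a negative power of t in the second.\<close>
  also have "\<dots> \<le> t * rho0\<^sup>2 / (t / 4) + k\<^sup>2 * (\<bar>v\<bar> powr Y)\<^sup>2 / v\<^sup>2"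
  proof (intro add_mono frac_le)
    show "t powr Y * rho0\<^sup>2 \<le> t * rho0\<^sup>2"
      using assms Y1 powr_mono'[of 1 Y t] by (intro mult_right_mono) auto
  qed (use assms d in auto)
  also have "\<dots> = 4 * rho0\<^sup>2 * \<bar>v\<bar> powr 0 + k\<^sup>2 * \<bar>v\<bar> powr (2 * Y - 2)"
  proof -
    have "\<bar>v\<bar> powr (2 * Y - 2) = (\<bar>v\<bar> powr Y)\<^sup>2 / v\<^sup>2"
      using assms by (simp add: powr_diff power2_eq_square flip: powr_add)
    then show ?thesis using assms by simp
  qed
  finally have 2: "t powr (Y - 2) * remainder2 (t * R) / (v\<^sup>2 + t / 4) \<le> 4 * rho0\<^sup>2 * \<bar>v\<bar> powr 0 + k\<^sup>2 * \<bar>v\<bar> powr (2 * Y - 2)" .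
  have "\<sigma>\<^sup>2 / 2 * v\<^sup>2 \<le> \<sigma>\<^sup>2 / 2 * (v\<^sup>2 + t / 4)"
    using assms by (intro mult_left_mono) auto
  then have "exp (- (\<sigma>\<^sup>2 / 2 * (v\<^sup>2 + t / 4))) \<le> exp (- (\<sigma>\<^sup>2 / 2 * v\<^sup>2))" by simp
  then show "scaled_remainder t v \<le> exp (- (\<sigma>\<^sup>2 / 2 * v\<^sup>2)) * (4 * rho0\<^sup>2 * \<bar>v\<bar> powr 0 + (2 * C * stable_const Y)\<^sup>2 * \<bar>v\<bar> powr (2 * Y - 2))"
    unfolding q k_def[symmetric] using 2 assms R d remainder2_bounds(1)[of "t * R"]
    by (intro mult_mono) auto
qed

lemma scaled_remainder_measurable [measurable]: "scaled_remainder t \<in> borel_measurable borel"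
  unfolding scaled_remainder_def[abs_def] by measurable

lemma integral_scaled_remainder_tendsto:
  "((\<lambda>t. \<integral>v. scaled_remainder t v \<partial>lborel) \<longlongrightarrow>
     2 * C\<^sup>2 * (stable_const Y)\<^sup>2 * (Gamma (Y - 1/2) * (\<sigma>\<^sup>2 / 2) powr - (Y - 1/2))) (at_right 0)"
proof -
  have g: "has_bochner_integral lborel (\<lambda>v. \<bar>v\<bar> powr (2 * Y - 2) * exp (- (\<sigma>\<^sup>2 / 2 * v\<^sup>2)))
      (Gamma (Y - 1/2) * (\<sigma>\<^sup>2 / 2) powr - (Y - 1/2))"
    using integral_gaussian_powr_line[of "2 * Y - 1" "\<sigma>\<^sup>2 / 2"] Y1 \<sigma> by (simp add: diff_divide_distrib)
  have g0: "has_bochner_integral lborel (\<lambda>v. \<bar>v\<bar> powr 0 * exp (- (\<sigma>\<^sup>2 / 2 * v\<^sup>2)))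
      (Gamma (1/2) * (\<sigma>\<^sup>2 / 2) powr - (1/2))"
    using integral_gaussian_powr_line[of 1 "\<sigma>\<^sup>2 / 2"] \<sigma> by simp
  have "((\<lambda>t. \<integral>v. scaled_remainder t v \<partial>lborel) \<longlongrightarrow> (\<integral>v. 2 * C\<^sup>2 * (stable_const Y)\<^sup>2 * (\<bar>v\<bar> powr (2 * Y - 2) * exp (- (\<sigma>\<^sup>2 / 2 * v\<^sup>2))) \<partial>lborel)) (at_right 0)"
  proof (rule dominated_convergence_at_right_0)
    have "integrable lborel (\<lambda>v. 4 * rho0\<^sup>2 * (\<bar>v\<bar> powr 0 * exp (- (\<sigma>\<^sup>2 / 2 * v\<^sup>2))) + (2 * C * stable_const Y)\<^sup>2 * (\<bar>v\<bar> powr (2 * Y - 2) * exp (- (\<sigma>\<^sup>2 / 2 * v\<^sup>2))))"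
      using g g0 by (intro Bochner_Integration.integrable_add integrable_mult_right) (auto simp: has_bochner_integral_iff)
    then show "integrable lborel (\<lambda>v. exp (- (\<sigma>\<^sup>2 / 2 * v\<^sup>2)) * (4 * rho0\<^sup>2 * \<bar>v\<bar> powr 0 + (2 * C * stable_const Y)\<^sup>2 * \<bar>v\<bar> powr (2 * Y - 2)))"
      by (simp add: distrib_left mult_ac)
    show "AE v in lborel. ((\<lambda>t. scaled_remainder t v) \<longlongrightarrow> 2 * C\<^sup>2 * (stable_const Y)\<^sup>2 * (\<bar>v\<bar> powr (2 * Y - 2) * exp (- (\<sigma>\<^sup>2 / 2 * v\<^sup>2)))) (at_right 0)"
      using AE_lborel_singleton[of "0::real"] by eventually_elim (rule scaled_remainder_tendsto)
    show "AE v in lborel. norm (scaled_remainder t v) \<le> exp (- (\<sigma>\<^sup>2 / 2 * v\<^sup>2)) * (4 * rho0\<^sup>2 * \<bar>v\<bar> powr 0 + (2 * C * stable_const Y)\<^sup>2 * \<bar>v\<bar> powr (2 * Y - 2))"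
      if "0 < t" "t \<le> 1" for t
      using AE_lborel_singleton[of "0::real"]
    proof eventually_elim
      fix v :: real assume v: "v \<noteq> 0"
      show "norm (scaled_remainder t v) \<le> exp (- (\<sigma>\<^sup>2 / 2 * v\<^sup>2)) * (4 * rho0\<^sup>2 * \<bar>v\<bar> powr 0 + (2 * C * stable_const Y)\<^sup>2 * \<bar>v\<bar> powr (2 * Y - 2))"
        using scaled_remainder_bound[OF that v] by (simp only: real_norm_def abs_of_nonneg)
    qed
  qed measurable
  then show ?thesis using g by (simp add: has_bochner_integral_iff)
qed

lemma integral_remainder2_scaled:
  assumes "0 < t"
  shows "(\<integral>u. gauss t u * (remainder2 (t * rho u) / (u\<^sup>2 + 1/4)) \<partial>lborel) = t powr (5/2 - Y) * (\<integral>v. scaled_remainder t v \<partial>lborel)"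
proof -
  have "(\<integral>u. gauss t u * (remainder2 (t * rho u) / (u\<^sup>2 + 1/4)) \<partial>lborel)
     = \<bar>1 / sqrt t\<bar> *\<^sub>R (\<integral>v. gauss t (0 + 1 / sqrt t * v) * (remainder2 (t * rho (0 + 1 / sqrt t * v)) / ((0 + 1 / sqrt t * v)\<^sup>2 + 1/4)) \<partial>lborel)"
    using assms by (intro lborel_integral_real_affine) auto
  also have "(\<lambda>v. gauss t (0 + 1 / sqrt t * v) * (remainder2 (t * rho (0 + 1 / sqrt t * v)) / ((0 + 1 / sqrt t * v)\<^sup>2 + 1/4)))
     = (\<lambda>v. t powr (3 - Y) * scaled_remainder t v)"
  proof
    fix v
    have sq: "(1 / sqrt t * v)\<^sup>2 = v\<^sup>2 / t"
      using assms by (simp add: power_divide)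
    have d: "v\<^sup>2 / t + 1/4 = (v\<^sup>2 + t / 4) / t"
      using assms by (simp add: field_simps)
    have e1: "gauss t (1 / sqrt t * v) = exp (- (\<sigma>\<^sup>2 / 2 * (v\<^sup>2 + t / 4)))"
      unfolding gauss_def sq d using assms by (simp add: mult_ac)
    have "t powr (3 - Y) * t powr (Y - 2) = t"
      using assms by (simp flip: powr_add)
    then have e2: "t powr (3 - Y) * (e * (t powr (Y - 2) * r / w)) = e * (r / (w / t))" for e r w
      using assms by (simp add: field_simps)
    show "gauss t (0 + 1 / sqrt t * v) * (remainder2 (t * rho (0 + 1 / sqrt t * v)) / ((0 + 1 / sqrt t * v)\<^sup>2 + 1/4)) = t powr (3 - Y) * scaled_remainder t v"
      unfolding scaled_remainder_def add_0 sq d e1 e2 by simp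
  qed
  also have "\<bar>1 / sqrt t\<bar> *\<^sub>R (\<integral>v. t powr (3 - Y) * scaled_remainder t v \<partial>lborel) = t powr (5/2 - Y) * (\<integral>v. scaled_remainder t v \<partial>lborel)"
  proof -
    have "t powr (3 - Y) = t powr (1/2) * t powr (5/2 - Y)"
      by (simp flip: powr_add)
    then show ?thesis using assms by (simp add: powr_half_sqrt)
  qed
  finally show ?thesis .
qed

text \<open>For fixed t the bound \<open>remainder2 y \<le> y\<close> suffices, since
  \<open>gauss t\<close> times \<open>rho\<close> over the kernel is already known to be
  integrable.\<close>

lemma integrable_remainder2:
  assumes "0 < t"
  shows "integrable lborel (\<lambda>u. gauss t u * (remainder2 (t * rho u) / (u\<^sup>2 + 1/4)))"
proof (rule Bochner_Integration.integrable_bound)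
  show "integrable lborel (\<lambda>u. t * (gauss t u * (rho u / (u\<^sup>2 + 1/4))))"
    using integral_gauss_rho[OF assms] by (intro integrable_mult_right) (simp add: has_bochner_integral_iff)
  show "AE u in lborel. norm (gauss t u * (remainder2 (t * rho u) / (u\<^sup>2 + 1/4))) \<le> norm (t * (gauss t u * (rho u / (u\<^sup>2 + 1/4))))"
  proof (rule AE_I2)
    fix u :: real
    have b: "0 \<le> remainder2 (t * rho u)" "remainder2 (t * rho u) \<le> t * rho u"
      using assms rho_nonneg[of u] by (intro remainder2_bounds; simp)+
    have d: "u\<^sup>2 + 1/4 > 0" by (auto intro: add_nonneg_pos)
    have "gauss t u * (remainder2 (t * rho u) / (u\<^sup>2 + 1/4)) \<le> gauss t u * (t * rho u / (u\<^sup>2 + 1/4))"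
      using b d gauss_pos[of t u] by (intro mult_left_mono divide_right_mono) auto
    moreover have "0 \<le> gauss t u * (remainder2 (t * rho u) / (u\<^sup>2 + 1/4))"
      using b d gauss_pos[of t u] by simp
    moreover have "0 \<le> t * (gauss t u * (rho u / (u\<^sup>2 + 1/4)))"
      using assms rho_nonneg[of u] d gauss_pos[of t u] by simp
    moreover have "gauss t u * (t * rho u / (u\<^sup>2 + 1/4)) = t * (gauss t u * (rho u / (u\<^sup>2 + 1/4)))" by simp
    ultimately show "norm (gauss t u * (remainder2 (t * rho u) / (u\<^sup>2 + 1/4))) \<le> norm (t * (gauss t u * (rho u / (u\<^sup>2 + 1/4))))"
      by (simp only: real_norm_def abs_of_nonneg)
  qed
qed measurable

section \<open>The contribution of the phase\<close>

definition phase_term :: "(real \<Rightarrow> real) \<Rightarrow> real \<Rightarrow> real \<Rightarrow> real" where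
  "phase_term I t u = gauss t u * (exp (- (t * rho u)) * (1 - cos (t * I u)) / (u\<^sup>2 + 1/4))"

text \<open>With a phase of at most linear growth, \<open>1 - cos (t * I u)\<close> is at most t^2
  K^2 u^2 / 2, and the kernel \<open>1 / (u\<^sup>2 + 1/4)\<close> absorbs u^2. What is left is t^2
  times a Gaussian whose total mass has order t^(-1/2), hence O(t^(3/2)) in all.\<close>

lemma phase_term_bounds:
  assumes "0 < t" "\<bar>I u\<bar> \<le> K * \<bar>u\<bar>"
  shows "0 \<le> phase_term I t u" "phase_term I t u \<le> t\<^sup>2 * K\<^sup>2 / 2 * exp (- (t * (\<sigma>\<^sup>2 / 2) * u\<^sup>2))"
proof -
  have d: "u\<^sup>2 + 1/4 > 0" by (auto intro: add_nonneg_pos)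
  show "0 \<le> phase_term I t u"
    unfolding phase_term_def using d gauss_pos[of t u] by simp
  have "(I u)\<^sup>2 \<le> (K * \<bar>u\<bar>)\<^sup>2"
    using assms(2) by (simp add: abs_le_square_iff[symmetric])
  then have "(t * I u)\<^sup>2 \<le> t\<^sup>2 * (K\<^sup>2 * u\<^sup>2)"
    using assms(1) by (simp add: power_mult_distrib)
  then have "1 - cos (t * I u) \<le> t\<^sup>2 * K\<^sup>2 / 2 * u\<^sup>2"
    using one_minus_cos_le[of "t * I u"] by simp
  also have "\<dots> \<le> t\<^sup>2 * K\<^sup>2 / 2 * (u\<^sup>2 + 1/4)" by (intro mult_left_mono) auto
  finally have "1 - cos (t * I u) \<le> t\<^sup>2 * K\<^sup>2 / 2 * (u\<^sup>2 + 1/4)" .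
  moreover have "exp (- (t * rho u)) \<le> 1" using assms(1) rho_nonneg[of u] by simp
  then have "exp (- (t * rho u)) * (1 - cos (t * I u)) \<le> 1 * (1 - cos (t * I u))"
    by (intro mult_right_mono) auto
  ultimately have "exp (- (t * rho u)) * (1 - cos (t * I u)) / (u\<^sup>2 + 1/4) \<le> t\<^sup>2 * K\<^sup>2 / 2"
    using d by (simp add: divide_le_eq)
  moreover have "gauss t u \<le> exp (- (t * (\<sigma>\<^sup>2 / 2) * u\<^sup>2))"
    using assms(1) by (simp add: gauss_def distrib_left)
  ultimately have "gauss t u * (exp (- (t * rho u)) * (1 - cos (t * I u)) / (u\<^sup>2 + 1/4)) \<le> exp (- (t * (\<sigma>\<^sup>2 / 2) * u\<^sup>2)) * (t\<^sup>2 * K\<^sup>2 / 2)"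
    using d gauss_pos[of t u] by (intro mult_mono) auto
  then show "phase_term I t u \<le> t\<^sup>2 * K\<^sup>2 / 2 * exp (- (t * (\<sigma>\<^sup>2 / 2) * u\<^sup>2))"
    by (simp add: phase_term_def mult_ac)
qed

lemma integral_phase_term:
  assumes [measurable]: "I \<in> borel_measurable borel" and I: "\<And>u. \<bar>I u\<bar> \<le> K * \<bar>u\<bar>" and "0 < t"
  shows "integrable lborel (phase_term I t)"
    and "0 \<le> (\<integral>u. phase_term I t u \<partial>lborel)"
    and "(\<integral>u. phase_term I t u \<partial>lborel) \<le> t\<^sup>2 * K\<^sup>2 / 2 * (sqrt pi * (t * (\<sigma>\<^sup>2 / 2)) powr - (1/2))"
proof -
  have g: "has_bochner_integral lborel (\<lambda>v. \<bar>v\<bar> powr 0 * exp (- (t * (\<sigma>\<^sup>2 / 2) * v\<^sup>2)))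
      (sqrt pi * (t * (\<sigma>\<^sup>2 / 2)) powr - (1/2))"
    using integral_gaussian_powr_line[of 1 "t * (\<sigma>\<^sup>2 / 2)"] \<sigma> \<open>0 < t\<close> by (simp add: Gamma_one_half_real)
  \<comment> \<open>The equality holds only almost everywhere because \<open>0 powr 0\<close> is
    0.\<close>
  have "AE v in lborel. \<bar>v\<bar> powr 0 * exp (- (t * (\<sigma>\<^sup>2 / 2) * v\<^sup>2)) = exp (- (t * (\<sigma>\<^sup>2 / 2) * v\<^sup>2))"
    using AE_lborel_singleton[of "0::real"] by eventually_elim simp
  with g have g: "has_bochner_integral lborel (\<lambda>v. exp (- (t * (\<sigma>\<^sup>2 / 2) * v\<^sup>2))) (sqrt pi * (t * (\<sigma>\<^sup>2 / 2)) powr - (1/2))"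
    by (subst (asm) has_bochner_integral_cong_AE) auto
  from has_bochner_integral_mult_right[OF g, of "t\<^sup>2 * K\<^sup>2 / 2"]
  have h: "has_bochner_integral lborel (\<lambda>v. t\<^sup>2 * K\<^sup>2 / 2 * exp (- (t * (\<sigma>\<^sup>2 / 2) * v\<^sup>2))) (t\<^sup>2 * K\<^sup>2 / 2 * (sqrt pi * (t * (\<sigma>\<^sup>2 / 2)) powr - (1/2)))"
    by simp
  note b = phase_term_bounds[where I = I and K = K, OF \<open>0 < t\<close> I]
  show i: "integrable lborel (phase_term I t)"
  proof (rule Bochner_Integration.integrable_bound)
    show "integrable lborel (\<lambda>v. t\<^sup>2 * K\<^sup>2 / 2 * exp (- (t * (\<sigma>\<^sup>2 / 2) * v\<^sup>2)))"
      using h by (simp add: has_bochner_integral_iff)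
    show "phase_term I t \<in> borel_measurable lborel"
      unfolding phase_term_def[abs_def] by measurable
    show "AE u in lborel. norm (phase_term I t u) \<le> norm (t\<^sup>2 * K\<^sup>2 / 2 * exp (- (t * (\<sigma>\<^sup>2 / 2) * u\<^sup>2)))"
    proof (rule AE_I2)
      fix u :: real
      show "norm (phase_term I t u) \<le> norm (t\<^sup>2 * K\<^sup>2 / 2 * exp (- (t * (\<sigma>\<^sup>2 / 2) * u\<^sup>2)))"
        using b[of u] unfolding real_norm_def by linarith
    qed
  qed
  show "0 \<le> (\<integral>u. phase_term I t u \<partial>lborel)"
    by (intro Bochner_Integration.integral_nonneg b)
  have "(\<integral>u. phase_term I t u \<partial>lborel) \<le> (\<integral>u. t\<^sup>2 * K\<^sup>2 / 2 * exp (- (t * (\<sigma>\<^sup>2 / 2) * u\<^sup>2)) \<partial>lborel)"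
    using h by (intro integral_mono i b) (auto simp: has_bochner_integral_iff)
  then show "(\<integral>u. phase_term I t u \<partial>lborel) \<le> t\<^sup>2 * K\<^sup>2 / 2 * (sqrt pi * (t * (\<sigma>\<^sup>2 / 2)) powr - (1/2))"
    using has_bochner_integral_integral_eq[OF h] by (simp only:)
qed

section \<open>Assembling the expansion of the Fourier integral\<close>

definition fourier_price :: "(real \<Rightarrow> real) \<Rightarrow> real \<Rightarrow> real" where
  "fourier_price I t = 1 / (2 * pi) * (\<integral>u. (1 - gauss t u * (exp (- (t * rho u)) * cos (t * I u))) / (u\<^sup>2 + 1/4) \<partial>lborel)"

text \<open>With g the Gaussian factor, e the factor of \<open>rho\<close> and c the cosine, 1 - g e
  c = (1 - g) + g (1 - e) + g e (1 - c), and 1 - e equals \<open>t * rho u\<close> minus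
  \<open>remainder2 (t * rho u)\<close>. Each of the four pieces is integrable on its own.\<close>

lemma fourier_price_split:
  assumes "I \<in> borel_measurable borel" "\<And>u. \<bar>I u\<bar> \<le> K * \<bar>u\<bar>" and "0 < t"
  shows "fourier_price I t = 1 / (2 * pi) * (\<integral>u. (1 - exp (- (t * (\<sigma>\<^sup>2 / 2) * (u\<^sup>2 + 1/4)))) / (u\<^sup>2 + 1/4) \<partial>lborel)
    + t * (1 / (2 * pi) * (\<integral>u. gauss t u * (rho u / (u\<^sup>2 + 1/4)) \<partial>lborel))
    - 1 / (2 * pi) * (\<integral>u. gauss t u * (remainder2 (t * rho u) / (u\<^sup>2 + 1/4)) \<partial>lborel)
    + 1 / (2 * pi) * (\<integral>u. phase_term I t u \<partial>lborel)"
proof -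
  have "has_bochner_integral lborel (\<lambda>u. (1 - exp (- (t * (\<sigma>\<^sup>2 / 2) * (u\<^sup>2 + 1/4)))) / (u\<^sup>2 + 1/4)
      + t * (gauss t u * (rho u / (u\<^sup>2 + 1/4))) - gauss t u * (remainder2 (t * rho u) / (u\<^sup>2 + 1/4)) + phase_term I t u)
     ((\<integral>u. (1 - exp (- (t * (\<sigma>\<^sup>2 / 2) * (u\<^sup>2 + 1/4)))) / (u\<^sup>2 + 1/4) \<partial>lborel)
    + t * (\<integral>u. gauss t u * (rho u / (u\<^sup>2 + 1/4)) \<partial>lborel)
    - (\<integral>u. gauss t u * (remainder2 (t * rho u) / (u\<^sup>2 + 1/4)) \<partial>lborel)
    + (\<integral>u. phase_term I t u \<partial>lborel))"
    using assms integral_gauss_rho[OF assms(3)]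
    by (intro has_bochner_integral_add has_bochner_integral_diff has_bochner_integral_mult_right has_bochner_integral_integrable
        integrable_one_minus_exp_laplace integrable_remainder2 integral_phase_term(1)[of I K])
      (auto simp: has_bochner_integral_iff)
  moreover have "(1 - exp (- (t * (\<sigma>\<^sup>2 / 2) * (u\<^sup>2 + 1/4)))) / (u\<^sup>2 + 1/4)
      + t * (gauss t u * (rho u / (u\<^sup>2 + 1/4))) - gauss t u * (remainder2 (t * rho u) / (u\<^sup>2 + 1/4)) + phase_term I t u
      = (1 - gauss t u * (exp (- (t * rho u)) * cos (t * I u))) / (u\<^sup>2 + 1/4)" for u
  proof -
    have "(1 - g) / w + t * (g * (r / w)) - g * ((t * r - (1 - e)) / w) + g * (e * (1 - c) / w) = (1 - g * (e * c)) / w" for g w r e c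
      by (simp add: add_divide_distrib[symmetric] diff_divide_distrib[symmetric]) (simp add: algebra_simps)
    then show ?thesis
      unfolding phase_term_def remainder2_def gauss_def[symmetric] .
  qed
  ultimately have eq: "(\<integral>u. (1 - gauss t u * (exp (- (t * rho u)) * cos (t * I u))) / (u\<^sup>2 + 1/4) \<partial>lborel) =
     (\<integral>u. (1 - exp (- (t * (\<sigma>\<^sup>2 / 2) * (u\<^sup>2 + 1/4)))) / (u\<^sup>2 + 1/4) \<partial>lborel)
    + t * (\<integral>u. gauss t u * (rho u / (u\<^sup>2 + 1/4)) \<partial>lborel)
    - (\<integral>u. gauss t u * (remainder2 (t * rho u) / (u\<^sup>2 + 1/4)) \<partial>lborel)
    + (\<integral>u. phase_term I t u \<partial>lborel)"
    by (simp only: has_bochner_integral_iff)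
  have "c * (a + s * b - d + e) = c * a + s * (c * b) - c * d + c * e" for a b c d e s :: real
    by (simp add: algebra_simps)
  then show ?thesis
    unfolding fourier_price_def eq .
qed

text \<open>\<open>stable_const\<close> has \<open>Gamma ((Y + 1) / 2)\<close> in the denominator,
  which is \<open>(Y - 1) / 2\<close> times the \<open>Gamma ((Y - 1) / 2)\<close> of the Gaussian
  moment. The two Gamma values cancel and the factor Y - 1 in the denominator of d2 appears.\<close>

lemma d2_eq:
  assumes "0 < t"
  shows "t * (1 / (2 * pi) * (C * (2 * stable_const Y) * (Gamma ((Y - 1) / 2) * (t * (\<sigma>\<^sup>2 / 2)) powr - ((Y - 1) / 2))))
     = C * 2 powr ((1 - Y) / 2) * \<sigma> powr (1 - Y) / (sqrt pi * Y * (Y - 1)) * Gamma (1 - Y / 2) * t powr ((3 - Y) / 2)"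
proof -
  have "(t * (\<sigma>\<^sup>2 / 2)) powr - ((Y - 1) / 2) = t powr ((1 - Y) / 2) * ((\<sigma>\<^sup>2) powr ((1 - Y) / 2) / 2 powr ((1 - Y) / 2))"
    using assms \<sigma> by (simp add: powr_mult powr_divide minus_divide_left)
  also have "(\<sigma>\<^sup>2) powr ((1 - Y) / 2) = \<sigma> powr (1 - Y)"
  proof -
    have "2 * ((1 - Y) / 2) = 1 - Y" by simp
    then show ?thesis
      using \<sigma> powr_powr[of \<sigma> 2 "(1 - Y) / 2"] by (simp only: powr_numeral)
  qed
  finally have 1: "(t * (\<sigma>\<^sup>2 / 2)) powr - ((Y - 1) / 2) = t powr ((1 - Y) / 2) * (\<sigma> powr (1 - Y) / 2 powr ((1 - Y) / 2))" .
  have 2: "t * t powr ((1 - Y) / 2) = t powr ((3 - Y) / 2)"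
    using assms powr_add[of t 1 "(1 - Y) / 2"] by (simp add: field_simps)
  have "2 powr ((1 - Y) / 2) * 2 powr ((1 - Y) / 2) = (2::real) powr (1 - Y)"
    by (simp flip: powr_add)
  then have 3: "2 powr (- Y) = 2 powr ((1 - Y) / 2) * 2 powr ((1 - Y) / 2) / (2::real)"
    by (simp add: powr_diff powr_minus_divide)
  have 4: "Gamma ((Y + 1) / 2) = (Y - 1) / 2 * Gamma ((Y - 1) / 2)"
  proof -
    have "(Y - 1) / 2 \<notin> \<int>\<^sub>\<le>\<^sub>0" using Y1 by (auto elim!: nonpos_Ints_cases)
    from Gamma_plus1[OF this] show ?thesis by (simp add: field_simps)
  qed
  have g: "Gamma ((Y - 1) / 2) > 0" using Y1 by (intro Gamma_real_pos) auto
  have "t * (1 / (2 * pi) * (C * (2 * (sqrt pi * (a * a / 2) * h / (Y * ((Y - 1) / 2 * w)))) * (w * (q * (s / a)))))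
      = C * a * s / (sqrt pi * Y * (Y - 1)) * h * (t * q)" if "a > 0" "w > 0" for a h w q s :: real
  proof -
    have "sqrt pi / pi = 1 / sqrt pi"
      by (simp add: field_simps)
    then show ?thesis using that Y1 by (simp add: divide_simps)
  qed
  from this[OF _ g, of "2 powr ((1 - Y) / 2)" "Gamma (1 - Y / 2)" "t powr ((1 - Y) / 2)" "\<sigma> powr (1 - Y)"]
  show ?thesis
    unfolding stable_const_def 1 3 4 2[symmetric] by simp
qed

text \<open>Here \<open>stable_const\<close> enters squared and in its form with
  \<open>Gamma (- Y)\<close> and the cosine. The minus sign is that of the quadratic remainder in
  the splitting of the price.\<close>

lemma d32_eq:
  "- (1 / (2 * pi)) * (2 * C\<^sup>2 * (stable_const Y)\<^sup>2 * (Gamma (Y - 1/2) * (\<sigma>\<^sup>2 / 2) powr - (Y - 1/2)))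
   = - (1 / pi) * \<sigma> powr (1 - 2 * Y) * C\<^sup>2 * (cos (pi * Y / 2))\<^sup>2 * (Gamma (- Y))\<^sup>2
           * 2 powr (Y - 1 / 2) * Gamma (Y - 1 / 2)"
proof -
  have "(\<sigma>\<^sup>2 / 2) powr - (Y - 1/2) = (\<sigma>\<^sup>2) powr (1/2 - Y) * 2 powr (Y - 1/2)"
    using \<sigma> powr_minus_divide[of 2 "Y - 1/2"] by (simp add: powr_divide)
  also have "(\<sigma>\<^sup>2) powr (1/2 - Y) = \<sigma> powr (1 - 2 * Y)"
    using \<sigma> by (simp add: powr_powr right_diff_distrib flip: powr_numeral)
  finally show ?thesis
    unfolding stable_const_eq_Gamma[OF Y_bounds] by (simp add: power_mult_distrib mult_ac)
qed

lemma d1_eq: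
  assumes "0 < t"
  shows "1 / (2 * pi) * (2 * sqrt (pi * (t * (\<sigma>\<^sup>2 / 2)))) = \<sigma> / sqrt (2 * pi) * t powr (1/2)"
proof -
  have "sqrt (pi * (t * (\<sigma>\<^sup>2 / 2))) = sqrt pi * sqrt t * \<sigma> / sqrt 2"
    using \<sigma> by (simp add: real_sqrt_mult real_sqrt_divide)
  moreover have "1 / (2 * pi) * (2 * (sqrt pi * s * \<sigma> / sqrt 2)) = \<sigma> / (sqrt 2 * sqrt pi) * s" for s
  proof -
    have "sqrt pi / pi = 1 / sqrt pi" by (simp add: field_simps)
    then show ?thesis by (simp add: divide_simps) 
  qed
  ultimately show ?thesis
    using assms by (simp add: powr_half_sqrt real_sqrt_mult)
qed

text \<open>The four pieces are treated separately and enter with the factor 1 / (2 pi). Only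
  measurability and linear growth of the phase \<open>I\<close> are used, so the phase affects the
  remainders but no coefficient.\<close>

lemma fourier_price_expansion:
  assumes I: "I \<in> borel_measurable borel" "\<And>u. \<bar>I u\<bar> \<le> K * \<bar>u\<bar>"
  obtains r2 r3 :: "real \<Rightarrow> real" where
    "r2 \<in> o[at_right 0](\<lambda>t. t)" "r3 \<in> o[at_right 0](\<lambda>t. t powr (5/2 - Y))"
    "\<And>t. 0 < t \<Longrightarrow> fourier_price I t = \<sigma> / sqrt (2 * pi) * t powr (1/2)
      + C * 2 powr ((1 - Y) / 2) * \<sigma> powr (1 - Y) / (sqrt pi * Y * (Y - 1)) * Gamma (1 - Y / 2) * t powr ((3 - Y) / 2)
      + linear_coeff * t
      + - (1 / pi) * \<sigma> powr (1 - 2 * Y) * C\<^sup>2 * (cos (pi * Y / 2))\<^sup>2 * (Gamma (- Y))\<^sup>2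
           * 2 powr (Y - 1 / 2) * Gamma (Y - 1 / 2) * t powr (5/2 - Y) + r2 t + r3 t"
proof
  define A1 where "A1 t = (\<integral>u. (1 - exp (- (t * (\<sigma>\<^sup>2 / 2) * (u\<^sup>2 + 1/4)))) / (u\<^sup>2 + 1/4) \<partial>lborel)" for t
  define A2 where "A2 t = (\<integral>u. gauss t u * (rho u / (u\<^sup>2 + 1/4)) \<partial>lborel)" for t
  define A3 where "A3 t = (\<integral>v. scaled_remainder t v \<partial>lborel)" for t
  define A4 where "A4 t = (\<integral>u. phase_term I t u \<partial>lborel)" for t
  define B2 where "B2 t = C * (2 * stable_const Y) * (Gamma ((Y - 1) / 2) * (t * (\<sigma>\<^sup>2 / 2)) powr - ((Y - 1) / 2))" for t
  define q where "q = 2 * C\<^sup>2 * (stable_const Y)\<^sup>2 * (Gamma (Y - 1/2) * (\<sigma>\<^sup>2 / 2) powr - (Y - 1/2))"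
  \<comment> \<open>\<open>r2\<close> gathers the three errors of order o(t): that of the Gaussian
    part after its square root, t times the convergence error of the linear coefficient, and the
    phase. \<open>r3\<close> is the convergence error of the quadratic part alone.\<close>
  define r2 where "r2 t = 1 / (2 * pi) * (A1 t - 2 * sqrt (pi * (t * (\<sigma>\<^sup>2 / 2))))
     + t * (1 / (2 * pi) * (A2 t - B2 t) - linear_coeff) + 1 / (2 * pi) * A4 t" for t
  define r3 where "r3 t = t powr (5/2 - Y) * (- (1 / (2 * pi)) * (A3 t - q))" for t
  have ev: "\<forall>\<^sub>F t in at_right 0. 0 < (t::real)" by (rule eventually_at_right_less)
  have "((\<lambda>t. - (1 / (2 * pi)) * (A3 t - q)) \<longlongrightarrow> - (1 / (2 * pi)) * (q - q)) (at_right 0)"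
    unfolding A3_def q_def by (intro tendsto_intros integral_scaled_remainder_tendsto)
  then have "((\<lambda>t. - (1 / (2 * pi)) * (A3 t - q)) \<longlongrightarrow> 0) (at_right 0)" by simp
  then have "((\<lambda>t. r3 t / t powr (5/2 - Y)) \<longlongrightarrow> 0) (at_right 0)"
  proof (rule Lim_transform_eventually)
    show "\<forall>\<^sub>F t in at_right 0. - (1 / (2 * pi)) * (A3 t - q) = r3 t / t powr (5/2 - Y)"
      using ev by eventually_elim (simp add: r3_def)
  qed
  then show "r3 \<in> o[at_right 0](\<lambda>t. t powr (5/2 - Y))"
  proof (rule smalloI_tendsto)
    show "\<forall>\<^sub>F t in at_right 0. t powr (5/2 - Y) \<noteq> (0::real)"
      using ev by eventually_elim simp
  qed
  \<comment> \<open>The Gaussian asymptotics are used with parameter s = t \<sigma>^2 / 2.\<close>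
  have lim1: "((\<lambda>t. (A1 t - 2 * sqrt (pi * (t * (\<sigma>\<^sup>2 / 2)))) / (t * (\<sigma>\<^sup>2 / 2))) \<longlongrightarrow> 0) (at_right 0)"
  proof -
    have "a > 0 \<Longrightarrow> filterlim (\<lambda>t. t * a) (at_right 0) (at_right 0)" for a :: real
      by real_asymp
    from this[of "\<sigma>\<^sup>2 / 2"] have "filterlim (\<lambda>t. t * (\<sigma>\<^sup>2 / 2)) (at_right 0) (at_right 0)" using \<sigma> by simp
    from filterlim_compose[OF integral_one_minus_exp_laplace_asymp this] show ?thesis
      unfolding A1_def .
  qed
  have lim2: "((\<lambda>t. 1 / (2 * pi) * (A2 t - B2 t) - linear_coeff) \<longlongrightarrow> linear_coeff - linear_coeff) (at_right 0)"
    unfolding A2_def B2_def by (intro tendsto_diff integral_gauss_rho_asymp tendsto_const)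
  have lim4: "((\<lambda>t. A4 t / t) \<longlongrightarrow> 0) (at_right 0)"
  proof (rule tendsto_sandwich)
    show "\<forall>\<^sub>F t in at_right 0. 0 \<le> A4 t / t"
      using ev by eventually_elim (simp add: A4_def integral_phase_term(2)[OF I])
    show "\<forall>\<^sub>F t in at_right 0. A4 t / t \<le> t * (K\<^sup>2 / 2 * sqrt pi) * (t * (\<sigma>\<^sup>2 / 2)) powr - (1/2)"
      using ev
    proof eventually_elim
      fix t :: real assume t: "0 < t"
      have "A4 t / t \<le> t\<^sup>2 * K\<^sup>2 / 2 * (sqrt pi * (t * (\<sigma>\<^sup>2 / 2)) powr - (1/2)) / t"
        unfolding A4_def using t by (intro divide_right_mono integral_phase_term(3)[OF I]) auto
      also have "\<dots> = t * (K\<^sup>2 / 2 * sqrt pi) * (t * (\<sigma>\<^sup>2 / 2)) powr - (1/2)"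
        using t by (simp add: power2_eq_square)
      finally show "A4 t / t \<le> t * (K\<^sup>2 / 2 * sqrt pi) * (t * (\<sigma>\<^sup>2 / 2)) powr - (1/2)" .
    qed
    have "a > 0 \<Longrightarrow> ((\<lambda>t. t * c * (t * a) powr - (1/2)) \<longlongrightarrow> 0) (at_right 0)" for a c :: real
      by real_asymp
    from this[of "\<sigma>\<^sup>2 / 2" "K\<^sup>2 / 2 * sqrt pi"]
    show "((\<lambda>t. t * (K\<^sup>2 / 2 * sqrt pi) * (t * (\<sigma>\<^sup>2 / 2)) powr - (1/2)) \<longlongrightarrow> 0) (at_right 0)"
      using \<sigma> by simp
  qed auto
  have "((\<lambda>t. 1 / (2 * pi) * (\<sigma>\<^sup>2 / 2) * ((A1 t - 2 * sqrt (pi * (t * (\<sigma>\<^sup>2 / 2)))) / (t * (\<sigma>\<^sup>2 / 2)))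
      + (1 / (2 * pi) * (A2 t - B2 t) - linear_coeff) + 1 / (2 * pi) * (A4 t / t)) \<longlongrightarrow>
      1 / (2 * pi) * (\<sigma>\<^sup>2 / 2) * 0 + (linear_coeff - linear_coeff) + 1 / (2 * pi) * 0) (at_right 0)"
    by (intro tendsto_add tendsto_mult[OF tendsto_const] lim1 lim2 lim4)
  then have "((\<lambda>t. 1 / (2 * pi) * (\<sigma>\<^sup>2 / 2) * ((A1 t - 2 * sqrt (pi * (t * (\<sigma>\<^sup>2 / 2)))) / (t * (\<sigma>\<^sup>2 / 2)))
      + (1 / (2 * pi) * (A2 t - B2 t) - linear_coeff) + 1 / (2 * pi) * (A4 t / t)) \<longlongrightarrow> 0) (at_right 0)" by simp
  then have "((\<lambda>t. r2 t / t) \<longlongrightarrow> 0) (at_right 0)"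
  proof (rule Lim_transform_eventually)
    show "\<forall>\<^sub>F t in at_right 0. 1 / (2 * pi) * (\<sigma>\<^sup>2 / 2) * ((A1 t - 2 * sqrt (pi * (t * (\<sigma>\<^sup>2 / 2)))) / (t * (\<sigma>\<^sup>2 / 2)))
      + (1 / (2 * pi) * (A2 t - B2 t) - linear_coeff) + 1 / (2 * pi) * (A4 t / t) = r2 t / t"
      using ev
    proof eventually_elim
      fix t :: real assume t: "0 < t"
      have "c * s * (a / (t * s)) + b + c * (e / t) = (c * a + t * b + c * e) / t" if "s > 0" for a b c e s
        using t that by (simp add: add_divide_distrib)
      moreover have "\<sigma>\<^sup>2 / 2 > 0" using \<sigma> by simp
      ultimately show "1 / (2 * pi) * (\<sigma>\<^sup>2 / 2) * ((A1 t - 2 * sqrt (pi * (t * (\<sigma>\<^sup>2 / 2)))) / (t * (\<sigma>\<^sup>2 / 2)))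
      + (1 / (2 * pi) * (A2 t - B2 t) - linear_coeff) + 1 / (2 * pi) * (A4 t / t) = r2 t / t"
        unfolding r2_def by blast
    qed
  qed
  then show "r2 \<in> o[at_right 0](\<lambda>t. t)"
  proof (rule smalloI_tendsto)
    show "\<forall>\<^sub>F t in at_right 0. t \<noteq> (0::real)"
      using ev by eventually_elim simp
  qed
  fix t :: real assume t: "0 < t"
  have "fourier_price I t = 1 / (2 * pi) * A1 t + t * (1 / (2 * pi) * A2 t) - 1 / (2 * pi) * (t powr (5/2 - Y) * A3 t) + 1 / (2 * pi) * A4 t"
    unfolding fourier_price_split[OF I t] integral_remainder2_scaled[OF t] A1_def A2_def A3_def A4_def ..
  also have "\<dots> = 1 / (2 * pi) * (2 * sqrt (pi * (t * (\<sigma>\<^sup>2 / 2)))) + t * (1 / (2 * pi) * B2 t) + linear_coeff * t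
      + - (1 / (2 * pi)) * q * t powr (5/2 - Y) + r2 t + r3 t"
  proof -
    have "c * a1 + t * (c * a2) - c * (p * a3) + c * a4 = c * s + t * (c * b) + d * t + - c * k * p
      + (c * (a1 - s) + t * (c * (a2 - b) - d) + c * a4) + p * (- c * (a3 - k))" for c a1 a2 a3 a4 p s b d k :: real
      by (simp add: algebra_simps)
    then show ?thesis unfolding r2_def r3_def .
  qed
  finally show "fourier_price I t = \<sigma> / sqrt (2 * pi) * t powr (1/2)
      + C * 2 powr ((1 - Y) / 2) * \<sigma> powr (1 - Y) / (sqrt pi * Y * (Y - 1)) * Gamma (1 - Y / 2) * t powr ((3 - Y) / 2)
      + linear_coeff * t
      + - (1 / pi) * \<sigma> powr (1 - 2 * Y) * C\<^sup>2 * (cos (pi * Y / 2))\<^sup>2 * (Gamma (- Y))\<^sup>2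
           * 2 powr (Y - 1 / 2) * Gamma (Y - 1 / 2) * t powr (5/2 - Y) + r2 t + r3 t"
    unfolding d1_eq[OF t] B2_def d2_eq[OF t] q_def d32_eq .
qed

end

section \<open>Integrals depending holomorphically on a parameter\<close>

text \<open>Reduction to sequences, for which dominated convergence applies once the sequence has
  entered the ball of radius r. The bound is requested for \<open>w \<noteq> z\<close> only, so that
  difference quotients at z are admissible integrands.\<close>

lemma tendsto_integral_dominated_at:
  fixes F :: "complex \<Rightarrow> 'a \<Rightarrow> complex"
  assumes "z \<in> S" and meas: "\<And>w. w \<in> S \<Longrightarrow> F w \<in> borel_measurable M" and "0 < r" and B: "integrable M B"
    and bound: "\<And>w x. w \<in> S \<Longrightarrow> dist w z < r \<Longrightarrow> w \<noteq> z \<Longrightarrow> x \<in> space M \<Longrightarrow> norm (F w x) \<le> B x"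
    and lim: "\<And>x. x \<in> space M \<Longrightarrow> ((\<lambda>w. F w x) \<longlongrightarrow> f x) (at z within S)"
    and f: "f \<in> borel_measurable M"
  shows "((\<lambda>w. \<integral>x. F w x \<partial>M) \<longlongrightarrow> (\<integral>x. f x \<partial>M)) (at z within S)"
  unfolding tendsto_at_iff_sequentially comp_def
proof (intro allI impI)
  fix X :: "nat \<Rightarrow> complex" assume X: "\<forall>i. X i \<in> S - {z}" "X \<longlonglongrightarrow> z"
  from tendstoD[OF X(2) \<open>0 < r\<close>] obtain N where N: "\<And>n. n \<ge> N \<Longrightarrow> dist (X n) z < r"
    by (auto simp: eventually_sequentially)
  have "(\<lambda>n. \<integral>x. F (X (n + N)) x \<partial>M) \<longlonglongrightarrow> (\<integral>x. f x \<partial>M)"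
  proof (rule integral_dominated_convergence[OF f _ B])
    show "F (X (n + N)) \<in> borel_measurable M" for n
      using X by (intro meas) auto
    show "AE x in M. norm (F (X (n + N)) x) \<le> B x" for n
      using X N by (intro AE_I2 bound) auto
    show "AE x in M. (\<lambda>n. F (X (n + N)) x) \<longlonglongrightarrow> f x"
    proof (rule AE_I2)
      fix x assume "x \<in> space M"
      with lim X have "(\<lambda>n. F (X n) x) \<longlonglongrightarrow> f x"
        unfolding tendsto_at_iff_sequentially comp_def by blast
      then show "(\<lambda>n. F (X (n + N)) x) \<longlonglongrightarrow> f x"
        by (rule LIMSEQ_ignore_initial_segment)
    qed
  qed
  then show "(\<lambda>n. \<integral>x. F (X n) x \<partial>M) \<longlonglongrightarrow> (\<integral>x. f x \<partial>M)"
    by (rule LIMSEQ_offset)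
qed

lemma continuous_on_integral_dominated:
  fixes F :: "complex \<Rightarrow> 'a \<Rightarrow> complex"
  assumes meas: "\<And>z. z \<in> S \<Longrightarrow> F z \<in> borel_measurable M"
    and cont: "\<And>x. x \<in> space M \<Longrightarrow> continuous_on S (\<lambda>z. F z x)"
    and bound: "\<And>z. z \<in> S \<Longrightarrow> \<exists>r>0. \<exists>B. integrable M B \<and> (\<forall>w\<in>S. dist w z < r \<longrightarrow> (\<forall>x\<in>space M. norm (F w x) \<le> B x))"
  shows "continuous_on S (\<lambda>z. \<integral>x. F z x \<partial>M)"
  unfolding continuous_on_def
proof
  fix z assume z: "z \<in> S"
  from bound[OF z] obtain r B where "r > 0" "integrable M B" "\<forall>w\<in>S. dist w z < r \<longrightarrow> (\<forall>x\<in>space M. norm (F w x) \<le> B x)"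
    by blast
  then show "((\<lambda>z. \<integral>x. F z x \<partial>M) \<longlongrightarrow> (\<integral>x. F z x \<partial>M)) (at z within S)"
    using z cont by (intro tendsto_integral_dominated_at[where r = r and B = B] meas) (auto simp: continuous_on_def)
qed

text \<open>A local bound on the integrand alone suffices: Cauchy's inequality on slightly smaller
  discs turns it into a bound on the complex derivative, hence on the difference quotients, and
  dominated convergence differentiates under the integral.\<close>

lemma holomorphic_on_integral_dominated:
  fixes F :: "complex \<Rightarrow> 'a \<Rightarrow> complex"
  assumes S: "open S" and meas: "\<And>z. z \<in> S \<Longrightarrow> F z \<in> borel_measurable M"
    and holo: "\<And>x. x \<in> space M \<Longrightarrow> (\<lambda>z. F z x) holomorphic_on S"
    and bound: "\<And>z. z \<in> S \<Longrightarrow> \<exists>r>0. \<exists>B. integrable M B \<and> (\<forall>w\<in>S. dist w z < r \<longrightarrow> (\<forall>x\<in>space M. norm (F w x) \<le> B x))"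
  shows "(\<lambda>z. \<integral>x. F z x \<partial>M) holomorphic_on S"
  unfolding holomorphic_on_open[OF S]
proof
  fix z assume z: "z \<in> S"
  from bound[OF z] obtain r0 B where r0: "r0 > 0" and B: "integrable M B"
    and b0: "\<forall>w\<in>S. dist w z < r0 \<longrightarrow> (\<forall>x\<in>space M. norm (F w x) \<le> B x)"
    by blast
  from S z obtain r1 where r1: "r1 > 0" "ball z r1 \<subseteq> S" by (auto simp: open_contains_ball)
  define r where "r = min r0 r1"
  have r: "r > 0" "ball z r \<subseteq> S" using r0 r1 by (auto simp: r_def)
  have b: "norm (F w x) \<le> B x" if "w \<in> ball z r" "x \<in> space M" for w x
  proof -
    have "w \<in> S" "dist w z < r0" using that r by (auto simp: r_def dist_commute)
    with b0 that show ?thesis by blast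
  qed
  have int: "integrable M (F w)" if "w \<in> ball z r" for w
  proof (rule Bochner_Integration.integrable_bound[OF B])
    show "F w \<in> borel_measurable M" using that r by (intro meas) auto
    show "AE x in M. norm (F w x) \<le> norm (B x)"
      using order_trans[OF b[OF that] abs_ge_self] by (intro AE_I2) (simp only: real_norm_def)
  qed
  have lip: "norm (F w x - F z x) \<le> B x / (r / 3) * norm (w - z)" if "w \<in> ball z (r/2)" "x \<in> space M" for w x
  proof (rule field_differentiable_bound[of "ball z (r/2)" "\<lambda>z. F z x" "deriv (\<lambda>z. F z x)"])
    fix y assume y: "y \<in> ball z (r/2)"
    \<comment> \<open>The radii r/2 and r/3 are chosen because 1/2 + 1/3 < 1, so the Cauchy circle
      stays where \<open>B\<close> is a bound.\<close>
    have sub: "cball y (r/3) \<subseteq> ball z r"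
    proof
      fix w assume "w \<in> cball y (r/3)"
      then show "w \<in> ball z r" using y dist_triangle[of z w y] r by auto
    qed
    have h: "(\<lambda>z. F z x) holomorphic_on ball z r"
      using holo[OF that(2)] r(2) by (rule holomorphic_on_subset)
    show "((\<lambda>z. F z x) has_field_derivative deriv (\<lambda>z. F z x) y) (at y within ball z (r/2))"
      using y r by (intro holomorphic_derivI[OF h]) auto
    have "norm ((deriv ^^ 1) (\<lambda>z. F z x) y) \<le> fact 1 * B x / (r/3) ^ 1"
    proof (rule Cauchy_inequality)
      show "(\<lambda>z. F z x) holomorphic_on ball y (r/3)"
        using h sub ball_subset_cball by (meson holomorphic_on_subset order_trans)
      show "continuous_on (cball y (r/3)) (\<lambda>z. F z x)"
        using holomorphic_on_imp_continuous_on[OF h] sub by (rule continuous_on_subset)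
      show "norm (F w x) \<le> B x" if "norm (y - w) = r/3" for w
        using sub that \<open>x \<in> space M\<close> by (intro b) (auto simp: dist_norm)
    qed (use r in auto)
    then show "norm (deriv (\<lambda>z. F z x) y) \<le> B x / (r/3)" by simp
  qed (use that r in auto)
  \<comment> \<open>The derivative at z is measurable in x as a pointwise limit of difference
    quotients along a sequence \<open>w\<close> that stays in the ball and never meets z.\<close>
  have meas': "(\<lambda>x. deriv (\<lambda>z. F z x) z) \<in> borel_measurable M"
  proof (rule borel_measurable_LIMSEQ_metric)
    define w where "w n = z + of_real (r / 2 * inverse (real (Suc (Suc n))))" for n
    have w: "w n \<in> ball z r" "w n \<noteq> z" for n
    proof -
      have "r / 2 * inverse (real (Suc (Suc n))) < r" "0 < r / 2 * inverse (real (Suc (Suc n)))"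
        using r by (auto simp: field_simps intro: add_pos_nonneg)
      then show "w n \<in> ball z r" "w n \<noteq> z"
        using r unfolding w_def by (auto simp: dist_norm simp del: of_real_mult of_real_inverse of_real_divide)
    qed
    have "(\<lambda>n. w n) \<longlonglongrightarrow> z + of_real (r / 2 * 0)"
      unfolding w_def by (intro tendsto_intros LIMSEQ_inverse_real_of_nat LIMSEQ_Suc)
    then have wlim: "w \<longlonglongrightarrow> z" by simp
    show "(\<lambda>x. (F (w n) x - F z x) / (w n - z)) \<in> borel_measurable M" for n
      using w(1)[of n] r(2) z by (intro borel_measurable_divide borel_measurable_diff borel_measurable_const meas) blast+
    show "(\<lambda>n. (F (w n) x - F z x) / (w n - z)) \<longlonglongrightarrow> deriv (\<lambda>z. F z x) z" if "x \<in> space M" for x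
    proof -
      have "((\<lambda>z. F z x) has_field_derivative deriv (\<lambda>z. F z x) z) (at z)"
        using holo[OF that] S z by (rule holomorphic_derivI)
      then have "((\<lambda>w. (F w x - F z x) / (w - z)) \<longlongrightarrow> deriv (\<lambda>z. F z x) z) (at z)"
        by (simp add: has_field_derivative_iff)
      then show ?thesis
        using w wlim unfolding tendsto_at_iff_sequentially comp_def by auto
    qed
  qed
  have "((\<lambda>w. \<integral>x. (F w x - F z x) / (w - z) \<partial>M) \<longlongrightarrow> (\<integral>x. deriv (\<lambda>z. F z x) z \<partial>M)) (at z within ball z r)"
  proof (rule tendsto_integral_dominated_at[where r = "r/2" and B = "\<lambda>x. B x / (r/3)"])
    show "(\<lambda>x. (F w x - F z x) / (w - z)) \<in> borel_measurable M" if "w \<in> ball z r" for w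
      using that r z by (intro borel_measurable_divide borel_measurable_diff borel_measurable_const meas) auto
    show "norm ((F w x - F z x) / (w - z)) \<le> B x / (r/3)"
      if "w \<in> ball z r" "dist w z < r/2" "w \<noteq> z" "x \<in> space M" for w x
      using lip[of w x] that by (simp add: norm_divide divide_le_eq dist_commute)
    show "((\<lambda>w. (F w x - F z x) / (w - z)) \<longlongrightarrow> deriv (\<lambda>z. F z x) z) (at z within ball z r)" if "x \<in> space M" for x
      using holomorphic_derivI[OF holo[OF that] S z, of "ball z r"] by (simp add: has_field_derivative_iff)
  qed (use r B meas' in auto)
  moreover have eq: "(\<integral>x. (F w x - F z x) / (w - z) \<partial>M) = ((\<integral>x. F w x \<partial>M) - (\<integral>x. F z x \<partial>M)) / (w - z)" if "w \<in> ball z r" for w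
    using int[OF that] int[of z] r by (subst integral_divide_zero) (simp add: Bochner_Integration.integral_diff)
  ultimately have "((\<lambda>w. ((\<integral>x. F w x \<partial>M) - (\<integral>x. F z x \<partial>M)) / (w - z)) \<longlongrightarrow> (\<integral>x. deriv (\<lambda>z. F z x) z \<partial>M)) (at z within ball z r)"
  proof (elim Lim_transform_eventually)
    show "\<forall>\<^sub>F w in at z within ball z r. (\<integral>x. (F w x - F z x) / (w - z) \<partial>M) = ((\<integral>x. F w x \<partial>M) - (\<integral>x. F z x \<partial>M)) / (w - z)"
      unfolding eventually_at_filter using eq by (intro always_eventually) blast
  qed
  then have "((\<lambda>z. \<integral>x. F z x \<partial>M) has_field_derivative (\<integral>x. deriv (\<lambda>z. F z x) z \<partial>M)) (at z within ball z r)"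
    by (simp add: has_field_derivative_iff)
  then show "\<exists>f'. ((\<lambda>z. \<integral>x. F z x \<partial>M) has_field_derivative f') (at z)"
    using r by (subst (asm) at_within_open) auto
qed

text \<open>One exponential moment, at Re z = 1, together with the constant 1 at Re z = 0, dominates
  all exponentials of the closed strip.\<close>

lemma norm_exp_strip_le:
  fixes x :: real
  assumes "0 \<le> Re z" "Re z \<le> 1"
  shows "norm (exp (z * of_real x)) \<le> 1 + exp x"
proof -
  have "norm (exp (z * of_real x)) = exp (Re z * x)" by simp
  also have "\<dots> \<le> 1 + exp x"
  proof (cases "x \<ge> 0")
    case True
    then have "exp (Re z * x) \<le> exp x" using assms by (simp add: mult_left_le_one_le)
    then show ?thesis by linarith
  next
    case False
    then have "exp (Re z * x) \<le> 1" using assms by (simp add: mult_nonneg_nonpos)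
    then show ?thesis by (smt (verit) exp_ge_zero)
  qed
  finally show ?thesis .
qed

section \<open>Transforms on the strip and the Fourier formula for the price\<close>

context prob_space
begin

text \<open>The two sides agree on the imaginary axis, which is a boundary of the strip, so the
  identity theorem does not apply directly. It applies after the difference has been extended by 0
  to the left half-plane, where it is then known on an open set.\<close>

lemma mgf_strip_continuation:
  fixes X :: "'a \<Rightarrow> real"
  assumes X [measurable]: "X \<in> borel_measurable M" and intX: "integrable M (\<lambda>\<omega>. exp (X \<omega>))"
    and g: "continuous_on {z. 0 \<le> Re z \<and> Re z \<le> 1} g" "g holomorphic_on {z. 0 < Re z \<and> Re z < 1}"
    and eq: "\<And>u. (\<integral>\<omega>. exp (\<i> * of_real u * of_real (X \<omega>)) \<partial>M) = g (\<i> * of_real u)"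
    and z: "0 \<le> Re z" "Re z \<le> 1"
  shows "(\<integral>\<omega>. exp (z * of_real (X \<omega>)) \<partial>M) = g z"
proof -
  define f where "f z = (\<integral>\<omega>. exp (z * of_real (X \<omega>)) \<partial>M)" for z :: complex
  have intB: "integrable M (\<lambda>\<omega>. 1 + exp (X \<omega>))"
    using intX by simp
  have bound: "\<exists>r>0. \<exists>B. integrable M B \<and> (\<forall>w\<in>T. dist w z < r \<longrightarrow> (\<forall>\<omega>\<in>space M. norm (exp (w * of_real (X \<omega>))) \<le> B \<omega>))"
    if "T \<subseteq> {z. 0 \<le> Re z \<and> Re z \<le> 1}" for T z
    using intB norm_exp_strip_le that by (intro exI[of _ 1] conjI exI[of _ "\<lambda>\<omega>. 1 + exp (X \<omega>)"]) (auto simp del: norm_exp_eq_Re)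
  have contf: "continuous_on {z. 0 \<le> Re z \<and> Re z \<le> 1} f"
    unfolding f_def by (rule continuous_on_integral_dominated[OF _ _ bound]) (auto intro!: continuous_intros)
  have op: "open {z. 0 < Re z \<and> Re z < 1}"
    using open_Int[OF open_halfspace_Re_gt[of 0] open_halfspace_Re_lt[of 1]] by (simp add: Collect_conj_eq)
  have holf: "f holomorphic_on {z. 0 < Re z \<and> Re z < 1}"
    unfolding f_def by (rule holomorphic_on_integral_dominated[OF op _ _ bound]) (auto intro!: holomorphic_intros)
  \<comment> \<open>Continuity of \<open>D\<close> across the imaginary axis is the hypothesis
    \<open>eq\<close>; a continuous function that is holomorphic on both sides of a line is
    holomorphic across it. As \<open>D\<close> vanishes for Re z < 0, it vanishes for Re z <
    1.\<close>
  define D where "D z = (if Re z \<le> 0 then 0 else f z - g z)" for z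
  define S where "S = {z. Re z < 1}"
  have S: "open S" "connected S"
    using open_halfspace_Re_lt[of 1] convex_halfspace_Re_lt[of 1] by (auto simp: S_def convex_connected)
  have im: "f z = g z" if "Re z = 0" for z
    using eq[of "Im z"] that complex_eq[of z] by (simp add: f_def)
  have "continuous_on S D"
    unfolding D_def
  proof (rule continuous_on_cases_le)
    show "continuous_on {z \<in> S. 0 \<le> Re z} (\<lambda>z. f z - g z)"
      by (rule continuous_on_subset[OF continuous_on_diff[OF contf g(1)]]) (auto simp: S_def)
  qed (auto intro!: continuous_intros simp: im)
  moreover have "D holomorphic_on (S \<inter> {z. 1 \<bullet> z < 0})"
    by (rule holomorphic_transform[of "\<lambda>_. 0"]) (auto simp: D_def inner_complex_def)
  moreover have "D holomorphic_on (S \<inter> {z. 0 < 1 \<bullet> z})"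
    by (rule holomorphic_transform[of "\<lambda>z. f z - g z"], rule holomorphic_on_subset[OF holomorphic_on_diff[OF holf g(2)]])
      (auto simp: D_def inner_complex_def S_def)
  ultimately have holD: "D holomorphic_on S"
    using S by (intro holomorphic_on_paste_across_line[of S 1 D 0]) auto
  have zero: "D w = 0" if "w \<in> S" for w
  proof (rule analytic_continuation_open[where f = D and g = "\<lambda>_. 0" and s = "{z. Re z < 0}" and s' = S])
    show "{z. Re z < 0} \<noteq> {}" by (auto intro!: exI[of _ "-1"])
  qed (use S holD that open_halfspace_Re_lt in \<open>auto simp: S_def D_def\<close>)
  have eq': "f w = g w" if "0 \<le> Re w" "Re w < 1" for w
    using zero[of w] im[of w] that by (cases "Re w = 0") (auto simp: D_def S_def)
  have "f z = g z"
  proof (cases "Re z < 1")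
    case False
    with z have z1: "Re z = 1" by simp
    \<comment> \<open>The edge Re z = 1 is reached by continuity from inside the strip. It is needed
      because the martingale condition lives at z = 1.\<close>
    define w where "w n = z - of_real (inverse (real (Suc n)))" for n
    have w: "0 \<le> Re (w n)" "Re (w n) < 1" for n
    proof -
      have "Re (w n) = 1 - inverse (real (Suc n))"
        by (simp only: w_def minus_complex.simps Re_complex_of_real z1)
      moreover have "0 < inverse (real (Suc n))" "inverse (real (Suc n)) \<le> 1"
        by (auto simp: field_simps)
      ultimately show "0 \<le> Re (w n)" "Re (w n) < 1" by linarith+
    qed
    have "w \<longlonglongrightarrow> z - of_real 0"
      unfolding w_def by (intro tendsto_intros LIMSEQ_inverse_real_of_nat)
    then have wl: "w \<longlonglongrightarrow> z" by simp
    have "(\<lambda>n. f (w n) - g (w n)) \<longlonglongrightarrow> f z - g z"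
      using continuous_on_tendsto_compose[OF continuous_on_diff[OF contf g(1)] wl] w z
      by (auto intro!: always_eventually less_imp_le)
    moreover have "(\<lambda>n. f (w n) - g (w n)) = (\<lambda>_. 0)" using eq' w by auto
    ultimately show ?thesis by (simp add: LIMSEQ_const_iff)
  qed (use eq' z in auto)
  then show ?thesis by (simp add: f_def)
qed

text \<open>As \<open>max 0 (exp x - 1)\<close> is \<open>exp x\<close> minus
  \<open>min (exp x) 1\<close> and the expectation of \<open>exp (X \<omega>)\<close> is 1, only the
  expectation of the minimum has to be represented.\<close>

lemma call_price_fourier:
  fixes X :: "'a \<Rightarrow> real"
  assumes X [measurable]: "X \<in> borel_measurable M" and intX: "integrable M (\<lambda>\<omega>. exp (X \<omega>))"
    and one: "expectation (\<lambda>\<omega>. exp (X \<omega>)) = 1"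
  shows "expectation (\<lambda>\<omega>. max 0 (exp (X \<omega>) - 1))
    = 1 / (2 * pi) * (\<integral>u. (1 - expectation (\<lambda>\<omega>. exp (X \<omega> / 2) * cos (u * X \<omega>))) / (u\<^sup>2 + 1/4) \<partial>lborel)"
proof -
  have half: "exp (x / 2) \<le> 1 + exp x" for x :: real
    using norm_exp_strip_le[of "1/2" x] by simp
  have int2: "integrable M (\<lambda>\<omega>. exp (X \<omega> / 2))"
    using half by (intro Bochner_Integration.integrable_bound[OF Bochner_Integration.integrable_add[OF integrable_const[of 1] intX]]) auto
  have intc: "integrable M (\<lambda>\<omega>. exp (X \<omega> / 2) * cos (u * X \<omega>))" for u
    by (rule Bochner_Integration.integrable_bound[OF int2]) (auto simp: abs_mult mult_left_le)
  have intm: "integrable M (\<lambda>\<omega>. min (exp (X \<omega>)) 1)"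
    by (rule Bochner_Integration.integrable_bound[OF intX]) auto
  \<comment> \<open>The integrand \<open>exp (X \<omega> / 2) * cos (u * X \<omega>)\<close> has no
    sign. Working with \<open>1 - cos\<close> keeps it nonnegative; the surplus
    \<open>exp (X \<omega> / 2)\<close> is traded for 1 at the end by adding a multiple of the
    kernel, of integral 2 pi.\<close>
  define h where "h u = expectation (\<lambda>\<omega>. exp (X \<omega> / 2)) - expectation (\<lambda>\<omega>. exp (X \<omega> / 2) * cos (u * X \<omega>))" for u
  have "has_bochner_integral lborel (\<lambda>u. h u / (u\<^sup>2 + 1/4))
     (2 * pi * (expectation (\<lambda>\<omega>. exp (X \<omega> / 2)) - expectation (\<lambda>\<omega>. min (exp (X \<omega>)) 1)))"
  proof (rule tonelli_has_bochner_integral[where ?M1.0 = M and f = "\<lambda>\<omega> u. exp (X \<omega> / 2) * ((1 - cos (u * X \<omega>)) / (u\<^sup>2 + 1/4))"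
        and g = "\<lambda>\<omega>. 2 * pi * (exp (X \<omega> / 2) - min (exp (X \<omega>)) 1)"])
    show "pair_sigma_finite M (lborel :: real measure)"
      by (intro pair_sigma_finite.intro sigma_finite_measure_axioms lborel.sigma_finite_measure_axioms)
    show "(\<lambda>(\<omega>, u::real). exp (X \<omega> / 2) * ((1 - cos (u * X \<omega>)) / (u\<^sup>2 + 1/4))) \<in> borel_measurable (M \<Otimes>\<^sub>M lborel)"
      by measurable
    show "0 \<le> exp (X \<omega> / 2) * ((1 - cos (u * X \<omega>)) / (u\<^sup>2 + 1/4))" for \<omega> and u :: real
      by (intro mult_nonneg_nonneg divide_nonneg_nonneg) auto
    show "AE \<omega> in M. has_bochner_integral lborel (\<lambda>u. exp (X \<omega> / 2) * ((1 - cos (u * X \<omega>)) / (u\<^sup>2 + 1/4)))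
       (2 * pi * (exp (X \<omega> / 2) - min (exp (X \<omega>)) 1))"
    proof (rule AE_I2)
      fix \<omega>
      have "has_bochner_integral lborel (\<lambda>u. exp (X \<omega> / 2) * (1 / (u\<^sup>2 + 1/4) - cos (u * X \<omega>) / (u\<^sup>2 + 1/4)))
         (exp (X \<omega> / 2) * (2 * pi - 2 * pi * exp (- \<bar>X \<omega>\<bar> / 2)))"
        by (intro has_bochner_integral_mult_right has_bochner_integral_diff integral_laplace integral_cos_laplace)
      moreover have "exp (x / 2) * (2 * pi - 2 * pi * exp (- \<bar>x\<bar> / 2)) = 2 * pi * (exp (x / 2) - min (exp x) 1)" for x :: real
      proof -
        have "exp (x / 2) * exp (- \<bar>x\<bar> / 2) = min (exp x) 1"
          unfolding exp_add[symmetric] by (cases "x \<ge> 0") (auto simp: min_def)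
        then show ?thesis by (simp add: algebra_simps)
      qed
      ultimately show "has_bochner_integral lborel (\<lambda>u. exp (X \<omega> / 2) * ((1 - cos (u * X \<omega>)) / (u\<^sup>2 + 1/4)))
       (2 * pi * (exp (X \<omega> / 2) - min (exp (X \<omega>)) 1))"
        by (simp only: diff_divide_distrib)
    qed
    show "has_bochner_integral M (\<lambda>\<omega>. 2 * pi * (exp (X \<omega> / 2) - min (exp (X \<omega>)) 1))
       (2 * pi * (expectation (\<lambda>\<omega>. exp (X \<omega> / 2)) - expectation (\<lambda>\<omega>. min (exp (X \<omega>)) 1)))"
      by (intro has_bochner_integral_mult_right has_bochner_integral_diff has_bochner_integral_integrable int2 intm)
    show "AE u in lborel. has_bochner_integral M (\<lambda>\<omega>. exp (X \<omega> / 2) * ((1 - cos (u * X \<omega>)) / (u\<^sup>2 + 1/4))) (h u / (u\<^sup>2 + 1/4))"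
    proof (rule AE_I2)
      fix u :: real
      have "has_bochner_integral M (\<lambda>\<omega>. (exp (X \<omega> / 2) - exp (X \<omega> / 2) * cos (u * X \<omega>)) / (u\<^sup>2 + 1/4)) (h u / (u\<^sup>2 + 1/4))"
        unfolding h_def by (intro has_bochner_integral_divide_zero has_bochner_integral_diff has_bochner_integral_integrable int2 intc)
      then show "has_bochner_integral M (\<lambda>\<omega>. exp (X \<omega> / 2) * ((1 - cos (u * X \<omega>)) / (u\<^sup>2 + 1/4))) (h u / (u\<^sup>2 + 1/4))"
        by (simp add: right_diff_distrib)
    qed
    show "(\<lambda>u. h u / (u\<^sup>2 + 1/4)) \<in> borel_measurable lborel"
      unfolding h_def by measurable
  qed
  from has_bochner_integral_add[OF this has_bochner_integral_mult_right[OF integral_laplace, of "1 - expectation (\<lambda>\<omega>. exp (X \<omega> / 2))"]]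
  have "has_bochner_integral lborel (\<lambda>u. h u / (u\<^sup>2 + 1/4) + (1 - expectation (\<lambda>\<omega>. exp (X \<omega> / 2))) * (1 / (u\<^sup>2 + 1/4)))
     (2 * pi * (expectation (\<lambda>\<omega>. exp (X \<omega> / 2)) - expectation (\<lambda>\<omega>. min (exp (X \<omega>)) 1)) + (1 - expectation (\<lambda>\<omega>. exp (X \<omega> / 2))) * (2 * pi))"
    by simp
  moreover have "h u / (u\<^sup>2 + 1/4) + (1 - expectation (\<lambda>\<omega>. exp (X \<omega> / 2))) * (1 / (u\<^sup>2 + 1/4))
     = (1 - expectation (\<lambda>\<omega>. exp (X \<omega> / 2) * cos (u * X \<omega>))) / (u\<^sup>2 + 1/4)" for u
    by (simp add: h_def flip: add_divide_distrib)
  ultimately have "(\<integral>u. (1 - expectation (\<lambda>\<omega>. exp (X \<omega> / 2) * cos (u * X \<omega>))) / (u\<^sup>2 + 1/4) \<partial>lborel)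
     = 2 * pi * (1 - expectation (\<lambda>\<omega>. min (exp (X \<omega>)) 1))"
    by (simp add: has_bochner_integral_iff algebra_simps)
  moreover have "expectation (\<lambda>\<omega>. max 0 (exp (X \<omega>) - 1)) = expectation (\<lambda>\<omega>. exp (X \<omega>) - min (exp (X \<omega>)) 1)"
    by (intro Bochner_Integration.integral_cong) (auto simp: max_def min_def)
  moreover have "\<dots> = 1 - expectation (\<lambda>\<omega>. min (exp (X \<omega>)) 1)"
    using intX intm one by simp
  ultimately show ?thesis by simp
qed

end

section \<open>The CGMY exponent on the strip\<close>

lemma abs_exp_diff_le:
  fixes s r :: real
  assumes "0 \<le> s" "0 \<le> r"
  shows "\<bar>exp (- s) - exp (- r)\<bar> \<le> min \<bar>s - r\<bar> 1"
proof -
  have *: "\<bar>exp (- s) - exp (- r)\<bar> \<le> \<bar>s - r\<bar>" if "0 \<le> s" "s \<le> r" for s r :: real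
  proof -
    have "exp (- s) - exp (- r) = exp (- s) * (1 - exp (- (r - s)))"
      by (simp add: right_diff_distrib flip: exp_add)
    also have "\<dots> \<le> 1 * (r - s)"
    proof (rule mult_mono)
      show "1 - exp (- (r - s)) \<le> r - s"
        using exp_ge_add_one_self[of "- (r - s)"] by linarith
    qed (use that in auto)
    finally show ?thesis using that by simp
  qed
  have "exp (- s) \<le> 1" "exp (- r) \<le> 1" "0 < exp (- s)" "0 < exp (- r)"
    using assms by simp_all
  then have "\<bar>exp (- s) - exp (- r)\<bar> \<le> 1" by linarith
  moreover have "\<bar>exp (- s) - exp (- r)\<bar> \<le> \<bar>s - r\<bar>"
    using *[of s r] *[of r s] assms by (cases "s \<le> r") (auto simp: abs_minus_commute)
  ultimately show ?thesis by simp
qed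

text \<open>The compensator \<open>exp x - 1\<close> agrees with x to first order, which is enough
  for integrability near 0. It makes the kernel vanish at z = 1 as well as at z = 0, so the
  martingale condition will concern the drift and the Gaussian part only.\<close>

definition jump_kernel :: "complex \<Rightarrow> real \<Rightarrow> complex" where
  "jump_kernel z x = exp (z * of_real x) - 1 - z * of_real (exp x - 1)"

lemma jump_kernel_measurable [measurable]: "jump_kernel z \<in> borel_measurable borel"
  unfolding jump_kernel_def[abs_def] by measurable

lemma norm_exp_minus_one_minus_le:
  fixes x :: real
  assumes "0 \<le> Re z" "Re z \<le> 1" "norm z \<le> R" "\<bar>x\<bar> \<le> 1"
  shows "norm (exp (z * of_real x) - 1 - z * of_real x) \<le> exp 1 * R\<^sup>2 * x\<^sup>2"
proof -
  have "norm (exp (z * of_real x) - (\<Sum>i\<le>1. (z * of_real x) ^ i / fact i)) \<le> exp \<bar>Re (z * of_real x)\<bar> * norm (z * of_real x) ^ Suc 1 / fact 1"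
    by (rule Taylor_exp)
  also have "\<dots> = exp \<bar>Re z * x\<bar> * ((norm z)\<^sup>2 * x\<^sup>2)"
    by (simp add: norm_mult power_mult_distrib power2_eq_square)
  also have "\<dots> \<le> exp 1 * (R\<^sup>2 * x\<^sup>2)"
  proof (intro mult_mono)
    have "\<bar>Re z * x\<bar> \<le> 1 * 1"
      unfolding abs_mult using assms by (intro mult_mono) auto
    then show "exp \<bar>Re z * x\<bar> \<le> exp 1" by simp
    show "(norm z)\<^sup>2 \<le> R\<^sup>2" using assms by (intro power_mono) auto
  qed auto
  finally show ?thesis by (simp add: diff_diff_eq mult.assoc)
qed

text \<open>For |x| \<le> 1 both the exponential and the compensator differ from their linear parts
  by O(x^2); for larger |x| each term is at most a multiple of \<open>1 + exp x\<close>. The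
  constant depends on z through R only, which gives locally uniform domination.\<close>

lemma norm_jump_kernel_le:
  assumes "0 \<le> Re z" "Re z \<le> 1" "norm z \<le> R"
  shows "norm (jump_kernel z x) \<le> (exp 1 * (R\<^sup>2 + R) + (2 + R)) * (min 1 (x\<^sup>2) * (1 + exp x))"
proof -
  have R: "0 \<le> R" using assms(3) norm_ge_zero[of z] by linarith
  have c: "0 \<le> exp 1 * (R\<^sup>2 + R)" "0 \<le> 2 + R" using R by auto
  show ?thesis
  proof (cases "\<bar>x\<bar> \<le> 1")
    case True
    then have x2: "x\<^sup>2 \<le> 1" by (simp add: abs_square_le_1)
    have "norm (exp (1 * complex_of_real x) - 1 - 1 * of_real x) \<le> exp 1 * 1\<^sup>2 * x\<^sup>2"
      by (rule norm_exp_minus_one_minus_le) (use True in auto)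
    moreover have "exp (1 * complex_of_real x) - 1 - 1 * of_real x = complex_of_real (exp x - 1 - x)"
      by (simp add: exp_of_real)
    ultimately have e: "\<bar>exp x - 1 - x\<bar> \<le> exp 1 * x\<^sup>2"
      by (simp only: norm_of_real) simp
    have "jump_kernel z x = (exp (z * of_real x) - 1 - z * of_real x) - z * of_real (exp x - 1 - x)"
      by (simp add: jump_kernel_def algebra_simps)
    also have "norm \<dots> \<le> norm (exp (z * of_real x) - 1 - z * of_real x) + norm (z * of_real (exp x - 1 - x))"
      by (rule norm_triangle_ineq4)
    also have "\<dots> \<le> exp 1 * R\<^sup>2 * x\<^sup>2 + R * (exp 1 * x\<^sup>2)"
      unfolding norm_mult norm_of_real using assms True e R
      by (intro add_mono norm_exp_minus_one_minus_le mult_mono) auto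
    also have "\<dots> = exp 1 * (R\<^sup>2 + R) * (x\<^sup>2 * 1)" by (simp add: algebra_simps)
    also have "\<dots> \<le> (exp 1 * (R\<^sup>2 + R) + (2 + R)) * (min 1 (x\<^sup>2) * (1 + exp x))"
      using c x2 by (intro mult_mono) (auto simp: min_def)
    finally show ?thesis .
  next
    case False
    then have x2: "1 \<le> x\<^sup>2" using one_le_power[of "\<bar>x\<bar>" 2] by simp
    have "norm (jump_kernel z x) \<le> norm (exp (z * of_real x)) + norm (1::complex) + norm (z * of_real (exp x - 1))"
      unfolding jump_kernel_def by (intro order_trans[OF norm_triangle_ineq4] add_right_mono norm_triangle_ineq4)
    also have "\<dots> \<le> (1 + exp x) + (1 + exp x) + R * (1 + exp x)"
      unfolding norm_mult[of z] norm_of_real using assms R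
      by (intro add_mono mult_mono norm_exp_strip_le) (auto simp: abs_le_iff add.commute)
    also have "\<dots> = (2 + R) * (1 + exp x)" by (simp add: algebra_simps)
    also have "\<dots> \<le> (exp 1 * (R\<^sup>2 + R) + (2 + R)) * (min 1 (x\<^sup>2) * (1 + exp x))"
      using c x2 by (intro mult_mono) (auto intro: add_nonneg_nonneg)
    finally show ?thesis .
  qed
qed

section \<open>Integration against the CGMY measure and the jump exponent\<close>

context cgmy_params
begin

abbreviation nu :: "real measure" where
  "nu \<equiv> cgmy_measure C G M Y"

definition nu_density :: "real \<Rightarrow> real" where
  "nu_density x = C * \<bar>x\<bar> powr (- Y - 1) * (exp (- M * x) * indicator {0<..} x + exp (G * x) * indicator {..<0} x)"

lemma nu_density_measurable [measurable]: "nu_density \<in> borel_measurable borel"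
  unfolding nu_density_def[abs_def] by measurable

lemma nu_density_nonneg: "0 \<le> nu_density x"
  using C by (auto simp: nu_density_def)

lemma nu_eq: "nu = density lborel (\<lambda>x. ennreal (nu_density x))"
  by (simp add: cgmy_measure_def nu_density_def)

lemma sets_nu [measurable_cong, simp]: "sets nu = sets borel"
  by (simp add: nu_eq)

lemma integrable_stable_min:
  "integrable lborel (\<lambda>x. indicator {0<..} x * (x powr (- Y - 1) * min (x\<^sup>2) x))"
  by (rule integrable_powr_stable[OF Y_bounds, where K = 1]) auto

text \<open>The class of functions dominated here contains every kernel used. Because M > 1 and G >
  0, tempering absorbs the growth \<open>1 + exp x\<close> up to a factor 2, and the stable density
  is integrable against \<open>min (x\<^sup>2) \<bar>x\<bar>\<close>.\<close>

lemma integrable_nu: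
  fixes f :: "real \<Rightarrow> 'b::{banach, second_countable_topology}"
  assumes [measurable]: "f \<in> borel_measurable borel"
    and bound: "\<And>x. norm (f x) \<le> K * (min 1 (x\<^sup>2) * (1 + exp x))"
  shows "integrable nu f"
proof -
  have "norm (f 1) \<le> K * (1 + exp 1)" using bound[of 1] by simp
  then have "0 \<le> K * (1 + exp 1)" using norm_ge_zero order_trans by blast
  moreover have "0 < 1 + exp (1::real)" by (simp add: add_pos_pos)
  ultimately have K: "0 \<le> K" by (simp add: zero_le_mult_iff)
  define m where "m x = \<bar>x\<bar> powr (- Y - 1) * min (x\<^sup>2) \<bar>x\<bar>" for x :: real
  have "has_bochner_integral lborel m (2 * (\<integral>x. indicator {0<..} x * m x \<partial>lborel))"
  proof (rule has_bochner_integral_even)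
    have "integrable lborel (\<lambda>x. indicator {0<..} x * m x)"
      using integrable_stable_min by (rule Bochner_Integration.integrable_cong[THEN iffD1, rotated 2]) (auto simp: m_def indicator_def)
    then show "has_bochner_integral lborel (\<lambda>x. indicator {0<..} x * m x) (\<integral>x. indicator {0<..} x * m x \<partial>lborel)"
      by (rule has_bochner_integral_integrable)
  qed (auto simp: m_def[abs_def])
  then have im: "integrable lborel (\<lambda>x. 2 * C * K * m x)"
    by (auto simp: has_bochner_integral_iff)
  have "integrable lborel (\<lambda>x. nu_density x *\<^sub>R f x)"
  proof (rule Bochner_Integration.integrable_bound[OF im])
    show "AE x in lborel. norm (nu_density x *\<^sub>R f x) \<le> norm (2 * C * K * m x)"
    proof (rule AE_I2)
      fix x :: real
      have e: "(exp (- M * x) * indicator {0<..} x + exp (G * x) * indicator {..<0} x) * (1 + exp x) \<le> 2"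
      proof (cases x "0::real" rule: linorder_cases)
        case less
        then have "exp (G * x) \<le> 1" "exp x \<le> 1" using G by (auto simp: mult_nonneg_nonpos)
        then have "exp (G * x) * (1 + exp x) \<le> 1 * 2" by (intro mult_mono) auto
        then show ?thesis using less by simp
      next
        case greater
        then have "exp (- M * x) \<le> exp (- x)" "exp (- x) \<le> 1" using M by auto
        then have "exp (- M * x) * (1 + exp x) \<le> exp (- x) * (1 + exp x)" by (intro mult_right_mono) auto
        also have "\<dots> = exp (- x) + 1" by (simp add: distrib_left flip: exp_add)
        also have "\<dots> \<le> 2" using greater by simp
        finally show ?thesis using greater by simp
      qed simp
      have mm: "min 1 (x\<^sup>2) \<le> min (x\<^sup>2) \<bar>x\<bar>"
      proof (cases "\<bar>x\<bar> \<le> 1")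
        case True
        then have "\<bar>x\<bar> * \<bar>x\<bar> \<le> 1 * \<bar>x\<bar>" by (intro mult_right_mono) auto
        then show ?thesis by (simp add: min_def power2_eq_square)
      qed (simp add: min_def)
      define E where "E = exp (- M * x) * indicator {0<..} x + exp (G * x) * indicator {..<0} x"
      have E: "0 \<le> E" by (simp add: E_def)
      have "norm (nu_density x *\<^sub>R f x) = C * \<bar>x\<bar> powr (- Y - 1) * E * norm (f x)"
        unfolding nu_density_def E_def[symmetric] using C E by (simp add: abs_mult)
      also have "\<dots> \<le> C * \<bar>x\<bar> powr (- Y - 1) * E * (K * (min 1 (x\<^sup>2) * (1 + exp x)))"
        using C E by (intro mult_left_mono bound) auto
      also have "\<dots> = C * K * \<bar>x\<bar> powr (- Y - 1) * (min 1 (x\<^sup>2) * (E * (1 + exp x)))"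
        by simp
      also have "\<dots> \<le> C * K * \<bar>x\<bar> powr (- Y - 1) * (min (x\<^sup>2) \<bar>x\<bar> * 2)"
        using C K E e mm unfolding E_def[symmetric]
        by (intro mult_left_mono mult_mono) (auto intro: add_nonneg_nonneg)
      also have "\<dots> = 2 * C * K * m x" by (simp add: m_def)
      finally show "norm (nu_density x *\<^sub>R f x) \<le> norm (2 * C * K * m x)" by simp
    qed
  qed measurable
  then show ?thesis
    unfolding nu_eq by (subst integrable_density) (auto simp: nu_density_nonneg)
qed

lemma has_bochner_integral_nu_half:
  fixes f :: "real \<Rightarrow> real"
  assumes f [measurable]: "f \<in> borel_measurable borel" and int: "integrable nu f"
  shows "has_bochner_integral lborel
    (\<lambda>x. indicator {0<..} x * (x powr (- Y - 1) * (C * (exp (- (M * x)) * f x + exp (- (G * x)) * f (- x))))) (\<integral>x. f x \<partial>nu)"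
proof -
  define h where "h x = nu_density x * f x" for x
  have [measurable]: "h \<in> borel_measurable borel" unfolding h_def[abs_def] by measurable
  have h: "integrable lborel h" "(\<integral>x. h x \<partial>lborel) = (\<integral>x. f x \<partial>nu)"
    using int unfolding nu_eq h_def[abs_def] by (auto simp: integrable_density integral_density nu_density_nonneg)
  have i: "integrable lborel (\<lambda>x. indicator {0<..} x * h x)" "integrable lborel (\<lambda>x. indicator {..<0} x * h x)"
    using integrable_mult_indicator[OF _ h(1), of "{0<..}"] integrable_mult_indicator[OF _ h(1), of "{..<0}"] by simp_all
  define I1 where "I1 = (\<integral>x. indicator {0<..} x * h x \<partial>lborel)"
  define I2 where "I2 = (\<integral>x. indicator {..<0} x * h x \<partial>lborel)"
  have "(\<integral>x. h x \<partial>lborel) = (\<integral>x. indicator {0<..} x * h x + indicator {..<0} x * h x \<partial>lborel)"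
    by (intro integral_cong_AE) (use AE_lborel_singleton[of "0::real"] in \<open>auto simp: indicator_def elim!: eventually_mono\<close>)
  then have sum: "I1 + I2 = (\<integral>x. f x \<partial>nu)"
    using i h by (simp add: I1_def I2_def)
  have "has_bochner_integral lborel (\<lambda>x. indicator {..<0} x * h x) I2"
    using i(2) by (simp add: has_bochner_integral_iff I2_def)
  then have "has_bochner_integral lborel (\<lambda>x. indicator {..<0} (0 + (-1) * x) * h (0 + (-1) * x)) (I2 /\<^sub>R \<bar>-1\<bar>)"
    by (subst (asm) lborel_has_bochner_integral_real_affine_iff[where t = 0 and c = "-1"]) auto
  then have r: "has_bochner_integral lborel (\<lambda>x. indicator {..<0} (- x) * h (- x)) I2" by simp
  have "has_bochner_integral lborel (\<lambda>x. indicator {0<..} x * h x) I1"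
    using i(1) by (simp add: has_bochner_integral_iff I1_def)
  from has_bochner_integral_add[OF this r]
  have "has_bochner_integral lborel (\<lambda>x. indicator {0<..} x * h x + indicator {..<0} (- x) * h (- x)) (\<integral>x. f x \<partial>nu)"
    unfolding sum .
  moreover have "indicator {0<..} x * h x + indicator {..<0} (- x) * h (- x)
    = indicator {0<..} x * (x powr (- Y - 1) * (C * (exp (- (M * x)) * f x + exp (- (G * x)) * f (- x))))" for x
    by (auto simp: indicator_def h_def nu_density_def algebra_simps)
  ultimately show ?thesis by (simp only:)
qed

definition jump_exponent :: "complex \<Rightarrow> complex" where
  "jump_exponent z = (\<integral>x. jump_kernel z x \<partial>nu)"

lemma integrable_jump_kernel:
  assumes "0 \<le> Re z" "Re z \<le> 1"
  shows "integrable nu (jump_kernel z)"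
  by (rule integrable_nu[OF _ norm_jump_kernel_le[OF assms order_refl]]) measurable

lemma jump_kernel_local_bound:
  assumes "T \<subseteq> {z. 0 \<le> Re z \<and> Re z \<le> 1}"
  shows "\<exists>r>0. \<exists>B. integrable nu B \<and> (\<forall>w\<in>T. dist w z < r \<longrightarrow> (\<forall>x\<in>space nu. norm (jump_kernel w x) \<le> B x))"
proof (intro exI[of _ 1] conjI exI ballI impI)
  define R where "R = norm z + 1"
  have R: "0 \<le> R" by (simp add: R_def)
  show "integrable nu (\<lambda>x. (exp 1 * (R\<^sup>2 + R) + (2 + R)) * (min 1 (x\<^sup>2) * (1 + exp x)))"
    using R by (intro integrable_nu[where K = "exp 1 * (R\<^sup>2 + R) + (2 + R)"]) (auto simp: abs_mult add_nonneg_nonneg)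
  fix w x assume w: "w \<in> T" "dist w z < 1"
  have "norm w \<le> R"
    using w(2) norm_triangle_ineq2[of w z] by (simp add: R_def dist_norm)
  then show "norm (jump_kernel w x) \<le> (exp 1 * (R\<^sup>2 + R) + (2 + R)) * (min 1 (x\<^sup>2) * (1 + exp x))"
    using w(1) assms by (intro norm_jump_kernel_le) auto
qed auto

lemma jump_exponent_continuous: "continuous_on {z. 0 \<le> Re z \<and> Re z \<le> 1} jump_exponent"
  unfolding jump_exponent_def[abs_def]
proof (rule continuous_on_integral_dominated[OF _ _ jump_kernel_local_bound])
  show "continuous_on {z. 0 \<le> Re z \<and> Re z \<le> 1} (\<lambda>z. jump_kernel z x)" for x
    unfolding jump_kernel_def by (intro continuous_intros)
qed auto

lemma jump_exponent_holomorphic: "jump_exponent holomorphic_on {z. 0 < Re z \<and> Re z < 1}"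
  unfolding jump_exponent_def[abs_def]
proof (rule holomorphic_on_integral_dominated)
  show "open {z. 0 < Re z \<and> Re z < 1}"
    using open_Int[OF open_halfspace_Re_gt[of 0] open_halfspace_Re_lt[of 1]] by (simp add: Collect_conj_eq)
  show "(\<lambda>z. jump_kernel z x) holomorphic_on {z. 0 < Re z \<and> Re z < 1}" for x
    unfolding jump_kernel_def by (intro holomorphic_intros)
  show "\<exists>r>0. \<exists>B. integrable nu B \<and> (\<forall>w\<in>{z. 0 < Re z \<and> Re z < 1}. dist w z < r \<longrightarrow> (\<forall>x\<in>space nu. norm (jump_kernel w x) \<le> B x))" for z
    by (rule jump_kernel_local_bound) auto
qed auto

lemma jump_exponent_1: "jump_exponent 1 = 0"
proof -
  have "jump_kernel 1 x = 0" for x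
    by (simp add: jump_kernel_def exp_of_real)
  then show ?thesis by (simp add: jump_exponent_def)
qed

text \<open>At z = 1/2 + iu the real part of the kernel is - exp (x/2) times (cosh (x/2) - 1) + (1 -
  cos (u x)). Folding both half-lines onto x > 0 turns the prefactor into \<open>tilt\<close>. The
  first summand is half of \<open>(exp (x / 4) - exp (- x / 4))\<^sup>2\<close> and integrates to
  \<open>rho0\<close>; the second gives \<open>C * osc u\<close>.\<close>

lemma Re_jump_exponent: "Re (jump_exponent (1/2 + \<i> * of_real u)) = - rho u"
proof -
  define z where "z = 1/2 + \<i> * of_real u"
  define f where "f x = Re (jump_kernel z x)" for x
  have z: "0 \<le> Re z" "Re z \<le> 1" by (auto simp: z_def)
  have f: "f x = exp (x / 2) * cos (u * x) - 1 - (exp x - 1) / 2" for x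
    by (simp add: f_def jump_kernel_def z_def Re_exp algebra_simps)
  have int: "integrable nu f"
    unfolding f_def[abs_def] by (intro integrable_Re integrable_jump_kernel z)
  have [measurable]: "f \<in> borel_measurable borel" unfolding f_def[abs_def] by measurable
  have "has_bochner_integral lborel (\<lambda>x. indicator {0<..} x * (x powr (- Y - 1) * (C * (exp (- (M * x)) * f x + exp (- (G * x)) * f (- x))))) (\<integral>x. f x \<partial>nu)"
    by (rule has_bochner_integral_nu_half[OF _ int]) measurable
  moreover have "has_bochner_integral lborel (\<lambda>x. - (indicator {0<..} x * (x powr (- Y - 1) * (C / 2 * (tilt x * (exp (x / 4) - exp (- x / 4))\<^sup>2)))
      + C * (indicator {0<..} x * (x powr (- Y - 1) * (tilt x * (1 - cos (u * x))))))) (- (rho0 + C * osc u))"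
    using integrable_osc_kernel[of u]
    by (intro has_bochner_integral_minus has_bochner_integral_add has_bochner_integral_mult_right integral_rho0)
      (simp add: has_bochner_integral_iff osc_def)
  moreover have comb: "exp (- (M * x)) * f x + exp (- (G * x)) * f (- x) = - (tilt x * ((exp (x / 4) - exp (- x / 4))\<^sup>2 / 2 + (1 - cos (u * x))))" for x
  proof -
    define a where "a = exp (- ((M - 1/2) * x))"
    define b where "b = exp (- ((G + 1/2) * x))"
    define s where "s = exp (x / 2)"
    define r where "r = exp (- x / 2)"
    have sr: "s * r = 1" by (simp add: s_def r_def flip: exp_add)
    have eM: "exp (- (M * x)) = a * r" and eG: "exp (- (G * x)) = b * s" and ex: "exp x = s * s" and emx: "exp (- x) = r * r"
      unfolding a_def b_def r_def s_def exp_add[symmetric] by (simp_all add: algebra_simps)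
    have sq: "(exp (x / 4) - exp (- x / 4))\<^sup>2 = s + r - 2"
    proof -
      have "(exp (x / 4) - exp (- x / 4))\<^sup>2 = exp (x / 4) * exp (x / 4) - 2 * (exp (x / 4) * exp (- x / 4)) + exp (- x / 4) * exp (- x / 4)"
        by (simp add: power2_eq_square algebra_simps)
      also have "\<dots> = s + r - 2" by (simp add: s_def r_def flip: exp_add)
      finally show ?thesis .
    qed
    have "a * r * f x = a * (s * r) * cos (u * x) - a * r / 2 - a * s * (s * r) / 2"
      unfolding f ex s_def[symmetric] by (simp add: field_simps)
    moreover have "b * s * f (- x) = b * (s * r) * cos (u * x) - b * s / 2 - b * r * (s * r) / 2"
      unfolding f emx using r_def by (simp add: field_simps)
    ultimately show ?thesis
      unfolding eM eG sq sr tilt_def a_def[symmetric] b_def[symmetric] by (simp add: field_simps)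
  qed
  then have "indicator {0<..} x * (x powr (- Y - 1) * (C * (exp (- (M * x)) * f x + exp (- (G * x)) * f (- x))))
     = - (indicator {0<..} x * (x powr (- Y - 1) * (C / 2 * (tilt x * (exp (x / 4) - exp (- x / 4))\<^sup>2)))
      + C * (indicator {0<..} x * (x powr (- Y - 1) * (tilt x * (1 - cos (u * x))))))" for x
  proof -
    have "i * (p * (C * - (d * (w / 2 + c)))) = - (i * (p * (C / 2 * (d * w))) + C * (i * (p * (d * c))))" for i p d w c
      by (simp add: algebra_simps)
    then show ?thesis unfolding comb .
  qed
  ultimately have "(\<integral>x. f x \<partial>nu) = - (rho0 + C * osc u)"
    using has_bochner_integral_eq by (metis (no_types, lifting) has_bochner_integral_cong)
  then show ?thesis
    unfolding f_def jump_exponent_def z_def[symmetric] rho_def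
    using integral_Re[OF integrable_jump_kernel[OF z]] by simp
qed

definition phase :: "real \<Rightarrow> real" where
  "phase u = Im (jump_exponent (1/2 + \<i> * of_real u))"

lemma phase_measurable [measurable]: "phase \<in> borel_measurable borel"
proof (rule borel_measurable_continuous_onI)
  have "continuous_on UNIV (\<lambda>u. jump_exponent (1/2 + \<i> * of_real u))"
    by (rule continuous_on_compose2[OF jump_exponent_continuous]) (auto intro!: continuous_intros)
  then show "continuous_on UNIV phase"
    unfolding phase_def by (intro continuous_intros)
qed

text \<open>Before folding, the integral of |sin (u x)| against the stable singularity could grow
  like |u|^Y. The sine is odd and the singular factor is the same on both sides, so only differences
  of two exponentials survive; they are O(x) near 0 and buy one more power of x.\<close>

lemma phase_bound: "\<exists>K. \<forall>u. \<bar>phase u\<bar> \<le> K * \<bar>u\<bar>"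
proof (intro exI allI)
  fix u
  define c where "c = \<bar>M - 1 - G\<bar>"
  define J where "J = (\<integral>x. indicator {0<..} x * (x powr (- Y - 1) * min (x\<^sup>2) x) \<partial>lborel)"
  define z where "z = 1/2 + \<i> * of_real u"
  define f where "f x = Im (jump_kernel z x)" for x
  have z: "0 \<le> Re z" "Re z \<le> 1" by (auto simp: z_def)
  have f: "f x = exp (x / 2) * sin (u * x) - u * (exp x - 1)" for x
    by (simp add: f_def jump_kernel_def z_def Im_exp algebra_simps)
  have int: "integrable nu f"
    unfolding f_def[abs_def] by (intro integrable_Im integrable_jump_kernel z)
  have [measurable]: "f \<in> borel_measurable borel" unfolding f_def[abs_def] by measurable
  have i: "has_bochner_integral lborel (\<lambda>x. indicator {0<..} x * (x powr (- Y - 1) * (C * (exp (- (M * x)) * f x + exp (- (G * x)) * f (- x))))) (\<integral>x. f x \<partial>nu)"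
    by (rule has_bochner_integral_nu_half[OF _ int]) measurable
  have b: "\<bar>exp (- (M * x)) * f x + exp (- (G * x)) * f (- x)\<bar> \<le> 2 * (c + 1) * \<bar>u\<bar> * min (x\<^sup>2) x" if x: "x > 0" for x
  proof -
    have "exp (- (M * x)) * exp (x / 2) = exp (- ((M - 1/2) * x))" "exp (- (G * x)) * exp (- x / 2) = exp (- ((G + 1/2) * x))"
      "exp (- (M * x)) * exp x = exp (- ((M - 1) * x))" "exp (- ((M - 1) * x)) * exp (- x) = exp (- (M * x))"
      unfolding exp_add[symmetric] by (simp_all add: algebra_simps)
    \<comment> \<open>In both differences the exponents differ by the same number M - 1 - G, whence
      the constant \<open>c\<close>. Each difference is at most \<open>min (c * x) 1\<close>, while
      the sine and the factor \<open>1 - exp (- x)\<close> contribute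
      \<open>\<bar>u\<bar> * x\<close> and \<open>x\<close>.\<close>
    then have "exp (- (M * x)) * f x + exp (- (G * x)) * f (- x)
        = sin (u * x) * (exp (- ((M - 1/2) * x)) - exp (- ((G + 1/2) * x)))
          - u * ((1 - exp (- x)) * (exp (- ((M - 1) * x)) - exp (- (G * x))))"
      unfolding f by (simp add: algebra_simps)
    also have "\<bar>\<dots>\<bar> \<le> \<bar>sin (u * x)\<bar> * \<bar>exp (- ((M - 1/2) * x)) - exp (- ((G + 1/2) * x))\<bar>
          + \<bar>u\<bar> * (\<bar>1 - exp (- x)\<bar> * \<bar>exp (- ((M - 1) * x)) - exp (- (G * x))\<bar>)"
      unfolding abs_mult[symmetric] by (rule abs_triangle_ineq4)
    also have "\<dots> \<le> \<bar>u\<bar> * x * min (c * x) 1 + \<bar>u\<bar> * (x * min (c * x) 1)"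
    proof (intro add_mono mult_mono mult_left_mono)
      show "\<bar>sin (u * x)\<bar> \<le> \<bar>u\<bar> * x"
        using abs_sin_x_le_abs_x[of "u * x"] x by (simp add: abs_mult)
      have "\<bar>(M - 1/2) * x - (G + 1/2) * x\<bar> = c * x" "\<bar>(M - 1) * x - G * x\<bar> = c * x"
        using x by (simp_all add: c_def left_diff_distrib[symmetric] abs_mult)
      then show "\<bar>exp (- ((M - 1/2) * x)) - exp (- ((G + 1/2) * x))\<bar> \<le> min (c * x) 1"
        "\<bar>exp (- ((M - 1) * x)) - exp (- (G * x))\<bar> \<le> min (c * x) 1"
        using abs_exp_diff_le[of "(M - 1/2) * x" "(G + 1/2) * x"] abs_exp_diff_le[of "(M - 1) * x" "G * x"] M G x by auto
      show "\<bar>1 - exp (- x)\<bar> \<le> x"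
        using exp_ge_add_one_self[of "- x"] x by simp
    qed (use x in \<open>auto simp: c_def\<close>)
    also have "\<dots> = 2 * \<bar>u\<bar> * (x * min (c * x) 1)" by simp
    also have "\<dots> \<le> 2 * \<bar>u\<bar> * ((c + 1) * min (x\<^sup>2) x)"
    proof (intro mult_left_mono)
      have c0: "0 \<le> c" by (simp add: c_def)
      have "x * min (c * x) 1 \<le> (c + 1) * x\<^sup>2"
      proof -
        have "x * min (c * x) 1 \<le> x * ((c + 1) * x)" using x c0
          by (intro mult_left_mono order_trans[OF min.cobounded1]) (auto simp: distrib_right)
        then show ?thesis by (simp add: power2_eq_square mult_ac)
      qed
      moreover have "x * min (c * x) 1 \<le> (c + 1) * x"
      proof -
        have "x * min (c * x) 1 \<le> x * (c + 1)" using x c0 by (intro mult_left_mono) auto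
        then show ?thesis by (simp add: mult_ac)
      qed
      ultimately show "x * min (c * x) 1 \<le> (c + 1) * min (x\<^sup>2) x" by (simp add: min_def)
    qed auto
    also have "\<dots> = 2 * (c + 1) * \<bar>u\<bar> * min (x\<^sup>2) x" by (simp only: mult_ac)
    finally show ?thesis .
  qed
  have "norm (\<integral>x. indicator {0<..} x * (x powr (- Y - 1) * (C * (exp (- (M * x)) * f x + exp (- (G * x)) * f (- x)))) \<partial>lborel)
      \<le> (\<integral>x. C * 2 * (c + 1) * \<bar>u\<bar> * (indicator {0<..} x * (x powr (- Y - 1) * min (x\<^sup>2) x)) \<partial>lborel)"
  proof (rule Bochner_Integration.integral_norm_bound_integral)
    show "integrable lborel (\<lambda>x. C * 2 * (c + 1) * \<bar>u\<bar> * (indicator {0<..} x * (x powr (- Y - 1) * min (x\<^sup>2) x)))"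
      by (intro integrable_mult_right integrable_stable_min)
    show "integrable lborel (\<lambda>x. indicator {0<..} x * (x powr (- Y - 1) * (C * (exp (- (M * x)) * f x + exp (- (G * x)) * f (- x)))))"
      using i by (simp add: has_bochner_integral_iff)
    show "norm (indicator {0<..} x * (x powr (- Y - 1) * (C * (exp (- (M * x)) * f x + exp (- (G * x)) * f (- x)))))
       \<le> C * 2 * (c + 1) * \<bar>u\<bar> * (indicator {0<..} x * (x powr (- Y - 1) * min (x\<^sup>2) x))" for x
    proof (cases "x > 0")
      case True
      have "x powr (- Y - 1) * C * \<bar>exp (- (M * x)) * f x + exp (- (G * x)) * f (- x)\<bar> \<le> x powr (- Y - 1) * C * (2 * (c + 1) * \<bar>u\<bar> * min (x\<^sup>2) x)"
        using C by (intro mult_left_mono b True) auto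
      then show ?thesis using True C by (simp add: abs_mult mult_ac)
    qed simp
  qed
  then have "\<bar>\<integral>x. f x \<partial>nu\<bar> \<le> (\<integral>x. C * 2 * (c + 1) * \<bar>u\<bar> * (indicator {0<..} x * (x powr (- Y - 1) * min (x\<^sup>2) x)) \<partial>lborel)"
    unfolding has_bochner_integral_integral_eq[OF i] real_norm_def .
  also have "\<dots> = C * 2 * (c + 1) * \<bar>u\<bar> * J" by (simp add: J_def)
  finally have "\<bar>\<integral>x. f x \<partial>nu\<bar> \<le> C * 2 * (c + 1) * J * \<bar>u\<bar>" by (simp add: mult_ac)
  then show "\<bar>phase u\<bar> \<le> C * 2 * (\<bar>M - 1 - G\<bar> + 1) * (\<integral>x. indicator {0<..} x * (x powr (- Y - 1) * min (x\<^sup>2) x) \<partial>lborel) * \<bar>u\<bar>"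
    unfolding phase_def jump_exponent_def z_def[symmetric] c_def J_def f_def
    using integral_Im[OF integrable_jump_kernel[OF z]] by simp
qed

lemma integrable_levy_kernel:
  "integrable nu (\<lambda>x. iexp (u * x) - 1 - \<i> * of_real (u * x * indicator {-1..1} x))"
proof (rule integrable_nu[where K = "u\<^sup>2 / 2 + 2"])
  fix x :: real
  show "norm (iexp (u * x) - 1 - \<i> * of_real (u * x * indicator {-1..1} x)) \<le> (u\<^sup>2 / 2 + 2) * (min 1 (x\<^sup>2) * (1 + exp x))"
    (is "?l \<le> _")
  proof -
    have "?l \<le> (u\<^sup>2 / 2 + 2) * min 1 (x\<^sup>2)"
    proof (cases "\<bar>x\<bar> \<le> 1")
      case True
      then have x2: "x\<^sup>2 \<le> 1" by (simp add: abs_square_le_1)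
      have "?l \<le> (u * x)\<^sup>2 / 2"
        using iexp_approx1[of "u * x" 1] True by (simp add: abs_le_iff diff_diff_eq power2_eq_square abs_mult[symmetric])
      also have "\<dots> \<le> (u\<^sup>2 / 2 + 2) * x\<^sup>2" by (simp add: power_mult_distrib distrib_right)
      finally show ?thesis using x2 by (simp add: min_def)
    next
      case False
      then have x2: "1 \<le> x\<^sup>2" using one_le_power[of "\<bar>x\<bar>" 2] by simp
      have "?l = norm (iexp (u * x) - 1)" using False by (auto simp: indicator_def abs_le_iff)
      also have "\<dots> \<le> norm (iexp (u * x)) + norm (1::complex)" by (rule norm_triangle_ineq4)
      also have "\<dots> = 2" by simp
      also have "\<dots> \<le> (u\<^sup>2 / 2 + 2) * min 1 (x\<^sup>2)" using x2 by (simp add: min_absorb1)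
      finally show ?thesis .
    qed
    also have "\<dots> \<le> (u\<^sup>2 / 2 + 2) * min 1 (x\<^sup>2) * (1 + exp x)"
      using mult_left_mono[of 1 "1 + exp x" "(u\<^sup>2 / 2 + 2) * min 1 (x\<^sup>2)"] by (simp add: add_nonneg_nonneg)
    finally show ?thesis by (simp add: mult.assoc)
  qed
qed measurable

text \<open>Replacing the truncation \<open>x * indicator {-1..1} x\<close> by
  \<open>exp x - 1\<close> changes the integrand by a multiple of u that is integrable against
  \<open>nu\<close>, thanks to M > 1 at infinity. The effect is a shift of the drift by a real
  constant.\<close>

lemma levy_exponent_nu:
  "\<exists>b'. \<forall>u. levy_exponent b 0 nu u = \<i> * of_real (b' * u) + jump_exponent (\<i> * of_real u)"
proof -
  define f where "f x = exp x - 1 - x * indicator {-1..1} x" for x :: real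
  have f: "integrable nu f"
  proof (rule integrable_nu[where K = "exp 1 + 1"])
    fix x :: real
    show "norm (f x) \<le> (exp 1 + 1) * (min 1 (x\<^sup>2) * (1 + exp x))"
    proof (cases "\<bar>x\<bar> \<le> 1")
      case True
      then have x2: "x\<^sup>2 \<le> 1" by (simp add: abs_square_le_1)
      have "norm (exp (1 * complex_of_real x) - 1 - 1 * of_real x) \<le> exp 1 * 1\<^sup>2 * x\<^sup>2"
        by (rule norm_exp_minus_one_minus_le) (use True in auto)
      moreover have "exp (1 * complex_of_real x) - 1 - 1 * of_real x = complex_of_real (exp x - 1 - x)"
        by (simp add: exp_of_real)
      ultimately have "\<bar>exp x - 1 - x\<bar> \<le> exp 1 * x\<^sup>2"
        by (simp only: norm_of_real) simp
      moreover have "f x = exp x - 1 - x" using True by (auto simp: f_def indicator_def)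
      ultimately have "norm (f x) \<le> exp 1 * (x\<^sup>2 * 1)" by simp
      also have "\<dots> \<le> (exp 1 + 1) * (min 1 (x\<^sup>2) * (1 + exp x))"
        using x2 by (intro mult_mono) (auto simp: min_def)
      finally show ?thesis .
    next
      case False
      then have x2: "1 \<le> x\<^sup>2" using one_le_power[of "\<bar>x\<bar>" 2] by simp
      have "norm (f x) \<le> 1 * (1 + exp x)" using False by (auto simp: f_def indicator_def abs_le_iff add.commute)
      also have "\<dots> \<le> (exp 1 + 1) * (1 + exp x)" by (intro mult_right_mono) (auto simp: add_nonneg_nonneg)
      finally show ?thesis using x2 by (simp add: min_def)
    qed
  qed (simp add: f_def[abs_def])
  define d where "d = (\<integral>x. f x \<partial>nu)"
  have "levy_exponent b 0 nu u = \<i> * of_real ((b + d) * u) + jump_exponent (\<i> * of_real u)" for u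
  proof -
    have "jump_kernel (\<i> * of_real u) x = (iexp (u * x) - 1 - \<i> * of_real (u * x * indicator {-1..1} x)) - \<i> * of_real u * of_real (f x)" for x
      by (simp add: jump_kernel_def f_def algebra_simps)
    then have eq: "jump_kernel (\<i> * of_real u) = (\<lambda>x. (iexp (u * x) - 1 - \<i> * of_real (u * x * indicator {-1..1} x)) - \<i> * of_real u * of_real (f x))"
      by (intro ext)
    have "jump_exponent (\<i> * of_real u) = (\<integral>x. (iexp (u * x) - 1 - \<i> * of_real (u * x * indicator {-1..1} x)) \<partial>nu) - (\<integral>x. \<i> * of_real u * of_real (f x) \<partial>nu)"
      unfolding jump_exponent_def eq using integrable_levy_kernel[of u] f
      by (intro Bochner_Integration.integral_diff integrable_mult_right integrable_of_real)
    also have "(\<integral>x. \<i> * of_real u * of_real (f x) \<partial>nu) = \<i> * of_real u * of_real d"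
      by (simp only: integral_mult_right_zero integral_complex_of_real d_def)
    finally show ?thesis
      by (simp add: levy_exponent_def algebra_simps)
  qed
  then show ?thesis by blast
qed

text \<open>This is the exponent of L_t / sqrt t, and the limit expresses that L has no Gaussian
  part. For small jumps the factor t cancels the t^(-1) of the squared argument, leaving the t-free
  domination u^2 x^2 / 2; for fixed x the integrand is O(t) + O(sqrt t).\<close>

lemma levy_exponent_scaled_tendsto:
  "((\<lambda>t. of_real t * levy_exponent b 0 nu (u / sqrt t)) \<longlongrightarrow> 0) (at_right 0)"
proof -
  define k where "k t x = of_real t * (iexp (u / sqrt t * x) - 1 - \<i> * of_real (u / sqrt t * x * indicator {-1..1} x))" for t x :: real
  have "((\<lambda>t. \<integral>x. k t x \<partial>nu) \<longlongrightarrow> (\<integral>x. (\<lambda>_::real. 0::complex) x \<partial>nu)) (at_right 0)"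
  proof (rule dominated_convergence_at_right_0)
    show "integrable nu (\<lambda>x. (u\<^sup>2 / 2 + 2) * min 1 (x\<^sup>2))"
    proof (rule integrable_nu[where K = "u\<^sup>2 / 2 + 2"])
      show "norm ((u\<^sup>2 / 2 + 2) * min 1 (x\<^sup>2)) \<le> (u\<^sup>2 / 2 + 2) * (min 1 (x\<^sup>2) * (1 + exp x))" for x
        using mult_left_mono[of 1 "1 + exp x" "(u\<^sup>2 / 2 + 2) * min 1 (x\<^sup>2)"] by (simp add: add_nonneg_nonneg abs_mult mult.assoc)
    qed measurable
    show "k t \<in> borel_measurable nu" for t
      unfolding k_def[abs_def] by measurable
    show "AE x in nu. ((\<lambda>t. k t x) \<longlongrightarrow> 0) (at_right 0)"
    proof (rule AE_I2)
      fix x :: real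
      show "((\<lambda>t. k t x) \<longlongrightarrow> 0) (at_right 0)"
      proof (rule Lim_null_comparison)
        show "\<forall>\<^sub>F t in at_right 0. norm (k t x) \<le> t * 2 + sqrt t * \<bar>u * x\<bar>"
          using eventually_at_right_less[of 0]
        proof eventually_elim
          fix t :: real assume t: "0 < t"
          have tri: "norm (a - 1 - b) \<le> norm a + 1 + norm b" for a b :: complex
            using norm_triangle_ineq4[of "a - 1" b] norm_triangle_ineq4[of a 1] by simp
          have "norm (iexp (u / sqrt t * x)) = 1"
            by (rule norm_exp_i_times)
          moreover have "norm (\<i> * complex_of_real (u / sqrt t * x * indicator {-1..1} x)) \<le> \<bar>u * x\<bar> / sqrt t"
            unfolding norm_mult[of \<i>] norm_of_real using t by (auto simp: abs_mult indicator_def)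
          ultimately have "norm (iexp (u / sqrt t * x) - 1 - \<i> * of_real (u / sqrt t * x * indicator {-1..1} x)) \<le> 2 + \<bar>u * x\<bar> / sqrt t"
            using tri[of "iexp (u / sqrt t * x)" "\<i> * of_real (u / sqrt t * x * indicator {-1..1} x)"] by linarith
          then have "norm (k t x) \<le> t * (2 + \<bar>u * x\<bar> / sqrt t)"
            unfolding k_def norm_mult[of "of_real t"] norm_of_real abs_of_pos[OF t] using t
            by (intro mult_left_mono) auto
          also have "\<dots> = t * 2 + t / sqrt t * \<bar>u * x\<bar>" by (simp add: distrib_left)
          also have "t / sqrt t = sqrt t" using t by (simp add: real_div_sqrt)
          finally show "norm (k t x) \<le> t * 2 + sqrt t * \<bar>u * x\<bar>" .
        qed
        have "((\<lambda>t. t * 2 + sqrt t * c) \<longlongrightarrow> 0) (at_right 0)" for c :: real by real_asymp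
        then show "((\<lambda>t. t * 2 + sqrt t * \<bar>u * x\<bar>) \<longlongrightarrow> 0) (at_right 0)" .
      qed
    qed
    show "AE x in nu. norm (k t x) \<le> (u\<^sup>2 / 2 + 2) * min 1 (x\<^sup>2)" if t: "0 < t" "t \<le> 1" for t
    proof (rule AE_I2)
      fix x :: real
      show "norm (k t x) \<le> (u\<^sup>2 / 2 + 2) * min 1 (x\<^sup>2)"
      proof (cases "\<bar>x\<bar> \<le> 1")
        case True
        then have x2: "x\<^sup>2 \<le> 1" by (simp add: abs_square_le_1)
        have "norm (iexp (u / sqrt t * x) - 1 - \<i> * of_real (u / sqrt t * x * indicator {-1..1} x)) \<le> (u / sqrt t * x)\<^sup>2 / 2"
          using iexp_approx1[of "u / sqrt t * x" 1] True by (simp add: abs_le_iff diff_diff_eq power2_eq_square abs_mult[symmetric])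
        then have "norm (k t x) \<le> t * ((u / sqrt t * x)\<^sup>2 / 2)"
          unfolding k_def norm_mult norm_of_real abs_of_pos[OF t(1)] using t by (intro mult_left_mono) auto
        also have "\<dots> = u\<^sup>2 / 2 * x\<^sup>2" using t by (simp add: power_mult_distrib power_divide)
        also have "\<dots> \<le> (u\<^sup>2 / 2 + 2) * x\<^sup>2" by (intro mult_right_mono) auto
        finally show ?thesis using x2 by (simp add: min_def)
      next
        case False
        then have x2: "1 \<le> x\<^sup>2" using one_le_power[of "\<bar>x\<bar>" 2] by simp
        have "norm (k t x) = t * norm (iexp (u / sqrt t * x) - 1)"
          unfolding k_def norm_mult norm_of_real abs_of_pos[OF t(1)] using False by (auto simp: indicator_def abs_le_iff)
        also have "\<dots> \<le> 1 * (norm (iexp (u / sqrt t * x)) + norm (1::complex))"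
          using t by (intro mult_mono norm_triangle_ineq4) auto
        also have "\<dots> = 2" by simp
        also have "\<dots> \<le> (u\<^sup>2 / 2 + 2) * min 1 (x\<^sup>2)" using x2 by (simp add: min_absorb1)
        finally show ?thesis .
      qed
    qed
  qed auto
  then have k0: "((\<lambda>t. \<integral>x. k t x \<partial>nu) \<longlongrightarrow> 0) (at_right 0)" by simp
  have "((\<lambda>t. sqrt t * c) \<longlongrightarrow> 0) (at_right 0)" for c :: real by real_asymp
  then have "((\<lambda>t. complex_of_real (sqrt t * (b * u))) \<longlongrightarrow> of_real 0) (at_right 0)"
    by (rule tendsto_of_real)
  from tendsto_add[OF tendsto_mult_right_zero[of _ _ \<i>] k0, OF this[unfolded of_real_0]]
  have "((\<lambda>t. \<i> * complex_of_real (sqrt t * (b * u)) + (\<integral>x. k t x \<partial>nu)) \<longlongrightarrow> 0) (at_right 0)"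
    by simp
  then show ?thesis
  proof (rule Lim_transform_eventually)
    show "\<forall>\<^sub>F t in at_right 0. \<i> * complex_of_real (sqrt t * (b * u)) + (\<integral>x. k t x \<partial>nu) = of_real t * levy_exponent b 0 nu (u / sqrt t)"
      using eventually_at_right_less[of 0]
    proof eventually_elim
      fix t :: real assume t: "0 < t"
      have "t * (b * (u / sqrt t)) = sqrt t * (b * u)"
        using t real_div_sqrt[of t] by (simp add: field_simps)
      then have e1: "complex_of_real t * of_real (b * (u / sqrt t)) = of_real (sqrt t * (b * u))"
        by (simp only: of_real_mult[symmetric])
      have e2: "(\<integral>x. k t x \<partial>nu) = of_real t * (\<integral>x. (iexp (u / sqrt t * x) - 1 - \<i> * of_real (u / sqrt t * x * indicator {-1..1} x)) \<partial>nu)"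
        unfolding k_def by (rule integral_mult_right_zero)
      have e3: "levy_exponent b 0 nu v = \<i> * of_real (b * v) + (\<integral>x. (iexp (v * x) - 1 - \<i> * of_real (v * x * indicator {-1..1} x)) \<partial>nu)" for v
        by (simp add: levy_exponent_def)
      show "\<i> * complex_of_real (sqrt t * (b * u)) + (\<integral>x. k t x \<partial>nu) = of_real t * levy_exponent b 0 nu (u / sqrt t)"
        unfolding e3 e2 distrib_left mult.left_commute[of "of_real t" \<i>] e1 ..
    qed
  qed
qed

end

section \<open>Perturbation of the log-strike\<close>

lemma norm_integral_le:
  fixes f :: "'a \<Rightarrow> 'b::{banach, second_countable_topology}"
  assumes "integrable M f" "integrable M g" "\<And>x. x \<in> space M \<Longrightarrow> norm (f x) \<le> g x"
  shows "norm (\<integral>x. f x \<partial>M) \<le> (\<integral>x. g x \<partial>M)"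
proof -
  have "norm (\<integral>x. f x \<partial>M) \<le> (\<integral>x. norm (f x) \<partial>M)"
    by (rule integral_norm_bound)
  also have "\<dots> \<le> (\<integral>x. g x \<partial>M)"
    using assms by (intro integral_mono) auto
  finally show ?thesis .
qed

text \<open>The function (e^y - 1)^+ - y^+ is continuously differentiable with nondecreasing
  derivative (e^y - 1)^+. Its increment is therefore second order when the call price is small, and
  the first-order effect of a shift is that of y^+ alone.\<close>

lemma call_minus_forward_le:
  fixes a b :: real
  assumes "a \<le> b"
  shows "0 \<le> (max 0 (exp b - 1) - max 0 b) - (max 0 (exp a - 1) - max 0 a)"
    and "(max 0 (exp b - 1) - max 0 b) - (max 0 (exp a - 1) - max 0 a) \<le> (b - a) * max 0 (exp b - 1)"
proof -
  define p where "p y = (if 0 < y then exp y - 1 - y else 0)" for y :: real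
  have p: "max 0 (exp y - 1) - max 0 y = p y" for y :: real
    by (auto simp: p_def max_def)
  have inc: "exp a * (1 + (b - a)) \<le> exp b"
  proof -
    have "exp a * (1 + (b - a)) \<le> exp a * exp (b - a)"
      by (intro mult_left_mono exp_ge_add_one_self) auto
    then show ?thesis by (simp flip: exp_add)
  qed
  have dec: "exp b * (1 - (b - a)) \<le> exp a"
  proof -
    have "exp b * (1 + (a - b)) \<le> exp b * exp (a - b)"
      by (intro mult_left_mono exp_ge_add_one_self) auto
    then have "exp b * (1 + (a - b)) \<le> exp a" by (simp flip: exp_add)
    moreover have "1 + (a - b) = 1 - (b - a)" by simp
    ultimately show ?thesis by (simp only:)
  qed
  have pos: "0 \<le> p y" for y
  proof -
    have "0 \<le> exp y - 1 - y" using exp_ge_add_one_self[of y] by linarith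
    then show ?thesis unfolding p_def by auto
  qed
  consider "b \<le> 0" | "a \<le> 0" "0 < b" | "0 < a" by linarith
  then have "0 \<le> p b - p a \<and> p b - p a \<le> (b - a) * max 0 (exp b - 1)"
  proof cases
    case 1
    then show ?thesis using assms by (simp add: p_def)
  next
    case 2
    have "exp b * (1 + (0 - b)) \<le> exp b * exp (0 - b)"
      by (intro mult_left_mono exp_ge_add_one_self) auto
    then have "exp b - 1 - b \<le> b * (exp b - 1)"
      by (simp add: algebra_simps flip: exp_add)
    also have "\<dots> \<le> (b - a) * (exp b - 1)"
      using 2 by (intro mult_right_mono) auto
    finally show ?thesis
      using 2 pos[of b] by (simp add: p_def)
  next
    case 3
    have "b - a \<le> exp a * (b - a)"
      using 3 assms mult_right_mono[of 1 "exp a" "b - a"] by simp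
    then have "0 \<le> p b - p a"
      using inc 3 assms by (simp add: p_def algebra_simps)
    moreover have "p b - p a \<le> (b - a) * max 0 (exp b - 1)"
      using dec 3 assms by (simp add: p_def algebra_simps)
    ultimately show ?thesis by simp
  qed
  then show "0 \<le> (max 0 (exp b - 1) - max 0 b) - (max 0 (exp a - 1) - max 0 a)"
    and "(max 0 (exp b - 1) - max 0 b) - (max 0 (exp a - 1) - max 0 a) \<le> (b - a) * max 0 (exp b - 1)"
    unfolding p by auto
qed

text \<open>The length of the set of w in (0,1) with \<open>k * w \<le> z\<close>. The formula holds
  for both signs of k, as the log-strike may approach 0 from either side; the cases are whether z /
  k falls before, inside or after the interval.\<close>

lemma integral_indicator_ray:
  fixes k z :: real
  assumes "k \<noteq> 0"
  shows "has_bochner_integral lborel (\<lambda>w. indicator {0<..<1} w * (if k * w \<le> z then 1 else 0)) ((max 0 z - max 0 (z - k)) / k)"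
proof -
  have *: "has_bochner_integral lborel (\<lambda>w. indicator {0<..<1} w * (if k * w \<le> z then 1 else 0)) c"
    if A: "\<And>w. w \<noteq> 0 \<Longrightarrow> w \<noteq> 1 \<Longrightarrow> (0 < w \<and> w < 1 \<and> k * w \<le> z) = (w \<in> {a..b})" and "a \<le> b" "c = b - a" for a b c
  proof -
    have "has_bochner_integral lborel (indicator {a..b}) (measure lborel {a..b})"
      by (rule has_bochner_integral_real_indicator) (auto simp: emeasure_lborel_Icc_eq)
    then have "has_bochner_integral lborel (\<lambda>w. indicator {a..b} w) c"
      using that by simp
    moreover have "AE w in lborel. indicator {0<..<1} w * (if k * w \<le> z then 1 else 0) = (indicator {a..b} w :: real)"
      using AE_lborel_singleton[of "0::real"] AE_lborel_singleton[of "1::real"]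
      by eventually_elim (use A in \<open>auto simp: indicator_def\<close>)
    ultimately show ?thesis
      by (subst has_bochner_integral_cong_AE[where g = "indicator {a..b}"]) auto
  qed
  have e: "has_bochner_integral lborel (\<lambda>w. indicator {0<..<1} w * (if k * w \<le> z then 1 else 0)) (0::real)"
    if "\<And>w. 0 < w \<Longrightarrow> w < 1 \<Longrightarrow> \<not> k * w \<le> z"
  proof -
    have eq: "indicator {0<..<1} w * (if k * w \<le> z then 1 else 0) = (0::real)" for w
      using that[of w] by (auto simp: indicator_def)
    show ?thesis unfolding eq by (rule has_bochner_integral_zero)
  qed
  consider "k > 0" "z \<le> 0" | "k > 0" "0 < z" "z < k" | "k > 0" "k \<le> z"
    | "k < 0" "0 \<le> z" | "k < 0" "k < z" "z < 0" | "k < 0" "z \<le> k"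
    using assms by linarith
  then show ?thesis
  proof cases
    case 1
    then have "\<not> k * w \<le> z" if "0 < w" for w using that mult_pos_pos[of k w] by linarith
    moreover have "(max 0 z - max 0 (z - k)) / k = 0" using 1 by (auto simp: max_def)
    ultimately show ?thesis using e by (simp only: not_False_eq_True)
  next
    case 2
    have w1: "w < 1" if "k * w \<le> z" for w
    proof (rule ccontr)
      assume "\<not> w < 1"
      then have "k * 1 \<le> k * w" using 2 by (intro mult_left_mono) auto
      with that 2 show False by linarith
    qed
    have "(k * w \<le> z) = (w \<le> z / k)" for w using 2 by (simp add: le_divide_eq mult.commute)
    with w1 2 show ?thesis by (intro *[where a = 0 and b = "z / k"]) (auto simp: max_def)
  next
    case 3
    have "k * w \<le> z" if "w < 1" for w
      using that 3 mult_left_mono[of w 1 k] by linarith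
    then show ?thesis using 3 by (intro *[where a = 0 and b = 1]) (auto simp: max_def)
  next
    case 4
    have "k * w \<le> z" if "0 < w" for w
      using that 4 mult_neg_pos[of k w] by linarith
    then show ?thesis using 4 by (intro *[where a = 0 and b = 1]) (auto simp: max_def)
  next
    case 5
    then have zk: "0 < z / k" "z / k < 1" by (auto simp: field_simps)
    have "(k * w \<le> z) = (z / k \<le> w)" for w using 5 by (simp add: divide_le_eq mult.commute)
    moreover have "0 < w" if "k * w \<le> z" for w
    proof (rule ccontr)
      assume "\<not> 0 < w"
      then have "0 \<le> k * w" using 5 by (intro mult_nonpos_nonpos) auto
      with that 5 show False by linarith
    qed
    ultimately show ?thesis using 5 zk
      by (intro *[where a = "z / k" and b = 1]) (auto simp: max_def diff_divide_distrib)
  next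
    case 6
    have "\<not> k * w \<le> z" if "w < 1" for w
    proof -
      have "k * 1 < k * w" using that 6 by (intro mult_strict_left_mono_neg) auto
      then show ?thesis using 6 by linarith
    qed
    moreover have "(max 0 z - max 0 (z - k)) / k = 0" using 6 by (auto simp: max_def)
    ultimately show ?thesis using e by (simp only: not_False_eq_True)
  qed
qed

section \<open>Comparing tail probabilities and call prices\<close>

context prob_space
begin

text \<open>Multiplied by k, the averaged tail probability is the expected decrement of y^+ under a
  shift by k. This explains the shape of \<open>c_kappa\<close>.\<close>

lemma integral_tail_scaled:
  fixes Z :: "'a \<Rightarrow> real"
  assumes [measurable]: "Z \<in> borel_measurable M" and "k \<noteq> 0"
  shows "has_bochner_integral lborel (\<lambda>w. indicator {0<..<1} w * prob {\<omega> \<in> space M. k * w \<le> Z \<omega>})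
     (expectation (\<lambda>\<omega>. (max 0 (Z \<omega>) - max 0 (Z \<omega> - k)) / k))"
proof (rule tonelli_has_bochner_integral[where ?M1.0 = M and f = "\<lambda>\<omega> w. indicator {0<..<1} w * (if k * w \<le> Z \<omega> then 1 else 0)"
      and g = "\<lambda>\<omega>. (max 0 (Z \<omega>) - max 0 (Z \<omega> - k)) / k"])
  show "pair_sigma_finite M (lborel :: real measure)"
    by (intro pair_sigma_finite.intro sigma_finite_measure_axioms lborel.sigma_finite_measure_axioms)
  show "(\<lambda>(\<omega>, w::real). indicator {0<..<1} w * (if k * w \<le> Z \<omega> then 1 else 0) :: real) \<in> borel_measurable (M \<Otimes>\<^sub>M lborel)"
    by measurable
  show "AE \<omega> in M. has_bochner_integral lborel (\<lambda>w. indicator {0<..<1} w * (if k * w \<le> Z \<omega> then 1 else 0)) ((max 0 (Z \<omega>) - max 0 (Z \<omega> - k)) / k)"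
    by (intro AE_I2 integral_indicator_ray assms)
  have "\<bar>max 0 z - max 0 (z - k)\<bar> \<le> \<bar>k\<bar>" for z by (auto simp: max_def)
  then have "integrable M (\<lambda>\<omega>. (max 0 (Z \<omega>) - max 0 (Z \<omega> - k)) / k)"
    using assms by (intro integrable_const_bound[of _ 1]) (auto simp: abs_divide)
  then show "has_bochner_integral M (\<lambda>\<omega>. (max 0 (Z \<omega>) - max 0 (Z \<omega> - k)) / k) (expectation (\<lambda>\<omega>. (max 0 (Z \<omega>) - max 0 (Z \<omega> - k)) / k))"
    by (rule has_bochner_integral_integrable)
  have m: "has_bochner_integral M (\<lambda>\<omega>. if k * w \<le> Z \<omega> then 1 else 0) (prob {\<omega> \<in> space M. k * w \<le> Z \<omega>})" for w
  proof -
    have "has_bochner_integral M (indicator {\<omega> \<in> space M. k * w \<le> Z \<omega>}) (prob {\<omega> \<in> space M. k * w \<le> Z \<omega>})"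
      by (rule has_bochner_integral_real_indicator) (auto simp: less_top[symmetric])
    then show ?thesis
      by (rule has_bochner_integral_cong[THEN iffD1, rotated 3]) (auto simp: indicator_def)
  qed
  then show "AE w in lborel. has_bochner_integral M (\<lambda>\<omega>. indicator {0<..<1} w * (if k * w \<le> Z \<omega> then 1 else 0))
     (indicator {0<..<1} w * prob {\<omega> \<in> space M. k * w \<le> Z \<omega>})"
    by (intro AE_I2 has_bochner_integral_mult_right) auto
  have "(\<lambda>w. prob {\<omega> \<in> space M. k * w \<le> Z \<omega>}) = (\<lambda>w. expectation (\<lambda>\<omega>. if k * w \<le> Z \<omega> then 1 else 0))"
    using m by (auto simp: has_bochner_integral_iff)
  also have "\<dots> \<in> borel_measurable borel" by measurable
  finally show "(\<lambda>w. indicator {0<..<1} w * prob {\<omega> \<in> space M. k * w \<le> Z \<omega>}) \<in> borel_measurable lborel"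
    by measurable
qed (auto simp: indicator_def)

text \<open>Two errors of size |k| times something small: the convexity error of the payoff,
  controlled by a call expectation, and the error d of replacing the tails of X by those of
  V.\<close>

lemma call_shift_bound:
  fixes X V :: "'a \<Rightarrow> real"
  assumes X [measurable]: "X \<in> borel_measurable M" and V [measurable]: "V \<in> borel_measurable M"
    and intX: "integrable M (\<lambda>\<omega>. exp (X \<omega>))"
    and close: "\<And>c. \<bar>prob {\<omega> \<in> space M. c \<le> X \<omega>} - prob {\<omega> \<in> space M. c \<le> V \<omega>}\<bar> \<le> d"
  shows "\<bar>expectation (\<lambda>\<omega>. max 0 (exp (X \<omega> - k) - 1)) - expectation (\<lambda>\<omega>. max 0 (exp (X \<omega>) - 1))
     + k * (\<integral>w. indicator {0<..<1} w * prob {\<omega> \<in> space M. k * w \<le> V \<omega>} \<partial>lborel)\<bar>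
     \<le> \<bar>k\<bar> * (d + exp \<bar>k\<bar> * (expectation (\<lambda>\<omega>. max 0 (exp (X \<omega>) - 1)) + (1 - exp (- \<bar>k\<bar>))))"
proof (cases "k = 0")
  case False
  define e where "e = exp \<bar>k\<bar> * (expectation (\<lambda>\<omega>. max 0 (exp (X \<omega>) - 1)) + (1 - exp (- \<bar>k\<bar>)))"
  define T where "T Z = (\<integral>w. indicator {0<..<1} w * prob {\<omega> \<in> space M. k * w \<le> Z \<omega>} \<partial>lborel)" for Z :: "'a \<Rightarrow> real"
  have intc: "integrable M (\<lambda>\<omega>. max 0 (exp (X \<omega> - c) - 1))" for c
  proof (rule Bochner_Integration.integrable_bound)
    show "integrable M (\<lambda>\<omega>. exp (- c) * exp (X \<omega>))" using intX by simp
    show "AE \<omega> in M. norm (max 0 (exp (X \<omega> - c) - 1)) \<le> norm (exp (- c) * exp (X \<omega>))"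
      by (intro AE_I2) (auto simp: exp_diff exp_minus field_simps)
  qed measurable
  have T: "has_bochner_integral lborel (\<lambda>w. indicator {0<..<1} w * prob {\<omega> \<in> space M. k * w \<le> Z \<omega>}) (T Z)"
    and TE: "k * T Z = expectation (\<lambda>\<omega>. max 0 (Z \<omega>) - max 0 (Z \<omega> - k))"
    if [measurable]: "Z \<in> borel_measurable M" for Z
    using integral_tail_scaled[of Z k] False by (auto simp: T_def has_bochner_integral_iff)
  have intd: "integrable lborel (\<lambda>w::real. indicator {0<..<1} w * d)"
    by (intro integrable_mult_left integrable_real_indicator) auto
  have "norm (\<integral>w. indicator {0<..<1} w * prob {\<omega> \<in> space M. k * w \<le> V \<omega>} - indicator {0<..<1} w * prob {\<omega> \<in> space M. k * w \<le> X \<omega>} \<partial>lborel)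
     \<le> (\<integral>w. indicator {0<..<1::real} w * d \<partial>lborel)"
  proof (rule norm_integral_le[OF _ intd])
    show "norm (indicator {0<..<1} w * prob {\<omega> \<in> space M. k * w \<le> V \<omega>} - indicator {0<..<1} w * prob {\<omega> \<in> space M. k * w \<le> X \<omega>}) \<le> indicator {0<..<1} w * d" for w
      using close[of "k * w"] by (auto simp: indicator_def abs_minus_commute)
  qed (use T[OF V] T[OF X] in \<open>auto simp: has_bochner_integral_iff\<close>)
  then have TVX: "\<bar>T V - T X\<bar> \<le> d"
    using T[OF V] T[OF X] by (simp add: has_bochner_integral_iff)
  \<comment> \<open>\<open>D\<close> is, up to sign, the increment of (e^y - 1)^+ - y^+ between X
    and X - k. Both points are at most X + |k|, so one bound covers both signs of k.\<close>
  define D where "D \<omega> = max 0 (exp (X \<omega> - k) - 1) - max 0 (exp (X \<omega>) - 1) + (max 0 (X \<omega>) - max 0 (X \<omega> - k))" for \<omega>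
  have intm: "integrable M (\<lambda>\<omega>. max 0 (X \<omega>) - max 0 (X \<omega> - k))"
    by (rule integrable_const_bound[of _ "\<bar>k\<bar>"]) (auto simp: max_def)
  have intD: "integrable M D"
    unfolding D_def[abs_def] using intc[of k] intc[of 0] intm by simp
  have Dle: "\<bar>D \<omega>\<bar> \<le> \<bar>k\<bar> * max 0 (exp (X \<omega> - (- \<bar>k\<bar>)) - 1)" for \<omega>
  proof (cases "k > 0")
    case True
    have "\<bar>D \<omega>\<bar> \<le> k * max 0 (exp (X \<omega>) - 1)"
      using call_minus_forward_le[of "X \<omega> - k" "X \<omega>"] True by (simp add: D_def abs_if)
    also have "\<dots> \<le> k * max 0 (exp (X \<omega> - (- \<bar>k\<bar>)) - 1)"
      using True by (intro mult_left_mono max.mono) auto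
    finally show ?thesis using True by simp
  next
    case False
    then show ?thesis
      using call_minus_forward_le[of "X \<omega>" "X \<omega> - k"] by (simp add: D_def abs_if)
  qed
  have "\<bar>expectation D\<bar> \<le> expectation (\<lambda>\<omega>. \<bar>k\<bar> * max 0 (exp (X \<omega> - (- \<bar>k\<bar>)) - 1))"
    unfolding real_norm_def[symmetric, of "expectation D"]
    by (rule norm_integral_le[OF intD]) (use intc[of "- \<bar>k\<bar>"] Dle in auto)
  also have "\<dots> = \<bar>k\<bar> * expectation (\<lambda>\<omega>. max 0 (exp (X \<omega> - (- \<bar>k\<bar>)) - 1))"
    by (rule integral_mult_right_zero)
  also have "\<dots> \<le> \<bar>k\<bar> * e"
  proof (rule mult_left_mono)
    have "expectation (\<lambda>\<omega>. max 0 (exp (X \<omega> - (- \<bar>k\<bar>)) - 1)) \<le> expectation (\<lambda>\<omega>. exp \<bar>k\<bar> * (max 0 (exp (X \<omega>) - 1) + (1 - exp (- \<bar>k\<bar>))))"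
    proof (rule integral_mono)
      show "integrable M (\<lambda>\<omega>. exp \<bar>k\<bar> * (max 0 (exp (X \<omega>) - 1) + (1 - exp (- \<bar>k\<bar>))))"
        using intc[of 0] by simp
      show "max 0 (exp (X \<omega> - (- \<bar>k\<bar>)) - 1) \<le> exp \<bar>k\<bar> * (max 0 (exp (X \<omega>) - 1) + (1 - exp (- \<bar>k\<bar>)))" for \<omega>
      proof -
        \<comment> \<open>Moving the log-strike from 0 to -|k| is absorbed by factoring out exp |k|:
          the new strike exp(-|k|) differs from 1 by \<open>1 - exp (- \<bar>k\<bar>)\<close>, which
          is all the payoff can gain.\<close>
        have one: "exp \<bar>k\<bar> * exp (- \<bar>k\<bar>) = 1" by (simp flip: exp_add)
        have "exp (X \<omega> - (- \<bar>k\<bar>)) - 1 = exp \<bar>k\<bar> * (exp (X \<omega>) - exp (- \<bar>k\<bar>))"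
          using one by (simp add: right_diff_distrib exp_add mult.commute)
        also have "\<dots> \<le> exp \<bar>k\<bar> * (max 0 (exp (X \<omega>) - 1) + (1 - exp (- \<bar>k\<bar>)))"
          by (intro mult_left_mono) auto
        finally show ?thesis by simp
      qed
    qed (rule intc)
    also have "\<dots> = e"
      using intc[of 0] by (simp add: e_def prob_space)
    finally show "expectation (\<lambda>\<omega>. max 0 (exp (X \<omega> - (- \<bar>k\<bar>)) - 1)) \<le> e" .
  qed simp
  finally have De: "\<bar>expectation D\<bar> \<le> \<bar>k\<bar> * e" .
  have "expectation D = expectation (\<lambda>\<omega>. max 0 (exp (X \<omega> - k) - 1)) - expectation (\<lambda>\<omega>. max 0 (exp (X \<omega>) - 1)) + k * T X"
    unfolding D_def TE[OF X] using intc[of k] intc[of 0] intm by simp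
  then have "expectation (\<lambda>\<omega>. max 0 (exp (X \<omega> - k) - 1)) - expectation (\<lambda>\<omega>. max 0 (exp (X \<omega>) - 1)) + k * T V
     = expectation D + k * (T V - T X)" by (simp add: algebra_simps)
  also have "\<bar>\<dots>\<bar> \<le> \<bar>expectation D\<bar> + \<bar>k * (T V - T X)\<bar>" by (rule abs_triangle_ineq)
  also have "\<dots> \<le> \<bar>k\<bar> * e + \<bar>k\<bar> * d"
    using De TVX by (intro add_mono) (auto simp: abs_mult mult_left_mono)
  finally show ?thesis
    unfolding T_def e_def by (simp add: algebra_simps)
qed simp

text \<open>Averaging \<open>1 - cos (v * Z t \<omega>)\<close> over a Gaussian v gives sqrt (2 pi)
  times the expectation of 1 - exp (- Z^2 / 2). Where |Z| > \<epsilon> that integrand is at least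
  the constant \<open>c\<close>, so Markov's inequality bounds the tail by an integral that vanishes
  under domination by a Gaussian.\<close>

lemma tail_tendsto_0:
  fixes Z :: "real \<Rightarrow> 'a \<Rightarrow> real"
  assumes Z [measurable]: "\<And>t. Z t \<in> borel_measurable M"
    and lim: "\<And>v. ((\<lambda>t. expectation (\<lambda>\<omega>. cos (v * Z t \<omega>))) \<longlongrightarrow> 1) (at_right 0)" and "\<epsilon> > 0"
  shows "((\<lambda>t. prob {\<omega> \<in> space M. \<epsilon> < \<bar>Z t \<omega>\<bar>}) \<longlongrightarrow> 0) (at_right 0)"
proof -
  define c where "c = 1 - exp (- \<epsilon>\<^sup>2 / 2)"
  have c: "c > 0" using \<open>\<epsilon> > 0\<close> by (simp add: c_def)
  define h where "h t v = exp (- v\<^sup>2 / 2) * (1 - expectation (\<lambda>\<omega>. cos (v * Z t \<omega>)))" for t v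
  have [measurable]: "h t \<in> borel_measurable borel" for t
    unfolding h_def[abs_def] by measurable
  have gi: "has_bochner_integral lborel (\<lambda>v::real. exp (- v\<^sup>2 / 2)) (sqrt (2 * pi))"
  proof -
    have "has_bochner_integral lborel (\<lambda>v. sqrt (2 * pi) * std_normal_density v) (sqrt (2 * pi) * 1)"
      by (intro has_bochner_integral_mult_right) (simp add: has_bochner_integral_iff)
    then show ?thesis by (simp add: std_normal_density_def)
  qed
  have intcos: "integrable M (\<lambda>\<omega>. cos (v * Z t \<omega>))" for v t
    by (rule integrable_const_bound[of _ 1]) auto
  have h1: "\<bar>1 - expectation (\<lambda>\<omega>. cos (v * Z t \<omega>))\<bar> \<le> 2" for v t
  proof -
    have "norm (expectation (\<lambda>\<omega>. cos (v * Z t \<omega>))) \<le> expectation (\<lambda>\<omega>. 1)"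
      by (rule norm_integral_le) (use intcos[of v t] in auto)
    then show ?thesis by (simp add: prob_space)
  qed
  have "((\<lambda>t. \<integral>v. h t v \<partial>lborel) \<longlongrightarrow> (\<integral>v. (\<lambda>_::real. 0) v \<partial>lborel)) (at_right 0)"
  proof (rule dominated_convergence_at_right_0)
    show "integrable lborel (\<lambda>v::real. exp (- v\<^sup>2 / 2) * 2)"
      using gi by (auto simp: has_bochner_integral_iff)
    show "AE v in lborel. ((\<lambda>t. h t v) \<longlongrightarrow> 0) (at_right 0)"
    proof (rule AE_I2)
      fix v :: real
      have "((\<lambda>t. h t v) \<longlongrightarrow> exp (- v\<^sup>2 / 2) * (1 - 1)) (at_right 0)"
        unfolding h_def by (intro tendsto_intros lim)
      then show "((\<lambda>t. h t v) \<longlongrightarrow> 0) (at_right 0)" by simp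
    qed
    show "AE v in lborel. norm (h t v) \<le> exp (- v\<^sup>2 / 2) * 2" for t
      using h1 by (intro AE_I2) (simp add: h_def abs_mult)
  qed auto
  then have lim0: "((\<lambda>t. 1 / (c * sqrt (2 * pi)) * (\<integral>v. h t v \<partial>lborel)) \<longlongrightarrow> 1 / (c * sqrt (2 * pi)) * 0) (at_right 0)"
    by (intro tendsto_intros) simp
  have bound: "prob {\<omega> \<in> space M. \<epsilon> < \<bar>Z t \<omega>\<bar>} \<le> 1 / (c * sqrt (2 * pi)) * (\<integral>v. h t v \<partial>lborel)" for t
  proof -
    have inte: "integrable M (\<lambda>\<omega>. sqrt (2 * pi) * (1 - exp (- (Z t \<omega>)\<^sup>2 / 2)))"
      by (intro integrable_mult_right Bochner_Integration.integrable_diff integrable_const integrable_const_bound[of _ 1]) auto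
    have "has_bochner_integral lborel (h t) (expectation (\<lambda>\<omega>. sqrt (2 * pi) * (1 - exp (- (Z t \<omega>)\<^sup>2 / 2))))"
    proof (rule tonelli_has_bochner_integral[where ?M1.0 = M and f = "\<lambda>\<omega> v. (1 - cos (v * Z t \<omega>)) * exp (- v\<^sup>2 / 2)"
          and g = "\<lambda>\<omega>. sqrt (2 * pi) * (1 - exp (- (Z t \<omega>)\<^sup>2 / 2))"])
      show "pair_sigma_finite M (lborel :: real measure)"
        by (intro pair_sigma_finite.intro sigma_finite_measure_axioms lborel.sigma_finite_measure_axioms)
      show "AE \<omega> in M. has_bochner_integral lborel (\<lambda>v. (1 - cos (v * Z t \<omega>)) * exp (- v\<^sup>2 / 2)) (sqrt (2 * pi) * (1 - exp (- (Z t \<omega>)\<^sup>2 / 2)))"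
        by (intro AE_I2 integral_cos_gaussian)
      show "AE v in lborel. has_bochner_integral M (\<lambda>\<omega>. (1 - cos (v * Z t \<omega>)) * exp (- v\<^sup>2 / 2)) (h t v)"
      proof (rule AE_I2)
        fix v :: real
        have "has_bochner_integral M (\<lambda>\<omega>. (1 - cos (v * Z t \<omega>)) * exp (- v\<^sup>2 / 2)) ((1 - expectation (\<lambda>\<omega>. cos (v * Z t \<omega>))) * exp (- v\<^sup>2 / 2))"
          using intcos[of v t]
          by (intro has_bochner_integral_mult_left has_bochner_integral_diff) (auto simp: has_bochner_integral_iff prob_space)
        then show "has_bochner_integral M (\<lambda>\<omega>. (1 - cos (v * Z t \<omega>)) * exp (- v\<^sup>2 / 2)) (h t v)"
          by (simp add: h_def mult.commute)
      qed
      show "has_bochner_integral M (\<lambda>\<omega>. sqrt (2 * pi) * (1 - exp (- (Z t \<omega>)\<^sup>2 / 2))) (expectation (\<lambda>\<omega>. sqrt (2 * pi) * (1 - exp (- (Z t \<omega>)\<^sup>2 / 2))))"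
        using inte by (rule has_bochner_integral_integrable)
    qed auto
    then have I: "(\<integral>v. h t v \<partial>lborel) = expectation (\<lambda>\<omega>. sqrt (2 * pi) * (1 - exp (- (Z t \<omega>)\<^sup>2 / 2)))"
      by (simp add: has_bochner_integral_iff)
    have "c * sqrt (2 * pi) * prob {\<omega> \<in> space M. \<epsilon> < \<bar>Z t \<omega>\<bar>} = expectation (\<lambda>\<omega>. c * sqrt (2 * pi) * indicator {\<omega> \<in> space M. \<epsilon> < \<bar>Z t \<omega>\<bar>} \<omega>)"
      by simp
    also have "\<dots> \<le> (\<integral>v. h t v \<partial>lborel)"
      unfolding I
    proof (rule integral_mono[OF _ inte])
      show "c * sqrt (2 * pi) * indicator {\<omega> \<in> space M. \<epsilon> < \<bar>Z t \<omega>\<bar>} \<omega> \<le> sqrt (2 * pi) * (1 - exp (- (Z t \<omega>)\<^sup>2 / 2))" for \<omega>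
      proof (cases "\<epsilon> < \<bar>Z t \<omega>\<bar>")
        case True
        then have "\<epsilon>\<^sup>2 \<le> (Z t \<omega>)\<^sup>2"
          using \<open>\<epsilon> > 0\<close> by (simp add: abs_le_square_iff[symmetric])
        then have "c \<le> 1 - exp (- (Z t \<omega>)\<^sup>2 / 2)" by (simp add: c_def)
        then have "sqrt (2 * pi) * (c * indicator {\<omega> \<in> space M. \<epsilon> < \<bar>Z t \<omega>\<bar>} \<omega>) \<le> sqrt (2 * pi) * (1 - exp (- (Z t \<omega>)\<^sup>2 / 2))"
          using c by (intro mult_left_mono) (auto simp: indicator_def)
        then show ?thesis by (simp add: mult_ac)
      qed (auto simp: indicator_def)
    qed (intro integrable_mult_right integrable_real_indicator; simp add: less_top[symmetric])
    finally show ?thesis using c by (simp add: field_simps)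
  qed
  show ?thesis
    by (rule tendsto_sandwich[OF _ _ tendsto_const lim0[simplified]]) (use bound in \<open>auto intro!: always_eventually\<close>)
qed

end

section \<open>The CGMY model with a Brownian component\<close>

context prob_space
begin

lemma indep_var_process_at:
  assumes "indep_processes M W L" "0 \<le> t"
  shows "indep_var borel (W t) borel (L t)"
proof -
  have "indep_var borel ((\<lambda>f. f t) \<circ> (\<lambda>\<omega>. \<lambda>t\<in>{0..}. W t \<omega>)) borel ((\<lambda>f. f t) \<circ> (\<lambda>\<omega>. \<lambda>t\<in>{0..}. L t \<omega>))"
    using assms unfolding indep_processes_def
    by (intro indep_var_compose[of "Pi\<^sub>M {0..} (\<lambda>_. borel)" _ "Pi\<^sub>M {0..} (\<lambda>_. borel)"] measurable_component_singleton) auto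
  moreover have "(\<lambda>f. f t) \<circ> (\<lambda>\<omega>. \<lambda>t\<in>{0..}. Z t \<omega>) = Z t" for Z :: "real \<Rightarrow> 'a \<Rightarrow> real"
    using assms by (auto simp: fun_eq_iff)
  ultimately show ?thesis by simp
qed

lemma brownian_distributed:
  assumes "standard_brownian_motion M W" "0 < t"
  shows "distributed M lborel (W t) (normal_density 0 (sqrt t))"
proof -
  have [measurable]: "W t \<in> borel_measurable M" "W 0 \<in> borel_measurable M"
    using assms by (auto simp: standard_brownian_motion_def)
  have d: "distributed M lborel (\<lambda>\<omega>. W t \<omega> - W 0 \<omega>) (normal_density 0 (sqrt t))"
    using assms by (auto simp: standard_brownian_motion_def)
  have "AE \<omega> in M. W t \<omega> - W 0 \<omega> = W t \<omega>"
    using assms by (auto simp: standard_brownian_motion_def elim: eventually_mono)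
  then have "distr M lborel (\<lambda>\<omega>. W t \<omega> - W 0 \<omega>) = distr M lborel (W t)"
    by (intro distr_cong_AE) auto
  with d show ?thesis
    by (simp add: distributed_def)
qed

lemma char_brownian:
  assumes "standard_brownian_motion M W" "0 < t" "0 < \<sigma>"
  shows "char (distr M borel (\<lambda>\<omega>. \<sigma> * W t \<omega>)) u = of_real (exp (- (t * \<sigma>\<^sup>2 * u\<^sup>2 / 2)))"
proof -
  have [measurable]: "W t \<in> borel_measurable M"
    using assms by (auto simp: standard_brownian_motion_def)
  have "distributed M lborel (\<lambda>\<omega>. (W t \<omega> - 0) / sqrt t) std_normal_density"
    using brownian_distributed[OF assms(1,2)] normal_standard_normal_convert[of "sqrt t" "W t" 0] assms by simp
  then have d: "distr M lborel (\<lambda>\<omega>. (W t \<omega> - 0) / sqrt t) = std_normal_distribution"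
    by (simp add: distributed_def)
  have "char (distr M borel (\<lambda>\<omega>. \<sigma> * W t \<omega>)) u = (CLINT \<omega>|M. iexp (u * (\<sigma> * W t \<omega>)))"
    unfolding char_def by (subst integral_distr) auto
  also have "\<dots> = (CLINT \<omega>|M. iexp (u * \<sigma> * sqrt t * ((W t \<omega> - 0) / sqrt t)))"
    using assms by simp
  also have "\<dots> = (CLINT x|distr M lborel (\<lambda>\<omega>. (W t \<omega> - 0) / sqrt t). iexp (u * \<sigma> * sqrt t * x))"
    by (subst integral_distr) auto
  also have "\<dots> = char std_normal_distribution (u * \<sigma> * sqrt t)"
    unfolding d char_def ..
  also have "\<dots> = of_real (exp (- (u * \<sigma> * sqrt t)\<^sup>2 / 2))"
    by (simp add: char_std_normal_distribution)
  finally show ?thesis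
    using assms by (simp add: power_mult_distrib mult_ac)
qed

text \<open>The density of W_t is at most 1 / sqrt (2 pi t). Intervals whose length is a fixed
  multiple of sqrt t thus have a probability bounded uniformly in t and in their position.\<close>

lemma brownian_interval_le:
  assumes "standard_brownian_motion M W" "0 < t" "0 < \<sigma>" "0 \<le> h"
  shows "prob {\<omega> \<in> space M. c \<le> \<sigma> * W t \<omega> \<and> \<sigma> * W t \<omega> \<le> c + h} \<le> h / (\<sigma> * sqrt (2 * pi * t))"
proof -
  have [measurable]: "W t \<in> borel_measurable M"
    using assms by (auto simp: standard_brownian_motion_def)
  have A: "{\<omega> \<in> space M. c \<le> \<sigma> * W t \<omega> \<and> \<sigma> * W t \<omega> \<le> c + h} = W t -` {c / \<sigma>..(c + h) / \<sigma>} \<inter> space M"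
    using assms by (auto simp: divide_le_eq le_divide_eq mult.commute)
  have "emeasure M (W t -` {c / \<sigma>..(c + h) / \<sigma>} \<inter> space M) = (\<integral>\<^sup>+x. ennreal (normal_density 0 (sqrt t) x) * indicator {c / \<sigma>..(c + h) / \<sigma>} x \<partial>lborel)"
    by (rule distributed_emeasure[OF brownian_distributed[OF assms(1,2)]]) auto
  also have "\<dots> \<le> (\<integral>\<^sup>+x. ennreal (1 / sqrt (2 * pi * t)) * indicator {c / \<sigma>..(c + h) / \<sigma>} x \<partial>lborel)"
  proof (intro nn_integral_mono mult_right_mono ennreal_leI)
    fix x :: real
    have "exp (- x\<^sup>2 / (2 * t)) \<le> 1" using assms by simp
    then show "normal_density 0 (sqrt t) x \<le> 1 / sqrt (2 * pi * t)"
      using assms by (simp add: normal_density_def divide_right_mono)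
  qed auto
  also have "\<dots> = ennreal (1 / sqrt (2 * pi * t)) * ennreal ((c + h) / \<sigma> - c / \<sigma>)"
  proof -
    have "c / \<sigma> \<le> (c + h) / \<sigma>" using assms by (intro divide_right_mono) auto
    then show ?thesis by (subst nn_integral_cmult_indicator) simp_all
  qed
  also have "\<dots> = ennreal (h / (\<sigma> * sqrt (2 * pi * t)))"
  proof -
    have eq: "(c + h) / \<sigma> - c / \<sigma> = h / \<sigma>" by (simp add: add_divide_distrib)
    have "ennreal (1 / sqrt (2 * pi * t)) * ennreal (h / \<sigma>) = ennreal (1 / sqrt (2 * pi * t) * (h / \<sigma>))"
      using assms by (intro ennreal_mult[symmetric]) auto
    then show ?thesis unfolding eq by (simp add: mult.commute)
  qed
  finally show ?thesis
    unfolding A using assms by (simp add: emeasure_eq_measure)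
qed

text \<open>When |L| \<le> h, the events c \<le> L + V and c \<le> V can differ only if V lies
  within h of c. The interval hypothesis is used below c for one inequality and above c for the
  other.\<close>

lemma tail_prob_close:
  fixes L V :: "'a \<Rightarrow> real"
  assumes [measurable]: "L \<in> borel_measurable M" "V \<in> borel_measurable M"
    and V: "\<And>c. prob {\<omega> \<in> space M. c \<le> V \<omega> \<and> V \<omega> \<le> c + h} \<le> d"
  shows "\<bar>prob {\<omega> \<in> space M. c \<le> L \<omega> + V \<omega>} - prob {\<omega> \<in> space M. c \<le> V \<omega>}\<bar> \<le> prob {\<omega> \<in> space M. h < \<bar>L \<omega>\<bar>} + d"
proof -
  have "prob {\<omega> \<in> space M. c \<le> L \<omega> + V \<omega>} \<le> prob ({\<omega> \<in> space M. c \<le> V \<omega>} \<union> ({\<omega> \<in> space M. h < \<bar>L \<omega>\<bar>} \<union> {\<omega> \<in> space M. c - h \<le> V \<omega> \<and> V \<omega> \<le> (c - h) + h}))"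
    by (rule finite_measure_mono) auto
  also have "\<dots> \<le> prob {\<omega> \<in> space M. c \<le> V \<omega>} + (prob {\<omega> \<in> space M. h < \<bar>L \<omega>\<bar>} + prob {\<omega> \<in> space M. c - h \<le> V \<omega> \<and> V \<omega> \<le> (c - h) + h})"
    by (intro order_trans[OF measure_Un_le] add_left_mono measure_Un_le) auto
  also have "\<dots> \<le> prob {\<omega> \<in> space M. c \<le> V \<omega>} + (prob {\<omega> \<in> space M. h < \<bar>L \<omega>\<bar>} + d)"
    by (intro add_left_mono V)
  finally have 1: "prob {\<omega> \<in> space M. c \<le> L \<omega> + V \<omega>} - prob {\<omega> \<in> space M. c \<le> V \<omega>} \<le> prob {\<omega> \<in> space M. h < \<bar>L \<omega>\<bar>} + d" by simp
  have "prob {\<omega> \<in> space M. c \<le> V \<omega>} \<le> prob ({\<omega> \<in> space M. c \<le> L \<omega> + V \<omega>} \<union> ({\<omega> \<in> space M. h < \<bar>L \<omega>\<bar>} \<union> {\<omega> \<in> space M. c \<le> V \<omega> \<and> V \<omega> \<le> c + h}))"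
    by (rule finite_measure_mono) auto
  also have "\<dots> \<le> prob {\<omega> \<in> space M. c \<le> L \<omega> + V \<omega>} + (prob {\<omega> \<in> space M. h < \<bar>L \<omega>\<bar>} + prob {\<omega> \<in> space M. c \<le> V \<omega> \<and> V \<omega> \<le> c + h})"
    by (intro order_trans[OF measure_Un_le] add_left_mono measure_Un_le) auto
  also have "\<dots> \<le> prob {\<omega> \<in> space M. c \<le> L \<omega> + V \<omega>} + (prob {\<omega> \<in> space M. h < \<bar>L \<omega>\<bar>} + d)"
    by (intro add_left_mono V)
  finally show ?thesis using 1 by linarith
qed

end

section \<open>Transform, price at the money and shifted strike in the model\<close>

locale cgmy_model = prob_space P + cgmy_params C G M Y \<sigma>
  for P :: "'a measure" and C G M Y \<sigma> :: real +
  fixes W L :: "real \<Rightarrow> 'a \<Rightarrow> real"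
  assumes bm: "standard_brownian_motion P W"
    and cgmy: "cgmy_process P C G M Y L"
    and indep: "indep_processes P W L"
    and integrable_exp: "\<And>t. 0 \<le> t \<Longrightarrow> integrable P (\<lambda>\<omega>. exp (L t \<omega> + \<sigma> * W t \<omega>))"
    and martingale: "\<And>t. 0 \<le> t \<Longrightarrow> expectation (\<lambda>\<omega>. exp (L t \<omega> + \<sigma> * W t \<omega>)) = 1"
begin

lemma process_measurable:
  assumes "0 \<le> t"
  shows "L t \<in> borel_measurable P" "W t \<in> borel_measurable P"
  using assms cgmy bm by (auto simp: cgmy_process_def levy_process_def standard_brownian_motion_def)

lemma char_L:
  obtains b where "\<And>t u. 0 \<le> t \<Longrightarrow> char (distr P borel (L t)) u = exp (of_real t * levy_exponent b 0 nu u)"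
  using cgmy that unfolding cgmy_process_def has_levy_triplet_def by blast

lemma char_log_price:
  obtains b where "\<And>t u. 0 < t \<Longrightarrow> (\<integral>\<omega>. exp (\<i> * of_real u * of_real (L t \<omega> + \<sigma> * W t \<omega>)) \<partial>P)
    = exp (of_real t * (of_real b * (\<i> * of_real u) + jump_exponent (\<i> * of_real u) + of_real (\<sigma>\<^sup>2 / 2) * (\<i> * of_real u)\<^sup>2))"
proof -
  obtain b0 where b0: "\<And>t u. 0 \<le> t \<Longrightarrow> char (distr P borel (L t)) u = exp (of_real t * levy_exponent b0 0 nu u)"
    by (rule char_L) blast
  obtain b where b: "\<And>u. levy_exponent b0 0 nu u = \<i> * of_real (b * u) + jump_exponent (\<i> * of_real u)"
    using levy_exponent_nu by blast
  show ?thesis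
  proof (rule that[of b])
    fix t u :: real assume t: "0 < t"
    note [measurable] = process_measurable[OF less_imp_le[OF t]]
    have "indep_var borel (W t) borel (L t)"
      using t by (intro indep_var_process_at indep) auto
    then have "indep_var borel ((\<lambda>x. \<sigma> * x) \<circ> W t) borel ((\<lambda>x. x) \<circ> L t)"
      by (rule indep_var_compose) auto
    then have "indep_var borel (\<lambda>\<omega>. \<sigma> * W t \<omega>) borel (\<lambda>\<omega>. L t \<omega>)" by (simp add: comp_def)
    from char_distr_add[OF this, of u]
    have "char (distr P borel (\<lambda>\<omega>. \<sigma> * W t \<omega> + L t \<omega>)) u = of_real (exp (- (t * \<sigma>\<^sup>2 * u\<^sup>2 / 2))) * exp (of_real t * levy_exponent b0 0 nu u)"
      using t \<sigma> by (simp add: char_brownian[OF bm] b0)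
    also have "\<dots> = exp (of_real (- (t * \<sigma>\<^sup>2 * u\<^sup>2 / 2)) + of_real t * levy_exponent b0 0 nu u)"
      by (simp only: exp_of_real[symmetric] exp_add)
    also have "of_real (- (t * \<sigma>\<^sup>2 * u\<^sup>2 / 2)) + of_real t * levy_exponent b0 0 nu u
      = of_real t * (of_real b * (\<i> * of_real u) + jump_exponent (\<i> * of_real u) + of_real (\<sigma>\<^sup>2 / 2) * (\<i> * of_real u)\<^sup>2)"
      by (simp add: b power_mult_distrib algebra_simps)
    finally have "char (distr P borel (\<lambda>\<omega>. \<sigma> * W t \<omega> + L t \<omega>)) u
      = exp (of_real t * (of_real b * (\<i> * of_real u) + jump_exponent (\<i> * of_real u) + of_real (\<sigma>\<^sup>2 / 2) * (\<i> * of_real u)\<^sup>2))" .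
    moreover have "char (distr P borel (\<lambda>\<omega>. \<sigma> * W t \<omega> + L t \<omega>)) u = (\<integral>\<omega>. exp (\<i> * of_real u * of_real (L t \<omega> + \<sigma> * W t \<omega>)) \<partial>P)"
      unfolding char_def by (subst integral_distr) (auto simp: add.commute mult.assoc)
    ultimately show "(\<integral>\<omega>. exp (\<i> * of_real u * of_real (L t \<omega> + \<sigma> * W t \<omega>)) \<partial>P)
      = exp (of_real t * (of_real b * (\<i> * of_real u) + jump_exponent (\<i> * of_real u) + of_real (\<sigma>\<^sup>2 / 2) * (\<i> * of_real u)\<^sup>2))"
      by simp
  qed
qed

text \<open>The drift is eliminated: knowing the transform up to the edge of the strip allows z = 1,
  where the jump exponent vanishes and the martingale condition determines b. The quadratic then
  takes the form \<open>z\<^sup>2 - z\<close>.\<close>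

lemma mgf_log_price:
  assumes "0 < t" "0 \<le> Re z" "Re z \<le> 1"
  shows "(\<integral>\<omega>. exp (z * of_real (L t \<omega> + \<sigma> * W t \<omega>)) \<partial>P)
    = exp (of_real t * (jump_exponent z + of_real (\<sigma>\<^sup>2 / 2) * (z\<^sup>2 - z)))"
proof -
  obtain b where b: "\<And>t u. 0 < t \<Longrightarrow> (\<integral>\<omega>. exp (\<i> * of_real u * of_real (L t \<omega> + \<sigma> * W t \<omega>)) \<partial>P)
    = exp (of_real t * (of_real b * (\<i> * of_real u) + jump_exponent (\<i> * of_real u) + of_real (\<sigma>\<^sup>2 / 2) * (\<i> * of_real u)\<^sup>2))"
    by (rule char_log_price) blast
  have mgf: "(\<integral>\<omega>. exp (z * of_real (L t \<omega> + \<sigma> * W t \<omega>)) \<partial>P)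
      = exp (of_real t * (of_real b * z + jump_exponent z + of_real (\<sigma>\<^sup>2 / 2) * z\<^sup>2))"
    if "0 < t" "0 \<le> Re z" "Re z \<le> 1" for t z
  proof (rule mgf_strip_continuation[where g = "\<lambda>z. exp (of_real t * (of_real b * z + jump_exponent z + of_real (\<sigma>\<^sup>2 / 2) * z\<^sup>2))"])
    note [measurable] = process_measurable[OF less_imp_le[OF that(1)]]
    show "(\<lambda>\<omega>. L t \<omega> + \<sigma> * W t \<omega>) \<in> borel_measurable P" by measurable
    show "continuous_on {z. 0 \<le> Re z \<and> Re z \<le> 1} (\<lambda>z. exp (of_real t * (of_real b * z + jump_exponent z + of_real (\<sigma>\<^sup>2 / 2) * z\<^sup>2)))"
      by (intro continuous_intros jump_exponent_continuous)
    show "(\<lambda>z. exp (of_real t * (of_real b * z + jump_exponent z + of_real (\<sigma>\<^sup>2 / 2) * z\<^sup>2))) holomorphic_on {z. 0 < Re z \<and> Re z < 1}"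
      by (intro holomorphic_intros jump_exponent_holomorphic)
  qed (use that integrable_exp b in auto)
  \<comment> \<open>Evaluation at z = 1 and time 1. Since b is real, exp (b + \<sigma>^2 / 2) = 1
    gives b without the ambiguity of multiples of 2 pi i.\<close>
  have "complex_of_real (exp (b + \<sigma>\<^sup>2 / 2)) = exp (of_real 1 * (of_real b * 1 + jump_exponent 1 + of_real (\<sigma>\<^sup>2 / 2) * 1\<^sup>2))"
  proof -
    have "of_real 1 * (of_real b * 1 + jump_exponent 1 + of_real (\<sigma>\<^sup>2 / 2) * 1\<^sup>2) = complex_of_real (b + \<sigma>\<^sup>2 / 2)"
      by (simp add: jump_exponent_1)
    then show ?thesis by (simp only: exp_of_real)
  qed
  also have "\<dots> = (\<integral>\<omega>. exp (1 * of_real (L 1 \<omega> + \<sigma> * W 1 \<omega>)) \<partial>P)"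
    by (rule mgf[symmetric]) auto
  also have "\<dots> = (\<integral>\<omega>. complex_of_real (exp (L 1 \<omega> + \<sigma> * W 1 \<omega>)) \<partial>P)"
    by (simp only: mult_1 exp_of_real)
  also have "\<dots> = complex_of_real 1"
    by (simp only: integral_complex_of_real martingale[of 1, simplified])
  finally have "exp (b + \<sigma>\<^sup>2 / 2) = 1" by (simp only: of_real_eq_iff)
  then have "b = - (\<sigma>\<^sup>2 / 2)" by simp
  then have b': "complex_of_real b = - of_real (\<sigma>\<^sup>2 / 2)" by (simp only: of_real_minus)
  have "- s * z + j + s * z\<^sup>2 = j + s * (z\<^sup>2 - z)" for s j :: complex
    by (simp add: algebra_simps)
  then have "of_real b * z + jump_exponent z + of_real (\<sigma>\<^sup>2 / 2) * z\<^sup>2 = jump_exponent z + of_real (\<sigma>\<^sup>2 / 2) * (z\<^sup>2 - z)"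
    unfolding b' .
  with mgf[OF assms] show ?thesis by (simp only:)
qed

lemma atm_price_eq_fourier_price:
  assumes t: "0 < t"
  shows "expectation (\<lambda>\<omega>. max 0 (exp (L t \<omega> + \<sigma> * W t \<omega>) - 1)) = fourier_price phase t"
proof -
  note [measurable] = process_measurable[OF less_imp_le[OF t]]
  define X where "X \<omega> = L t \<omega> + \<sigma> * W t \<omega>" for \<omega>
  have [measurable]: "X \<in> borel_measurable P" unfolding X_def[abs_def] by measurable
  have intX: "integrable P (\<lambda>\<omega>. exp (X \<omega>))" using integrable_exp[of t] t by (simp add: X_def)
  have c: "expectation (\<lambda>\<omega>. exp (X \<omega> / 2) * cos (u * X \<omega>)) = gauss t u * (exp (- (t * rho u)) * cos (t * phase u))" for u
  proof -
    define z where "z = 1/2 + \<i> * of_real u"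
    have z: "0 \<le> Re z" "Re z \<le> 1" by (auto simp: z_def)
    have int: "integrable P (\<lambda>\<omega>. exp (z * of_real (X \<omega>)))"
    proof (rule Bochner_Integration.integrable_bound)
      show "integrable P (\<lambda>\<omega>. 1 + exp (X \<omega>))" using intX by simp
      show "AE \<omega> in P. norm (exp (z * of_real (X \<omega>))) \<le> norm (1 + exp (X \<omega>))"
        using norm_exp_strip_le[OF z] by (intro AE_I2) (simp add: add_nonneg_nonneg)
    qed measurable
    have "expectation (\<lambda>\<omega>. exp (X \<omega> / 2) * cos (u * X \<omega>)) = expectation (\<lambda>\<omega>. Re (exp (z * of_real (X \<omega>))))"
      by (simp add: z_def Re_exp)
    also have "\<dots> = Re (\<integral>\<omega>. exp (z * of_real (X \<omega>)) \<partial>P)"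
      by (rule integral_Re[OF int])
    also have "\<dots> = Re (exp (of_real t * (jump_exponent z + of_real (\<sigma>\<^sup>2 / 2) * (z\<^sup>2 - z))))"
      unfolding X_def mgf_log_price[OF t z] ..
    also have "of_real t * (jump_exponent z + of_real (\<sigma>\<^sup>2 / 2) * (z\<^sup>2 - z)) = Complex (- (t * rho u) + - (t * (\<sigma>\<^sup>2 / 2) * (u\<^sup>2 + 1/4))) (t * phase u)"
    proof -
      have e1: "z\<^sup>2 - z = of_real (- (u\<^sup>2 + 1/4))"
        by (simp add: z_def power2_eq_square complex_eq_iff field_simps)
      have e2: "jump_exponent z = Complex (- rho u) (phase u)"
        unfolding z_def phase_def Re_jump_exponent[symmetric] by simp
      show ?thesis
        unfolding e1 e2 by (simp add: complex_eq_iff algebra_simps)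
    qed
    also have "Re (exp (Complex (- (t * rho u) + - (t * (\<sigma>\<^sup>2 / 2) * (u\<^sup>2 + 1/4))) (t * phase u))) = gauss t u * (exp (- (t * rho u)) * cos (t * phase u))"
      unfolding Re_exp gauss_def complex.sel exp_add by simp
    finally show ?thesis .
  qed
  have "expectation (\<lambda>\<omega>. max 0 (exp (X \<omega>) - 1)) = fourier_price phase t"
    unfolding fourier_price_def c[symmetric] using martingale[of t] t
    by (intro call_price_fourier intX) (auto simp: X_def)
  then show ?thesis by (simp add: X_def)
qed

lemma jump_tail_tendsto_0:
  assumes "0 < \<epsilon>"
  shows "((\<lambda>t. prob {\<omega> \<in> space P. \<epsilon> * sqrt t < \<bar>L t \<omega>\<bar>}) \<longlongrightarrow> 0) (at_right 0)"
proof -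
  obtain b where b: "\<And>t u. 0 \<le> t \<Longrightarrow> char (distr P borel (L t)) u = exp (of_real t * levy_exponent b 0 nu u)"
    by (rule char_L) blast
  \<comment> \<open>The value 0 for t \<le> 0 only provides a random variable for every real index,
    as \<open>tail_tendsto_0\<close> demands; the limit sees positive times alone.\<close>
  define Z where "Z t \<omega> = (if 0 < t then L t \<omega> / sqrt t else 0)" for t \<omega>
  have Zm [measurable]: "Z t \<in> borel_measurable P" for t
    using process_measurable[of t] unfolding Z_def[abs_def] by (cases "0 < t") auto
  have "((\<lambda>t. prob {\<omega> \<in> space P. \<epsilon> < \<bar>Z t \<omega>\<bar>}) \<longlongrightarrow> 0) (at_right 0)"
  proof (rule tail_tendsto_0[OF Zm _ assms])
    fix v :: real
    have "((\<lambda>t. Re (exp (of_real t * levy_exponent b 0 nu (v / sqrt t)))) \<longlongrightarrow> Re (exp 0)) (at_right 0)"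
      by (intro tendsto_Re tendsto_exp levy_exponent_scaled_tendsto)
    then have "((\<lambda>t. Re (exp (of_real t * levy_exponent b 0 nu (v / sqrt t)))) \<longlongrightarrow> 1) (at_right 0)" by simp
    then show "((\<lambda>t. expectation (\<lambda>\<omega>. cos (v * Z t \<omega>))) \<longlongrightarrow> 1) (at_right 0)"
    proof (rule Lim_transform_eventually)
      show "\<forall>\<^sub>F t in at_right 0. Re (exp (of_real t * levy_exponent b 0 nu (v / sqrt t))) = expectation (\<lambda>\<omega>. cos (v * Z t \<omega>))"
        using eventually_at_right_less[of 0]
      proof eventually_elim
        fix t :: real assume t: "0 < t"
        note [measurable] = process_measurable[OF less_imp_le[OF t]]
        have int: "integrable P (\<lambda>\<omega>. iexp (v / sqrt t * L t \<omega>))"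
          by (rule integrable_iexp) auto
        have "exp (of_real t * levy_exponent b 0 nu (v / sqrt t)) = char (distr P borel (L t)) (v / sqrt t)"
          using b t by simp
        also have "\<dots> = (CLINT \<omega>|P. iexp (v / sqrt t * L t \<omega>))"
          unfolding char_def by (subst integral_distr) auto
        finally have "Re (exp (of_real t * levy_exponent b 0 nu (v / sqrt t))) = expectation (\<lambda>\<omega>. Re (iexp (v / sqrt t * L t \<omega>)))"
          by (simp only: integral_Re[OF int])
        also have "\<dots> = expectation (\<lambda>\<omega>. cos (v * Z t \<omega>))"
          using t by (intro Bochner_Integration.integral_cong) (auto simp: Z_def Re_exp)
        finally show "Re (exp (of_real t * levy_exponent b 0 nu (v / sqrt t))) = expectation (\<lambda>\<omega>. cos (v * Z t \<omega>))" .
      qed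
    qed
  qed
  then show ?thesis
  proof (rule Lim_transform_eventually)
    show "\<forall>\<^sub>F t in at_right 0. prob {\<omega> \<in> space P. \<epsilon> < \<bar>Z t \<omega>\<bar>} = prob {\<omega> \<in> space P. \<epsilon> * sqrt t < \<bar>L t \<omega>\<bar>}"
      using eventually_at_right_less[of 0]
    proof eventually_elim
      fix t :: real assume t: "0 < t"
      then have "(\<epsilon> < \<bar>Z t \<omega>\<bar>) = (\<epsilon> * sqrt t < \<bar>L t \<omega>\<bar>)" for \<omega>
        by (simp add: Z_def abs_divide less_divide_eq)
      then show "prob {\<omega> \<in> space P. \<epsilon> < \<bar>Z t \<omega>\<bar>} = prob {\<omega> \<in> space P. \<epsilon> * sqrt t < \<bar>L t \<omega>\<bar>}" by simp
    qed
  qed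
qed

text \<open>This will be the o(\<kappa>) remainder: by construction the normalised price plus
  \<open>c_kappa\<close> equals the price at the money plus this quantity.\<close>

definition shift_error :: "(real \<Rightarrow> real) \<Rightarrow> real \<Rightarrow> real" where
  "shift_error \<kappa> t = expectation (\<lambda>\<omega>. max 0 (exp (L t \<omega> + \<sigma> * W t \<omega> - \<kappa> t) - 1))
     - expectation (\<lambda>\<omega>. max 0 (exp (L t \<omega> + \<sigma> * W t \<omega>) - 1)) + c_kappa P W \<sigma> \<kappa> t"

lemma c_kappa_eq:
  "c_kappa P W \<sigma> \<kappa> t = \<kappa> t * (\<integral>w. indicator {0<..<1} w * prob {\<omega> \<in> space P. \<kappa> t * w \<le> \<sigma> * W t \<omega>} \<partial>lborel)"
  unfolding c_kappa_def interval_lebesgue_integral_def set_lebesgue_integral_def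
  by (simp add: zero_ereal_def one_ereal_def)

text \<open>The tolerance c is shared in thirds between the convexity error, which is small because
  the price at the money and \<kappa> vanish, the tail of L beyond
  \<open>\<epsilon> * sqrt t\<close>, and the Brownian interval of that length.\<close>

lemma shift_error_small:
  assumes \<kappa>: "(\<kappa> \<longlongrightarrow> 0) (at_right 0)" and price0: "((\<lambda>t. expectation (\<lambda>\<omega>. max 0 (exp (L t \<omega> + \<sigma> * W t \<omega>) - 1))) \<longlongrightarrow> 0) (at_right 0)"
  shows "shift_error \<kappa> \<in> o[at_right 0](\<kappa>)"
proof (rule landau_o.smallI)
  fix c :: real assume c: "c > 0"
  \<comment> \<open>Chosen so that the interval bound h / (\<sigma> sqrt (2 pi t)) equals c / 3 when
    h = \<epsilon> sqrt t.\<close>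
  define \<epsilon> where "\<epsilon> = c / 3 * \<sigma> * sqrt (2 * pi)"
  have \<epsilon>: "\<epsilon> > 0" using c \<sigma> by (simp add: \<epsilon>_def)
  define a where "a t = expectation (\<lambda>\<omega>. max 0 (exp (L t \<omega> + \<sigma> * W t \<omega>) - 1))" for t
  have "((\<lambda>t. exp \<bar>\<kappa> t\<bar> * (a t + (1 - exp (- \<bar>\<kappa> t\<bar>)))) \<longlongrightarrow> exp \<bar>0\<bar> * (0 + (1 - exp (- \<bar>0\<bar>)))) (at_right 0)"
    unfolding a_def by (intro tendsto_intros \<kappa> price0)
  then have "((\<lambda>t. exp \<bar>\<kappa> t\<bar> * (a t + (1 - exp (- \<bar>\<kappa> t\<bar>)))) \<longlongrightarrow> 0) (at_right 0)" by simp
  then have e1: "\<forall>\<^sub>F t in at_right 0. exp \<bar>\<kappa> t\<bar> * (a t + (1 - exp (- \<bar>\<kappa> t\<bar>))) < c / 3"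
    using c by (intro order_tendstoD(2)) auto
  have e2: "\<forall>\<^sub>F t in at_right 0. prob {\<omega> \<in> space P. \<epsilon> * sqrt t < \<bar>L t \<omega>\<bar>} < c / 3"
    using c by (intro order_tendstoD(2)[OF jump_tail_tendsto_0[OF \<epsilon>]]) auto
  show "\<forall>\<^sub>F t in at_right 0. norm (shift_error \<kappa> t) \<le> c * norm (\<kappa> t)"
    using e1 e2 eventually_at_right_less[of 0]
  proof eventually_elim
    fix t :: real
    assume 1: "exp \<bar>\<kappa> t\<bar> * (a t + (1 - exp (- \<bar>\<kappa> t\<bar>))) < c / 3"
      and 2: "prob {\<omega> \<in> space P. \<epsilon> * sqrt t < \<bar>L t \<omega>\<bar>} < c / 3" and t: "0 < t"
    note [measurable] = process_measurable[OF less_imp_le[OF t]]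
    have "prob {\<omega> \<in> space P. s \<le> \<sigma> * W t \<omega> \<and> \<sigma> * W t \<omega> \<le> s + \<epsilon> * sqrt t} \<le> c / 3" for s
    proof -
      have "prob {\<omega> \<in> space P. s \<le> \<sigma> * W t \<omega> \<and> \<sigma> * W t \<omega> \<le> s + \<epsilon> * sqrt t} \<le> \<epsilon> * sqrt t / (\<sigma> * sqrt (2 * pi * t))"
        using \<epsilon> t \<sigma> by (intro brownian_interval_le bm) auto
      also have "\<dots> = c / 3"
        using t \<sigma> by (simp add: \<epsilon>_def real_sqrt_mult)
      finally show ?thesis .
    qed
    then have close: "\<bar>prob {\<omega> \<in> space P. s \<le> L t \<omega> + \<sigma> * W t \<omega>} - prob {\<omega> \<in> space P. s \<le> \<sigma> * W t \<omega>}\<bar> \<le> prob {\<omega> \<in> space P. \<epsilon> * sqrt t < \<bar>L t \<omega>\<bar>} + c / 3" for s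
      by (intro tail_prob_close) auto
    have "\<bar>prob {\<omega> \<in> space P. s \<le> L t \<omega> + \<sigma> * W t \<omega>} - prob {\<omega> \<in> space P. s \<le> \<sigma> * W t \<omega>}\<bar> \<le> 2 * c / 3" for s
      using 2 close[of s] by linarith
    then have "\<bar>shift_error \<kappa> t\<bar> \<le> \<bar>\<kappa> t\<bar> * (2 * c / 3 + exp \<bar>\<kappa> t\<bar> * (a t + (1 - exp (- \<bar>\<kappa> t\<bar>))))"
      unfolding shift_error_def c_kappa_eq a_def using integrable_exp[of t] t
      by (intro call_shift_bound) auto
    also have "\<dots> \<le> \<bar>\<kappa> t\<bar> * c"
      using 1 by (intro mult_left_mono) auto
    finally show "norm (shift_error \<kappa> t) \<le> c * norm (\<kappa> t)"
      by (simp add: mult.commute)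
  qed
qed

end

theorem theorem3p2:
  fixes P :: "'a measure"
    and W L X S :: "real \<Rightarrow> 'a \<Rightarrow> real"
    and C G M Y \<sigma> S0 d1 d2 d31 d32 :: real
  assumes "prob_space P"
    and "C > 0" and "G > 0" and "M > 1" and "1 < Y" and "Y < 2" and "\<sigma> > 0" and "S0 > 0"
    and "standard_brownian_motion P W"
    and "cgmy_process P C G M Y L"
    and "indep_processes P W L"
    and "\<And>t \<omega>. t \<ge> 0 \<Longrightarrow> X t \<omega> = L t \<omega> + \<sigma> * W t \<omega>"
    and "\<And>t \<omega>. t \<ge> 0 \<Longrightarrow> S t \<omega> = S0 * exp (X t \<omega>)"
    and "\<And>t. t \<ge> 0 \<Longrightarrow> integrable P (\<lambda>\<omega>. exp (X t \<omega>))"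
    and "\<And>t. t \<ge> 0 \<Longrightarrow> (\<integral>\<omega>. exp (X t \<omega>) \<partial>P) = 1"
    and "d1 = \<sigma> / sqrt (2 * pi)"
    and "d2 = C * 2 powr ((1 - Y) / 2) * \<sigma> powr (1 - Y) / (sqrt pi * Y * (Y - 1)) * Gamma (1 - Y / 2)"
    and "d31 = C * Gamma (- Y) / 2 *
           ((M - 1) powr Y - M powr Y - (G + 1) powr Y + G powr Y)"
    and "d32 = - (1 / pi) * \<sigma> powr (1 - 2 * Y) * C\<^sup>2 * (cos (pi * Y / 2))\<^sup>2 * (Gamma (- Y))\<^sup>2
           * 2 powr (Y - 1 / 2) * Gamma (Y - 1 / 2)"
  shows "\<exists>r2 r3 :: real \<Rightarrow> real.
           r2 \<in> o[at_right 0](\<lambda>t. t) \<and>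
           r3 \<in> o[at_right 0](\<lambda>t. t powr (5 / 2 - Y)) \<and>
           (\<forall>\<kappa> :: real \<Rightarrow> real. (\<kappa> \<longlongrightarrow> 0) (at_right 0) \<longrightarrow>
             (\<exists>r1 :: real \<Rightarrow> real.
                r1 \<in> o[at_right 0](\<kappa>) \<and>
                (\<forall>\<^sub>F t in at_right 0.
                   exp (- \<kappa> t) / S0 * (\<integral>\<omega>. max 0 (S t \<omega> - S0 * exp (\<kappa> t)) \<partial>P)
                     + c_kappa P W \<sigma> \<kappa> t
                   = d1 * t powr (1 / 2) + d2 * t powr ((3 - Y) / 2) + d31 * t
                     + d32 * t powr (5 / 2 - Y)
                     + r1 t + r2 t + r3 t)))"
proof -
  have X: "\<And>t \<omega>. t \<ge> 0 \<Longrightarrow> X t \<omega> = L t \<omega> + \<sigma> * W t \<omega>"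
    and S: "\<And>t \<omega>. t \<ge> 0 \<Longrightarrow> S t \<omega> = S0 * exp (X t \<omega>)"
    and S0: "S0 > 0" by fact+
  interpret prob_space P by fact
  interpret cgmy_model P C G M Y \<sigma> W L
  proof unfold_locales
    show "integrable P (\<lambda>\<omega>. exp (L t \<omega> + \<sigma> * W t \<omega>))" if "0 \<le> t" for t
      using assms(14)[OF that] X[OF that] by simp
    show "expectation (\<lambda>\<omega>. exp (L t \<omega> + \<sigma> * W t \<omega>)) = 1" if "0 \<le> t" for t
      using assms(15)[OF that] X[OF that] by simp
  qed (use assms in auto)
  define a where "a t = expectation (\<lambda>\<omega>. max 0 (exp (L t \<omega> + \<sigma> * W t \<omega>) - 1))" for t
  obtain K where K: "\<And>u. \<bar>phase u\<bar> \<le> K * \<bar>u\<bar>" using phase_bound by blast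
  obtain r2 r3 :: "real \<Rightarrow> real" where r2: "r2 \<in> o[at_right 0](\<lambda>t. t)" and r3: "r3 \<in> o[at_right 0](\<lambda>t. t powr (5/2 - Y))"
    and price: "\<And>t. 0 < t \<Longrightarrow> fourier_price phase t = \<sigma> / sqrt (2 * pi) * t powr (1/2)
      + C * 2 powr ((1 - Y) / 2) * \<sigma> powr (1 - Y) / (sqrt pi * Y * (Y - 1)) * Gamma (1 - Y / 2) * t powr ((3 - Y) / 2)
      + linear_coeff * t
      + - (1 / pi) * \<sigma> powr (1 - 2 * Y) * C\<^sup>2 * (cos (pi * Y / 2))\<^sup>2 * (Gamma (- Y))\<^sup>2
           * 2 powr (Y - 1 / 2) * Gamma (Y - 1 / 2) * t powr (5/2 - Y) + r2 t + r3 t"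
    using fourier_price_expansion[OF phase_measurable K] by blast
  have a_eq: "a t = d1 * t powr (1 / 2) + d2 * t powr ((3 - Y) / 2) + d31 * t + d32 * t powr (5 / 2 - Y) + r2 t + r3 t" if "0 < t" for t
    unfolding a_def atm_price_eq_fourier_price[OF that] price[OF that] assms(16,17,18,19) linear_coeff_def ..
  have null: "(f \<longlongrightarrow> 0) (at_right 0)" if f: "f \<in> o[at_right 0](g)" and g: "(g \<longlongrightarrow> 0) (at_right 0)" for f g :: "real \<Rightarrow> real"
  proof (rule Lim_null_comparison)
    show "\<forall>\<^sub>F t in at_right 0. norm (f t) \<le> norm (g t)"
      using landau_o.smallD[OF f, of 1] by simp
    show "((\<lambda>t. norm (g t)) \<longlongrightarrow> 0) (at_right 0)" using g by (rule tendsto_norm_zero)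
  qed
  have powr0: "((\<lambda>t::real. t powr e) \<longlongrightarrow> 0) (at_right 0)" if "0 < e" for e
    using that by real_asymp
  \<comment> \<open>The expansion itself shows that the price at the money vanishes: all its
    exponents are positive, in particular 5/2 - Y > 1/2 since Y < 2.\<close>
  have "((\<lambda>t. d1 * t powr (1 / 2) + d2 * t powr ((3 - Y) / 2) + d31 * t + d32 * t powr (5 / 2 - Y) + r2 t + r3 t)
     \<longlongrightarrow> d1 * 0 + d2 * 0 + d31 * 0 + d32 * 0 + 0 + 0) (at_right 0)"
    using Y2 by (intro tendsto_intros powr0 null[OF r2] null[OF r3]) auto
  then have "((\<lambda>t. d1 * t powr (1 / 2) + d2 * t powr ((3 - Y) / 2) + d31 * t + d32 * t powr (5 / 2 - Y) + r2 t + r3 t) \<longlongrightarrow> 0) (at_right 0)"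
    by simp
  then have a0: "(a \<longlongrightarrow> 0) (at_right 0)"
    by (rule Lim_transform_eventually) (use eventually_at_right_less[of 0] a_eq in \<open>auto elim!: eventually_mono\<close>)
  show ?thesis
  \<comment> \<open>\<open>r2\<close> and \<open>r3\<close> are fixed before \<kappa> is introduced,
    which is the asserted independence of \<kappa>.\<close>
  proof (rule exI[of _ r2], rule exI[of _ r3], intro conjI r2 r3 allI impI)
    fix \<kappa> :: "real \<Rightarrow> real" assume \<kappa>: "(\<kappa> \<longlongrightarrow> 0) (at_right 0)"
    show "\<exists>r1. r1 \<in> o[at_right 0](\<kappa>) \<and>
      (\<forall>\<^sub>F t in at_right 0.
         exp (- \<kappa> t) / S0 * (\<integral>\<omega>. max 0 (S t \<omega> - S0 * exp (\<kappa> t)) \<partial>P) + c_kappa P W \<sigma> \<kappa> t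
         = d1 * t powr (1 / 2) + d2 * t powr ((3 - Y) / 2) + d31 * t + d32 * t powr (5 / 2 - Y) + r1 t + r2 t + r3 t)"
    proof (intro exI[of _ "shift_error \<kappa>"] conjI)
      show "shift_error \<kappa> \<in> o[at_right 0](\<kappa>)"
        using shift_error_small[OF \<kappa>] a0 unfolding a_def[abs_def] by blast
      show "\<forall>\<^sub>F t in at_right 0.
         exp (- \<kappa> t) / S0 * (\<integral>\<omega>. max 0 (S t \<omega> - S0 * exp (\<kappa> t)) \<partial>P) + c_kappa P W \<sigma> \<kappa> t
         = d1 * t powr (1 / 2) + d2 * t powr ((3 - Y) / 2) + d31 * t + d32 * t powr (5 / 2 - Y) + shift_error \<kappa> t + r2 t + r3 t"
        using eventually_at_right_less[of 0]
      proof eventually_elim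
        fix t :: real assume t: "0 < t"
        have "max 0 (S t \<omega> - S0 * exp (\<kappa> t)) = S0 * exp (\<kappa> t) * max 0 (exp (L t \<omega> + \<sigma> * W t \<omega> - \<kappa> t) - 1)" for \<omega>
        proof -
          have "S t \<omega> - S0 * exp (\<kappa> t) = S0 * exp (\<kappa> t) * (exp (L t \<omega> + \<sigma> * W t \<omega> - \<kappa> t) - 1)"
            using t S X by (simp add: right_diff_distrib exp_diff)
          moreover have "0 < S0 * exp (\<kappa> t)" using S0 by simp
          ultimately show ?thesis by (simp add: max_mult_distrib_left)
        qed
        then have "(\<integral>\<omega>. max 0 (S t \<omega> - S0 * exp (\<kappa> t)) \<partial>P) = S0 * exp (\<kappa> t) * expectation (\<lambda>\<omega>. max 0 (exp (L t \<omega> + \<sigma> * W t \<omega> - \<kappa> t) - 1))"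
          by (simp only: integral_mult_right_zero)
        moreover have "exp (- \<kappa> t) / S0 * (S0 * exp (\<kappa> t) * e) = e" for e
          using S0 by (simp add: exp_minus)
        ultimately have "exp (- \<kappa> t) / S0 * (\<integral>\<omega>. max 0 (S t \<omega> - S0 * exp (\<kappa> t)) \<partial>P) = expectation (\<lambda>\<omega>. max 0 (exp (L t \<omega> + \<sigma> * W t \<omega> - \<kappa> t) - 1))"
          by (simp only:)
        then have "exp (- \<kappa> t) / S0 * (\<integral>\<omega>. max 0 (S t \<omega> - S0 * exp (\<kappa> t)) \<partial>P) + c_kappa P W \<sigma> \<kappa> t = a t + shift_error \<kappa> t"
          by (simp add: shift_error_def a_def)
        then show "exp (- \<kappa> t) / S0 * (\<integral>\<omega>. max 0 (S t \<omega> - S0 * exp (\<kappa> t)) \<partial>P) + c_kappa P W \<sigma> \<kappa> t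
         = d1 * t powr (1 / 2) + d2 * t powr ((3 - Y) / 2) + d31 * t + d32 * t powr (5 / 2 - Y) + shift_error \<kappa> t + r2 t + r3 t"
          unfolding a_eq[OF t] by simp
      qed
    qed
  qed
qed

end
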